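(* Let $S\subset\mathbb{R}^2$ be a set of at least $9$ points in general position. Every geometric graph on $S$ that is supporting for $S$ has two edges that cross (i.e. it is not a plane drawing).
   Context: General position: no three points collinear. Two labeled point sets in general position have the same order type under a bijection $\varphi$ if every triple $(p,q,r)$ of distinct points has the same orientation as $(\varphi(p),\varphi(q),\varphi(r))$. A geometric graph on $S$ is a graph with vertex set $S$ whose edges are drawn as straight segments between their endpoints. An ambient isotopy of $\mathbb{R}^2$ is a continuous map $f:\mathbb{R}^2\times[0,1]\to\mathbb{R}^2$ with $f(\cdot,t)$ a homeomorphism for every $t$ and $f(\cdot,0)$ the identity. A geometric graph $G$ on $S$ is supporting for $S$ if every ambient isotopy $f$ such that for every $t\in[0,1]$ the image under $f(\cdot,t)$ of each edge of $G$ is a straight segment and no four points of $f(S,t)$ are collinear, preserves the order type, i.e. for each $t$ with $f(S,t)$ in general position, $f(S,t)$ has the same order type as $S$ under $s\mapsto f(s,t)$. *)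

theory Defs
  imports "HOL-Analysis.Analysis"
begin

type_synonym point = "real \<times> real"

definition orient :: "point \<Rightarrow> point \<Rightarrow> point \<Rightarrow> real" where
  "orient p q r = sgn ((fst q - fst p) * (snd r - snd p) - (snd q - snd p) * (fst r - fst p))"

definition general_position :: "point set \<Rightarrow> bool" where
  "general_position S \<longleftrightarrow>
     (\<forall>p\<in>S. \<forall>q\<in>S. \<forall>r\<in>S. p \<noteq> q \<and> p \<noteq> r \<and> q \<noteq> r \<longrightarrow> \<not> collinear {p, q, r})"

definition no_four_collinear :: "point set \<Rightarrow> bool" where
  "no_four_collinear S \<longleftrightarrow>
     (\<forall>p\<in>S. \<forall>q\<in>S. \<forall>r\<in>S. \<forall>s\<in>S. p \<noteq> q \<and> p \<noteq> r \<and> p \<noteq> s \<and> q \<noteq> r \<and> q \<noteq> s \<and> r \<noteq> s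
        \<longrightarrow> \<not> collinear {p, q, r, s})"

definition same_order_type :: "point set \<Rightarrow> (point \<Rightarrow> point) \<Rightarrow> bool" where
  "same_order_type S \<phi> \<longleftrightarrow>
     (\<forall>p\<in>S. \<forall>q\<in>S. \<forall>r\<in>S. p \<noteq> q \<and> p \<noteq> r \<and> q \<noteq> r \<longrightarrow>
        orient (\<phi> p) (\<phi> q) (\<phi> r) = orient p q r)"

text \<open>A geometric graph on S: a set of edges, each a 2-element subset of S;
  the edge e is drawn as the straight segment convex hull e.\<close>
definition geometric_graph_on :: "point set \<Rightarrow> point set set \<Rightarrow> bool" where
  "geometric_graph_on S E \<longleftrightarrow> (\<forall>e\<in>E. \<exists>p q. p \<in> S \<and> q \<in> S \<and> p \<noteq> q \<and> e = {p, q})"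

definition ambient_isotopy :: "(real \<Rightarrow> point \<Rightarrow> point) \<Rightarrow> bool" where
  "ambient_isotopy F \<longleftrightarrow>
     continuous_on (UNIV \<times> {0..1}) (\<lambda>(x, t). F t x) \<and>
     (\<forall>t\<in>{0..1}. \<exists>g. homeomorphism UNIV UNIV (F t) g) \<and>
     F 0 = id"

definition supporting :: "point set \<Rightarrow> point set set \<Rightarrow> bool" where
  "supporting S E \<longleftrightarrow>
     (\<forall>F. ambient_isotopy F \<and>
          (\<forall>t\<in>{0..1}. (\<forall>e\<in>E. \<exists>a b. F t ` (convex hull e) = closed_segment a b)
                       \<and> no_four_collinear (F t ` S))
        \<longrightarrow> (\<forall>t\<in>{0..1}. general_position (F t ` S) \<longrightarrow> same_order_type S (F t)))"

definition has_crossing :: "point set set \<Rightarrow> bool" where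
  "has_crossing E \<longleftrightarrow>
     (\<exists>e1\<in>E. \<exists>e2\<in>E. e1 \<noteq> e2 \<and> ((convex hull e1) \<inter> (convex hull e2)) - (e1 \<inter> e2) \<noteq> {})"

end

theory Submission
  imports Defs
begin

text \<open>
  A supporting graph stays supporting when edges are added, so suppose it is a maximal plane graph
  \<open>T\<close>. Whenever the vertices of \<open>S\<close> move continuously so that the straight-line drawing of \<open>T\<close> remains
  plane, the motion extends to an ambient isotopy; hence the order type cannot change, because a
  triple that becomes collinear could then be pushed through. Fix the extreme points of \<open>S\<close> and give
  the edges at the other vertices positive weights. As in Tutte's embedding theorem, a balanced
  drawing that has the order type of \<open>S\<close> up to degenerate triples is plane, so along a continuous
  change of weights the order type is preserved: every balanced drawing, for every choice of
  positive weights, has the order type of \<open>S\<close>. But the weights can be concentrated so that a connected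
  group of inner vertices collapses to any extreme point adjacent to it, and going to different
  extreme points changes the orientation of some triple. This works directly if there are at least
  four extreme points; for a triangular hull one plays off the vertices adjacent to both ends of the
  three hull edges against each other. If all points are extreme, some ear can be flattened across a
  missing edge.
\<close>

section \<open>Ambient isotopies from moving plane drawings\<close>

text \<open>The continuity argument plays closed against open conditions. \<open>weak_type\<close>
  is what survives of \<open>same_type\<close> in a limit, and \<open>plane_config\<close> is open;
  so everything hinges on showing that a balanced drawing that is merely \<open>weak_type\<close> is
  still plane. Balance does this: if vertices coincide or fall on an edge, the equilibrium of forces
  traps a set of inner vertices behind at most two others, which \<open>inner_set_boundary\<close>
  forbids. Maximality of the graph enters through visibility, by following the first edge that
  blocks a segment. The supporting property compares order types in general position only, and it
  forbids four collinear points on the way. Therefore a motion towards a degenerate moment is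
  stopped just before it and a single vertex is pushed across a line, so that only triples
  containing that vertex can degenerate. Weights are directed, \<open>w u x\<close> being
  independent of \<open>w x u\<close>. This lets them be changed one vertex at a time, with an
  explicit formula for the new drawing, and lets a group of vertices be pulled along a tree towards
  a chosen extreme point.\<close>

definition plane_config :: "point set \<Rightarrow> point set set \<Rightarrow> (point \<Rightarrow> point) \<Rightarrow> bool" where
  "plane_config S T p \<longleftrightarrow> (\<forall>a\<in>S. \<forall>b\<in>S. \<forall>c\<in>S. \<forall>d\<in>S.
     (a = b \<or> {a, b} \<in> T) \<longrightarrow> (c = d \<or> {c, d} \<in> T) \<longrightarrow> {a, b} \<inter> {c, d} = {} \<longrightarrow>
     closed_segment (p a) (p b) \<inter> closed_segment (p c) (p d) = {})"

lemma plane_config_disjoint: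
  assumes "plane_config S T p" "a \<in> S" "b \<in> S" "c \<in> S" "d \<in> S"
    "a = b \<or> {a, b} \<in> T" "c = d \<or> {c, d} \<in> T" "{a, b} \<inter> {c, d} = {}"
  shows "closed_segment (p a) (p b) \<inter> closed_segment (p c) (p d) = {}"
  using assms unfolding plane_config_def by blast

text \<open>Vertices count as degenerate edges \<open>a = b\<close> in \<open>plane_config\<close>,
  so its single disjointness condition yields injectivity here and, in the next lemma, that no
  vertex lies on an edge. The latter also controls edges with a common endpoint: an overlap beyond
  it would put the far end of one edge on the other.\<close>

lemma plane_config_inj:
  assumes "plane_config S T p" "a \<in> S" "b \<in> S" "a \<noteq> b"
  shows "p a \<noteq> p b"
  using plane_config_disjoint[of S T p a a b b] assms by auto

lemma plane_config_vertex:
  assumes "plane_config S T p" "a \<in> S" "b \<in> S" "{a, b} \<in> T" "s \<in> S" "s \<noteq> a" "s \<noteq> b"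
  shows "p s \<notin> closed_segment (p a) (p b)"
  using plane_config_disjoint[of S T p a b s s] assms by auto

lemma geometric_graph_edgeD:
  assumes "geometric_graph_on S T" "{a, b} \<in> T"
  shows "a \<in> S" "b \<in> S" "a \<noteq> b"
  using assms unfolding geometric_graph_on_def by (metis doubleton_eq_iff)+

text \<open>McShane's formula takes the infimum over \<open>i\<close> of
  \<open>f i + L * dist x (g i)\<close>. The data are indexed by \<open>i\<close> instead of by
  points, so that points of different edges can be treated uniformly; the Lipschitz hypothesis
  forces equal values wherever \<open>g i = g j\<close>.\<close>

lemma McShane_extension:
  fixes f :: "'i \<Rightarrow> real" and g :: "'i \<Rightarrow> 'a::metric_space"
  assumes "Z \<noteq> {}" "L \<ge> 0"
    and lip: "\<And>i j. i \<in> Z \<Longrightarrow> j \<in> Z \<Longrightarrow> \<bar>f i - f j\<bar> \<le> L * dist (g i) (g j)"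
  obtains h where "\<And>x y. \<bar>h x - h y\<bar> \<le> L * dist x y" "\<And>i. i \<in> Z \<Longrightarrow> h (g i) = f i"
proof -
  define h where "h x = (INF i\<in>Z. f i + L * dist x (g i))" for x
  have lower: "f j - L * dist x (g j) \<le> f i + L * dist x (g i)" if "i \<in> Z" "j \<in> Z" for i j x
  proof -
    have "f j - f i \<le> L * dist (g j) (g i)"
      using lip[OF that] by (simp add: dist_commute abs_le_iff)
    also have "\<dots> \<le> L * (dist x (g j) + dist x (g i))"
      by (intro mult_left_mono \<open>L \<ge> 0\<close> dist_triangle3)
    finally show ?thesis
      by (simp add: algebra_simps)
  qed
  have bdd: "bdd_below ((\<lambda>i. f i + L * dist x (g i)) ` Z)" for x
  proof -
    obtain j where "j \<in> Z"
      using \<open>Z \<noteq> {}\<close> by blast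
    then show ?thesis
      using lower by (intro bdd_belowI2[of _ "f j - L * dist x (g j)"]) blast
  qed
  have le: "h x \<le> h y + L * dist x y" for x y
  proof -
    have "h x - L * dist x y \<le> f i + L * dist y (g i)" if "i \<in> Z" for i
    proof -
      have "h x \<le> f i + L * dist x (g i)"
        unfolding h_def by (rule cINF_lower[OF bdd that])
      also have "\<dots> \<le> f i + L * (dist x y + dist y (g i))"
        by (intro add_left_mono mult_left_mono \<open>L \<ge> 0\<close> dist_triangle)
      finally show ?thesis
        by (simp add: algebra_simps)
    qed
    then have "h x - L * dist x y \<le> h y"
      unfolding h_def[of y] by (intro cINF_greatest \<open>Z \<noteq> {}\<close>)
    then show ?thesis
      by simp
  qed
  have "\<bar>h x - h y\<bar> \<le> L * dist x y" for x y
    using le[of x y] le[of y x] by (simp add: dist_commute abs_le_iff)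
  moreover have "h (g i) = f i" if "i \<in> Z" for i
  proof (rule antisym)
    show "h (g i) \<le> f i"
      unfolding h_def using cINF_lower[OF bdd that, of "g i"] by simp
    show "f i \<le> h (g i)"
      unfolding h_def using lower[OF _ that, of _ "g i"] by (intro cINF_greatest \<open>Z \<noteq> {}\<close>) simp
  qed
  ultimately show ?thesis
    using that by blast
qed

text \<open>Solving \<open>x + \<phi> x = y\<close> means finding a fixed point of the contraction
  \<open>\<lambda>x. y - \<phi> x\<close>. Distances shrink at most by the factor
  \<open>1 - L\<close>, which gives injectivity and a Lipschitz inverse.\<close>

lemma homeomorphism_id_plus_contraction:
  fixes \<phi> :: "'a::euclidean_space \<Rightarrow> 'a"
  assumes "0 \<le> L" "L < 1" and lip: "\<And>x y. dist (\<phi> x) (\<phi> y) \<le> L * dist x y"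
  shows "\<exists>g. homeomorphism UNIV UNIV (\<lambda>x. x + \<phi> x) g"
proof -
  have expand: "(1 - L) * dist x y \<le> dist (x + \<phi> x) (y + \<phi> y)" for x y
  proof -
    have "dist x y \<le> dist (x + \<phi> x) (y + \<phi> y) + dist (\<phi> x) (\<phi> y)"
      using norm_triangle_ineq4[of "x + \<phi> x - (y + \<phi> y)" "\<phi> x - \<phi> y"] by (simp add: dist_norm)
    then show ?thesis
      using lip[of x y] by (simp add: algebra_simps)
  qed
  have "inj (\<lambda>x. x + \<phi> x)"
  proof (rule injI)
    fix x y assume "x + \<phi> x = y + \<phi> y"
    then have "(1 - L) * dist x y \<le> 0"
      using expand[of x y] by simp
    then show "x = y"
      using \<open>L < 1\<close> by (simp add: mult_le_0_iff)
  qed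
  moreover have "\<exists>x. y = x + \<phi> x" for y
  proof -
    have "\<exists>!x\<in>UNIV. y - \<phi> x = x"
      using lip by (intro Banach_fix[OF complete_UNIV _ \<open>0 \<le> L\<close> \<open>L < 1\<close>]) (auto simp: dist_norm norm_minus_commute)
    then show ?thesis
      by (metis add.commute diff_add_cancel)
  qed
  ultimately have bij: "bij (\<lambda>x. x + \<phi> x)"
    by (simp add: bij_def surj_def)
  define g where "g = inv (\<lambda>x. x + \<phi> x)"
  have fg: "g y + \<phi> (g y) = y" for y
    unfolding g_def using surj_f_inv_f[OF bij_is_surj[OF bij]] by simp
  have gf: "g (x + \<phi> x) = x" for x
    unfolding g_def using inv_f_f[OF bij_is_inj[OF bij]] by simp
  have "continuous_on UNIV \<phi>"
    by (rule lipschitz_on_continuous_on[of L]) (use lip \<open>0 \<le> L\<close> in \<open>auto simp: lipschitz_on_def\<close>)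
  then have "continuous_on UNIV (\<lambda>x. x + \<phi> x)"
    by (intro continuous_intros)
  moreover have "continuous_on UNIV g"
  proof (rule lipschitz_on_continuous_on[of "1 / (1 - L)"])
    show "(1 / (1 - L))-lipschitz_on UNIV g"
      unfolding lipschitz_on_def
    proof (intro conjI ballI)
      fix x y :: 'a
      show "dist (g x) (g y) \<le> 1 / (1 - L) * dist x y"
        using expand[of "g x" "g y"] \<open>L < 1\<close> by (simp add: fg field_simps)
    qed (use \<open>L < 1\<close> in simp)
  qed
  ultimately have "homeomorphism UNIV UNIV (\<lambda>x. x + \<phi> x) g"
    using fg gf by (auto simp: homeomorphism_def surj_def) (metis gf fg)+
  then show ?thesis
    by blast
qed

text \<open>Interpolating the values \<open>v\<close> linearly along edges gives a function on the
  drawn graph that is Lipschitz for the distance of the plane: disjoint edges have positive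
  distance, and distinct edges at a common vertex enclose a positive angle. McShane's extension
  spreads it over the plane.\<close>

lemma plane_config_hat_functions:
  fixes p :: "point \<Rightarrow> point"
  assumes "finite S" "S \<noteq> {}" and T: "geometric_graph_on S T" and pc: "plane_config S T p"
    and v: "\<And>x. 0 \<le> v x \<and> v x \<le> (1::real)"
  obtains L h where "L \<ge> 0" "\<And>x y. \<bar>h x - h y\<bar> \<le> L * dist x y"
    "\<And>s. s \<in> S \<Longrightarrow> h (p s) = v s"
    "\<And>a b l. {a, b} \<in> T \<Longrightarrow> 0 \<le> l \<Longrightarrow> l \<le> 1 \<Longrightarrow>
       h (p a + l *\<^sub>R (p b - p a)) = v a + l * (v b - v a)"
proof -
  define Pr where "Pr = {(a, b). a \<in> S \<and> b \<in> S \<and> (a = b \<or> {a, b} \<in> T)}"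
  define pt where "pt a b l = p a + l *\<^sub>R (p b - p a)" for a b and l :: real
  define val where "val a b l = v a + l * (v b - v a)" for a b and l :: real
  have inj: "p a \<noteq> p b" if "a \<in> S" "b \<in> S" "a \<noteq> b" for a b
    using plane_config_inj[OF pc] that by blast
  have pt_seg: "pt a b l \<in> closed_segment (p a) (p b)" if "0 \<le> l" "l \<le> 1" for a b l
    unfolding pt_def in_segment using that by (intro exI[of _ l]) (simp add: algebra_simps)
  have val01: "0 \<le> val a b l \<and> val a b l \<le> 1" if "0 \<le> l" "l \<le> 1" for a b l
  proof -
    have "val a b l = (1 - l) * v a + l * v b"
      by (simp add: val_def algebra_simps)
    moreover have "(1 - l) * v a + l * v b \<le> (1 - l) * 1 + l * 1"
      using that v by (intro add_mono mult_left_mono) auto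
    ultimately show ?thesis
      using that v by auto
  qed
  \<comment> \<open>A Lipschitz bound between the points of two given edges; the constant may depend
    on the pair, since only finitely many pairs occur.\<close>
  define good where "good a b c d = (\<exists>L\<ge>0. \<forall>l m. 0 \<le> l \<and> l \<le> 1 \<and> 0 \<le> m \<and> m \<le> 1 \<longrightarrow>
      \<bar>val a b l - val c d m\<bar> \<le> L * dist (pt a b l) (pt c d m))" for a b c d
  have good_swap1: "good a b c d" if "good b a c d" for a b c d
  proof -
    obtain L where "L \<ge> 0" and L: "\<And>l m. 0 \<le> l \<Longrightarrow> l \<le> 1 \<Longrightarrow> 0 \<le> m \<Longrightarrow> m \<le> 1 \<Longrightarrow>
        \<bar>val b a l - val c d m\<bar> \<le> L * dist (pt b a l) (pt c d m)"
      using \<open>good b a c d\<close> unfolding good_def by blast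
    have "val b a (1 - l) = val a b l" "pt b a (1 - l) = pt a b l" for l
      by (simp_all add: val_def pt_def algebra_simps)
    then have "\<bar>val a b l - val c d m\<bar> \<le> L * dist (pt a b l) (pt c d m)"
      if "0 \<le> l" "l \<le> 1" "0 \<le> m" "m \<le> 1" for l m
      using L[of "1 - l" m] that by simp
    then show ?thesis
      unfolding good_def using \<open>L \<ge> 0\<close> by blast
  qed
  have good_sym: "good a b c d" if "good c d a b" for a b c d
    using that unfolding good_def by (metis abs_minus_commute dist_commute)
  have good_swap2: "good a b c d" if "good a b d c" for a b c d
    using good_sym good_swap1 that by blast
  have good_disjoint: "good a b c d" if "(a, b) \<in> Pr" "(c, d) \<in> Pr" "{a, b} \<inter> {c, d} = {}" for a b c d
  proof -
    have "closed_segment (p a) (p b) \<inter> closed_segment (p c) (p d) = {}"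
      by (rule plane_config_disjoint[OF pc]) (use that in \<open>auto simp: Pr_def\<close>)
    then obtain e where "e > 0" and e: "\<And>x y. x \<in> closed_segment (p a) (p b) \<Longrightarrow>
        y \<in> closed_segment (p c) (p d) \<Longrightarrow> e \<le> dist x y"
      using separate_compact_closed[of "closed_segment (p a) (p b)" "closed_segment (p c) (p d)"]
      by (metis closed_segment compact_segment)
    show ?thesis
      unfolding good_def
    proof (intro exI[of _ "1 / e"] conjI allI impI)
      fix l m :: real assume *: "0 \<le> l \<and> l \<le> 1 \<and> 0 \<le> m \<and> m \<le> 1"
      have "\<bar>val a b l - val c d m\<bar> \<le> 1"
        using val01[of l a b] val01[of m c d] * by auto
      also have "\<dots> \<le> 1 / e * dist (pt a b l) (pt c d m)"
        using e[OF pt_seg pt_seg, of l m] * \<open>e > 0\<close> by (simp add: field_simps)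
      finally show "\<bar>val a b l - val c d m\<bar> \<le> 1 / e * dist (pt a b l) (pt c d m)" .
    qed (use \<open>e > 0\<close> in simp)
  qed
  have good_shared: "good a b a d" if "(a, b) \<in> Pr" "(a, d) \<in> Pr" for a b d
  proof -
    define B D where "B = p b - p a" and "D = p d - p a"
    have S: "a \<in> S" "b \<in> S" "d \<in> S"
      using that by (auto simp: Pr_def)
    have ptd: "dist (pt a b l) (pt a d m) = norm (l *\<^sub>R B - m *\<^sub>R D)" for l m
      by (simp add: pt_def dist_norm B_def D_def)
    have vald: "val a b l - val a d m = l * (v b - v a) - m * (v d - v a)" for l m
      by (simp add: val_def)
    have v1: "\<bar>v x - v y\<bar> \<le> 1" for x y
      using v[of x] v[of y] by auto
    have valle: "\<bar>val a b l - val a d m\<bar> \<le> l + m" if "0 \<le> l" "0 \<le> m" for l m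
    proof -
      have "\<bar>val a b l - val a d m\<bar> \<le> \<bar>l * (v b - v a)\<bar> + \<bar>m * (v d - v a)\<bar>"
        unfolding vald by linarith
      also have "\<dots> \<le> l * 1 + m * 1"
        unfolding abs_mult using that v1 by (intro add_mono mult_mono) auto
      finally show ?thesis
        by simp
    qed
    consider "b = d" | "b \<noteq> d" "a = b" | "b \<noteq> d" "a = d" | "b \<noteq> d" "a \<noteq> b" "a \<noteq> d"
      by blast
    then show ?thesis
    proof cases
      case 1
      show ?thesis
      proof (cases "a = b")
        case True
        then show ?thesis
          using 1 unfolding good_def by (intro exI[of _ 0]) (simp add: val_def)
      next
        case False
        then have "norm B > 0"
          using inj S by (auto simp: B_def)
        have "\<bar>val a b l - val a d m\<bar> \<le> 1 / norm B * dist (pt a b l) (pt a d m)" for l m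
        proof -
          have "\<bar>val a b l - val a d m\<bar> = \<bar>l - m\<bar> * \<bar>v b - v a\<bar>"
            using vald[of l m] 1 by (simp add: left_diff_distrib[symmetric] abs_mult)
          also have "\<dots> \<le> \<bar>l - m\<bar>"
            using v1[of b a] by (simp add: mult_left_le)
          also have "\<dots> = 1 / norm B * dist (pt a b l) (pt a d m)"
            using \<open>norm B > 0\<close> 1 ptd[of l m]
            by (simp add: B_def D_def scaleR_left_diff_distrib[symmetric])
          finally show ?thesis .
        qed
        then show ?thesis
          unfolding good_def by (intro exI[of _ "1 / norm B"]) auto
      qed
    next
      case 2
      then have "norm D > 0"
        using inj S by (auto simp: D_def)
      have "\<bar>val a b l - val a d m\<bar> \<le> 1 / norm D * dist (pt a b l) (pt a d m)"
        if "0 \<le> m" for l m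
      proof -
        have "\<bar>val a b l - val a d m\<bar> = m * \<bar>v d - v a\<bar>"
          unfolding vald using 2 that by (simp add: abs_mult)
        also have "\<dots> \<le> m"
          using v1 that by (simp add: mult_left_le)
        also have "\<dots> = 1 / norm D * dist (pt a b l) (pt a d m)"
          using \<open>norm D > 0\<close> 2 that unfolding ptd by (simp add: B_def)
        finally show ?thesis .
      qed
      then show ?thesis
        unfolding good_def by (intro exI[of _ "1 / norm D"]) auto
    next
      case 3
      then have "norm B > 0"
        using inj S by (auto simp: B_def)
      have "\<bar>val a b l - val a d m\<bar> \<le> 1 / norm B * dist (pt a b l) (pt a d m)"
        if "0 \<le> l" for l m
      proof -
        have "\<bar>val a b l - val a d m\<bar> = l * \<bar>v b - v a\<bar>"
          unfolding vald using 3 that by (simp add: abs_mult)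
        also have "\<dots> \<le> l"
          using v1 that by (simp add: mult_left_le)
        also have "\<dots> = 1 / norm B * dist (pt a b l) (pt a d m)"
          using \<open>norm B > 0\<close> 3 that unfolding ptd by (simp add: D_def)
        finally show ?thesis .
      qed
      then show ?thesis
        unfolding good_def by (intro exI[of _ "1 / norm B"]) auto
    next
      case 4
      \<comment> \<open>Two distinct edges at \<open>a\<close>: neither contains the far end of the
        other, so \<open>B\<close> and \<open>D\<close> do not point in the same direction, and the
        norm of \<open>l *\<^sub>R B - m *\<^sub>R D\<close> is at least \<open>c * (l + m)\<close>,
        where \<open>c\<close> is its minimum over \<open>l + m = 1\<close>.\<close>
      have ed: "{a, b} \<in> T" "{a, d} \<in> T"
        using that 4 by (auto simp: Pr_def)
      have nseg: "p b \<notin> closed_segment (p a) (p d)" "p d \<notin> closed_segment (p a) (p b)"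
        using plane_config_vertex[OF pc _ _ ed(2), of b] plane_config_vertex[OF pc _ _ ed(1), of d] S 4 by auto
      have nz: "x *\<^sub>R B - (1 - x) *\<^sub>R D \<noteq> 0" if "0 \<le> x" "x \<le> 1" for x
      proof
        assume eq: "x *\<^sub>R B - (1 - x) *\<^sub>R D = 0"
        show False
        proof (cases "x \<le> 1 / 2")
          case True
          then have "(1 - x) *\<^sub>R ((x / (1 - x)) *\<^sub>R B) = (1 - x) *\<^sub>R D"
            using eq by simp
          then have "D = (x / (1 - x)) *\<^sub>R B"
            using True by (simp del: scaleR_scaleR)
          then have "p d = (1 - x / (1 - x)) *\<^sub>R p a + (x / (1 - x)) *\<^sub>R p b"
            by (simp add: B_def D_def algebra_simps)
          moreover have "0 \<le> x / (1 - x)" "x / (1 - x) \<le> 1"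
            using that True by (auto simp: field_simps)
          ultimately show False
            using nseg(2) unfolding in_segment by blast
        next
          case False
          then have "x *\<^sub>R (((1 - x) / x) *\<^sub>R D) = x *\<^sub>R B"
            using eq by simp
          then have "B = ((1 - x) / x) *\<^sub>R D"
            using False by (simp del: scaleR_scaleR)
          then have "p b = (1 - (1 - x) / x) *\<^sub>R p a + ((1 - x) / x) *\<^sub>R p d"
            by (simp add: B_def D_def algebra_simps)
          moreover have "0 \<le> (1 - x) / x" "(1 - x) / x \<le> 1"
            using that False by (auto simp: field_simps)
          ultimately show False
            using nseg(1) unfolding in_segment by blast
        qed
      qed
      have "continuous_on {0..1} (\<lambda>x. norm (x *\<^sub>R B - (1 - x) *\<^sub>R D))"
        by (intro continuous_intros)
      then obtain x0 where x0: "x0 \<in> {0..1}"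
        and min: "\<And>x. x \<in> {0..1} \<Longrightarrow> norm (x0 *\<^sub>R B - (1 - x0) *\<^sub>R D) \<le> norm (x *\<^sub>R B - (1 - x) *\<^sub>R D)"
        using continuous_attains_inf[of "{0..1::real}" "\<lambda>x. norm (x *\<^sub>R B - (1 - x) *\<^sub>R D)"] by auto
      define c where "c = norm (x0 *\<^sub>R B - (1 - x0) *\<^sub>R D)"
      have "c > 0"
        using nz[of x0] x0 by (simp add: c_def)
      have "\<bar>val a b l - val a d m\<bar> \<le> 1 / c * dist (pt a b l) (pt a d m)" if "0 \<le> l" "0 \<le> m" for l m
      proof (cases "l + m = 0")
        case True
        then have "l = 0" "m = 0"
          using that by auto
        then show ?thesis
          using \<open>c > 0\<close> by (simp add: vald)
      next
        case False
        define r where "r = l + m"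
        have "r > 0"
          using False that by (auto simp: r_def)
        have "c \<le> norm ((l / r) *\<^sub>R B - (1 - l / r) *\<^sub>R D)"
          unfolding c_def using that \<open>r > 0\<close> by (intro min) (auto simp: r_def field_simps)
        then have "r * c \<le> norm (r *\<^sub>R ((l / r) *\<^sub>R B - (1 - l / r) *\<^sub>R D))"
          using \<open>r > 0\<close> by simp
        also have "r *\<^sub>R ((l / r) *\<^sub>R B - (1 - l / r) *\<^sub>R D) = l *\<^sub>R B - m *\<^sub>R D"
          using \<open>r > 0\<close> by (simp add: scaleR_diff_right right_diff_distrib r_def)
        finally have "l + m \<le> 1 / c * dist (pt a b l) (pt a d m)"
          using \<open>c > 0\<close> unfolding ptd r_def by (simp add: field_simps)
        then show ?thesis
          using valle[OF that] by linarith
      qed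
      then show ?thesis
        unfolding good_def using \<open>c > 0\<close> by (intro exI[of _ "1 / c"]) auto
    qed
  qed
  have Pr_sym: "(b, a) \<in> Pr" if "(a, b) \<in> Pr" for a b
    using that by (auto simp: Pr_def insert_commute)
  have good_all: "good a b c d" if ab: "(a, b) \<in> Pr" and cd: "(c, d) \<in> Pr" for a b c d
  proof (cases "{a, b} \<inter> {c, d} = {}")
    case True
    then show ?thesis
      using good_disjoint that by blast
  next
    case False
    then consider "a = c" | "a = d" | "b = c" | "b = d"
      by blast
    then show ?thesis
    proof cases
      case 1
      then show ?thesis using good_shared[OF ab, of d] cd by simp
    next
      case 2
      then show ?thesis using good_swap2 good_shared[OF ab, of c] Pr_sym[OF cd] by simp
    next
      case 3
      then show ?thesis using good_swap1 good_shared[OF Pr_sym[OF ab], of d] cd by simp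
    next
      case 4
      then show ?thesis
        using good_swap1[OF good_swap2] good_shared[OF Pr_sym[OF ab], of c] Pr_sym[OF cd] by simp
    qed
  qed
  have "finite Pr"
    by (rule finite_subset[of _ "S \<times> S"]) (use \<open>finite S\<close> in \<open>auto simp: Pr_def\<close>)
  define P where "P = (\<lambda>((a, b), (c, d)) L. L \<ge> 0 \<and> (\<forall>l m. 0 \<le> l \<and> l \<le> 1 \<and> 0 \<le> m \<and> m \<le> 1 \<longrightarrow>
      \<bar>val a b l - val c d m\<bar> \<le> L * dist (pt a b l) (pt c d m)))"
  have "\<forall>z\<in>Pr \<times> Pr. \<exists>L. P z L"
    using good_all unfolding good_def P_def by auto
  then obtain LL where LL: "\<And>z. z \<in> Pr \<times> Pr \<Longrightarrow> P z (LL z)"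
    by metis
  \<comment> \<open>The sum of the finitely many nonnegative constants serves all pairs at
    once.\<close>
  define L where "L = (\<Sum>z\<in>Pr \<times> Pr. LL z)"
  have LL0: "LL z \<ge> 0" if "z \<in> Pr \<times> Pr" for z
    using LL[OF that] by (auto simp: P_def split: prod.splits)
  have "L \<ge> 0"
    unfolding L_def using LL0 by (intro sum_nonneg) auto
  have lip: "\<bar>val a b l - val c d m\<bar> \<le> L * dist (pt a b l) (pt c d m)"
    if "(a, b) \<in> Pr" "(c, d) \<in> Pr" "0 \<le> l" "l \<le> 1" "0 \<le> m" "m \<le> 1" for a b c d l m
  proof -
    have "((a, b), (c, d)) \<in> Pr \<times> Pr"
      using that by simp
    then have "LL ((a, b), (c, d)) \<le> L"
      unfolding L_def using LL0 \<open>finite Pr\<close> by (intro member_le_sum) auto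
    moreover have "\<bar>val a b l - val c d m\<bar> \<le> LL ((a, b), (c, d)) * dist (pt a b l) (pt c d m)"
      using LL[of "((a, b), (c, d))"] that by (simp add: P_def)
    ultimately show ?thesis
      by (meson mult_right_mono order_trans zero_le_dist)
  qed
  define Z where "Z = {(a, b, l). (a, b) \<in> Pr \<and> 0 \<le> l \<and> l \<le> (1::real)}"
  have "Z \<noteq> {}"
    using \<open>S \<noteq> {}\<close> by (force simp: Z_def Pr_def)
  then obtain h where h: "\<And>x y. \<bar>h x - h y\<bar> \<le> L * dist x y"
    "\<And>i. i \<in> Z \<Longrightarrow> h ((\<lambda>(a, b, l). pt a b l) i) = (\<lambda>(a, b, l). val a b l) i"
    by (rule McShane_extension[of Z L "\<lambda>(a, b, l). val a b l" "\<lambda>(a, b, l). pt a b l"])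
      (use \<open>L \<ge> 0\<close> lip in \<open>auto simp: Z_def\<close>)
  show ?thesis
  proof (rule that[OF \<open>L \<ge> 0\<close> h(1)])
    fix s assume "s \<in> S"
    then have "(s, s, 0) \<in> Z"
      by (simp add: Z_def Pr_def)
    from h(2)[OF this] show "h (p s) = v s"
      by (simp add: pt_def val_def)
  next
    fix a b and l :: real assume *: "{a, b} \<in> T" "0 \<le> l" "l \<le> 1"
    then have "(a, b, l) \<in> Z"
      using geometric_graph_edgeD[OF T] by (auto simp: Z_def Pr_def)
    from h(2)[OF this] show "h (p a + l *\<^sub>R (p b - p a)) = v a + l * (v b - v a)"
      by (simp add: pt_def val_def)
  qed
qed

text \<open>Bolzano's bisection principle reduces the claim to short intervals and to concatenation.
  The start \<open>a\<close> is arbitrary, with \<open>F a = id\<close>, so that successive motions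
  can be composed.\<close>

lemma plane_config_isotopy_aux:
  fixes \<gamma> :: "real \<Rightarrow> point \<Rightarrow> point"
  assumes "finite S" "S \<noteq> {}" and T: "geometric_graph_on S T"
    and cont: "\<And>s. s \<in> S \<Longrightarrow> continuous_on UNIV (\<lambda>t. \<gamma> t s)"
    and pc: "\<And>t. plane_config S T (\<gamma> t)"
    and "a \<le> b"
  shows "\<exists>F. continuous_on (UNIV \<times> {a..b}) (\<lambda>(x, t). F t x) \<and>
     (\<forall>t\<in>{a..b}. \<exists>g. homeomorphism UNIV UNIV (F t) g) \<and> F a = id \<and>
     (\<forall>t\<in>{a..b}. (\<forall>s\<in>S. F t (\<gamma> a s) = \<gamma> t s) \<and>
       (\<forall>u v. {u, v} \<in> T \<longrightarrow> F t ` closed_segment (\<gamma> a u) (\<gamma> a v) = closed_segment (\<gamma> t u) (\<gamma> t v)))"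
    (is "?P a b")
  using \<open>a \<le> b\<close>
proof (induction rule: Bolzano)
  case (trans a b c)
  from trans(1) obtain F where F: "continuous_on (UNIV \<times> {a..b}) (\<lambda>(x, t). F t x)"
    "\<And>t. t \<in> {a..b} \<Longrightarrow> \<exists>g. homeomorphism UNIV UNIV (F t) g" "F a = id"
    "\<And>t s. t \<in> {a..b} \<Longrightarrow> s \<in> S \<Longrightarrow> F t (\<gamma> a s) = \<gamma> t s"
    "\<And>t u v. t \<in> {a..b} \<Longrightarrow> {u, v} \<in> T \<Longrightarrow>
       F t ` closed_segment (\<gamma> a u) (\<gamma> a v) = closed_segment (\<gamma> t u) (\<gamma> t v)"
    by blast
  from trans(2) obtain G where G: "continuous_on (UNIV \<times> {b..c}) (\<lambda>(x, t). G t x)"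
    "\<And>t. t \<in> {b..c} \<Longrightarrow> \<exists>g. homeomorphism UNIV UNIV (G t) g" "G b = id"
    "\<And>t s. t \<in> {b..c} \<Longrightarrow> s \<in> S \<Longrightarrow> G t (\<gamma> b s) = \<gamma> t s"
    "\<And>t u v. t \<in> {b..c} \<Longrightarrow> {u, v} \<in> T \<Longrightarrow>
       G t ` closed_segment (\<gamma> b u) (\<gamma> b v) = closed_segment (\<gamma> t u) (\<gamma> t v)"
    by blast
  define K where "K t = (if t \<le> b then F t else G t \<circ> F b)" for t
  have "continuous_on UNIV (F b)"
    using F(2)[of b] trans(3) by (auto simp: homeomorphism_def)
  have "continuous_on (UNIV \<times> {b..c}) (\<lambda>z. (\<lambda>(x, t). G t x) (F b (fst z), snd z))"
    by (rule continuous_on_compose2[OF G(1)])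
      (auto intro!: continuous_intros continuous_on_compose2[OF \<open>continuous_on UNIV (F b)\<close>])
  then have "continuous_on (UNIV \<times> {b..c}) (\<lambda>(x, t). G t (F b x))"
    by (simp add: case_prod_unfold)
  have "continuous_on (UNIV \<times> {a..b} \<union> UNIV \<times> {b..c})
      (\<lambda>z. if snd z \<le> b then (\<lambda>(x, t). F t x) z else (\<lambda>(x, t). G t (F b x)) z)"
    by (rule continuous_on_If)
      (use F(1) \<open>continuous_on (UNIV \<times> {b..c}) (\<lambda>(x, t). G t (F b x))\<close> G(3)
        in \<open>auto intro!: closed_Times simp: not_le\<close>)
  moreover have "(UNIV :: point set) \<times> {a..b} \<union> UNIV \<times> {b..c} = UNIV \<times> {a..c}"
    using trans(3,4) by auto
  moreover have "(\<lambda>z. if snd z \<le> b then (\<lambda>(x, t). F t x) z else (\<lambda>(x, t). G t (F b x)) z) = (\<lambda>(x, t). K t x)"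
    by (auto simp: K_def)
  ultimately have "continuous_on (UNIV \<times> {a..c}) (\<lambda>(x, t). K t x)"
    by (simp only:)
  moreover have "\<exists>g. homeomorphism UNIV UNIV (K t) g" if "t \<in> {a..c}" for t
    using F(2)[of t] F(2)[of b] G(2)[of t] that trans(3,4) homeomorphism_compose
    unfolding K_def by (auto; blast)
  moreover have "K a = id"
    using F(3) trans(3) by (simp add: K_def)
  moreover have "K t (\<gamma> a s) = \<gamma> t s" if "t \<in> {a..c}" "s \<in> S" for t s
    using F(4)[of t s] F(4)[of b s] G(4)[of t s] that trans(3,4) by (auto simp: K_def)
  moreover have "K t ` closed_segment (\<gamma> a u) (\<gamma> a v) = closed_segment (\<gamma> t u) (\<gamma> t v)"
    if "t \<in> {a..c}" "{u, v} \<in> T" for t u v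
  proof (cases "t \<le> b")
    case True
    then show ?thesis
      using F(5)[of t u v] that by (simp add: K_def)
  next
    case False
    then have "K t ` closed_segment (\<gamma> a u) (\<gamma> a v) = G t ` F b ` closed_segment (\<gamma> a u) (\<gamma> a v)"
      by (simp add: K_def image_comp)
    then show ?thesis
      using False F(5)[of b u v] G(5)[of t u v] that trans(3,4) by simp
  qed
  ultimately show ?case
    by blast
next
  \<comment> \<open>Near \<open>\<tau>\<close> the plane is moved by the identity plus the vertex
    displacements weighted with hat functions \<open>h s\<close>. These are linear along edges, so
    edges go to edges.\<close>
  case (local \<tau>)
  have "\<forall>s\<in>S. \<exists>L h. L \<ge> 0 \<and> (\<forall>x y. \<bar>h x - h y\<bar> \<le> L * dist x y) \<and>
    (\<forall>r\<in>S. h (\<gamma> \<tau> r) = (if r = s then 1 else 0)) \<and>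
    (\<forall>a b l. {a, b} \<in> T \<longrightarrow> 0 \<le> l \<longrightarrow> l \<le> 1 \<longrightarrow> h (\<gamma> \<tau> a + l *\<^sub>R (\<gamma> \<tau> b - \<gamma> \<tau> a)) =
       (if a = s then 1 else 0) + l * ((if b = s then 1 else 0) - (if a = s then 1 else 0)))"
  proof
    fix s assume "s \<in> S"
    show "\<exists>L h. L \<ge> 0 \<and> (\<forall>x y. \<bar>h x - h y\<bar> \<le> L * dist x y) \<and>
    (\<forall>r\<in>S. h (\<gamma> \<tau> r) = (if r = s then 1 else 0)) \<and>
    (\<forall>a b l. {a, b} \<in> T \<longrightarrow> 0 \<le> l \<longrightarrow> l \<le> 1 \<longrightarrow> h (\<gamma> \<tau> a + l *\<^sub>R (\<gamma> \<tau> b - \<gamma> \<tau> a)) =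
       (if a = s then 1 else 0) + l * ((if b = s then 1 else 0) - (if a = s then 1 else 0)))"
      by (rule plane_config_hat_functions[OF \<open>finite S\<close> \<open>S \<noteq> {}\<close> T pc[of \<tau>],
            of "\<lambda>r. if r = s then 1 else 0"]) (simp, blast)
  qed
  from bchoice[OF this] obtain Lf where "\<forall>s\<in>S. \<exists>h. Lf s \<ge> 0 \<and> (\<forall>x y. \<bar>h x - h y\<bar> \<le> Lf s * dist x y) \<and>
    (\<forall>r\<in>S. h (\<gamma> \<tau> r) = (if r = s then 1 else 0)) \<and>
    (\<forall>a b l. {a, b} \<in> T \<longrightarrow> 0 \<le> l \<longrightarrow> l \<le> 1 \<longrightarrow> h (\<gamma> \<tau> a + l *\<^sub>R (\<gamma> \<tau> b - \<gamma> \<tau> a)) =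
       (if a = s then 1 else 0) + l * ((if b = s then 1 else 0) - (if a = s then 1 else 0)))" ..
  from bchoice[OF this] obtain h where h: "\<forall>s\<in>S. Lf s \<ge> 0 \<and> (\<forall>x y. \<bar>h s x - h s y\<bar> \<le> Lf s * dist x y) \<and>
    (\<forall>r\<in>S. h s (\<gamma> \<tau> r) = (if r = s then 1 else 0)) \<and>
    (\<forall>a b l. {a, b} \<in> T \<longrightarrow> 0 \<le> l \<longrightarrow> l \<le> 1 \<longrightarrow> h s (\<gamma> \<tau> a + l *\<^sub>R (\<gamma> \<tau> b - \<gamma> \<tau> a)) =
       (if a = s then 1 else 0) + l * ((if b = s then 1 else 0) - (if a = s then 1 else 0)))" ..
  have Lf: "\<And>s. s \<in> S \<Longrightarrow> Lf s \<ge> 0"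
    and lip: "\<And>s x y. s \<in> S \<Longrightarrow> \<bar>h s x - h s y\<bar> \<le> Lf s * dist x y"
    and hv: "\<And>s r. s \<in> S \<Longrightarrow> r \<in> S \<Longrightarrow> h s (\<gamma> \<tau> r) = (if r = s then 1 else 0)"
    and he: "\<And>s a b l. s \<in> S \<Longrightarrow> {a, b} \<in> T \<Longrightarrow> 0 \<le> l \<Longrightarrow> l \<le> 1 \<Longrightarrow>
       h s (\<gamma> \<tau> a + l *\<^sub>R (\<gamma> \<tau> b - \<gamma> \<tau> a)) =
       (if a = s then 1 else 0) + l * ((if b = s then 1 else 0) - (if a = s then 1 else 0))"
    using h by blast+
  \<comment> \<open>With this total Lipschitz constant, vertex displacements of at most
    \<open>1 / (2 * (N + 1))\<close> produce a displacement field that contracts by the factor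
    1/2.\<close>
  define N where "N = (\<Sum>s\<in>S. Lf s)"
  have "N \<ge> 0"
    unfolding N_def using Lf by (intro sum_nonneg)
  define \<phi> where "\<phi> t x = (\<Sum>s\<in>S. h s x *\<^sub>R (\<gamma> t s - \<gamma> \<tau> s))" for t x
  define \<Phi> where "\<Phi> t x = x + \<phi> t x" for t x
  have hcont: "continuous_on UNIV (h s)" if "s \<in> S" for s
    by (rule lipschitz_on_continuous_on[of "Lf s"])
      (use lip Lf that in \<open>auto simp: lipschitz_on_def dist_real_def\<close>)
  have \<phi>lip: "dist (\<phi> t x) (\<phi> t y) \<le> 1 / 2 * dist x y"
    if "\<And>s. s \<in> S \<Longrightarrow> dist (\<gamma> t s) (\<gamma> \<tau> s) \<le> 1 / (2 * (N + 1))" for t x y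
  proof -
    have "dist (\<phi> t x) (\<phi> t y) = norm (\<Sum>s\<in>S. (h s x - h s y) *\<^sub>R (\<gamma> t s - \<gamma> \<tau> s))"
      by (simp add: \<phi>_def dist_norm sum_subtractf scaleR_left_diff_distrib)
    also have "\<dots> \<le> (\<Sum>s\<in>S. (Lf s * dist x y) * (1 / (2 * (N + 1))))"
    proof (rule order_trans[OF norm_sum], rule sum_mono)
      fix s assume "s \<in> S"
      then show "norm ((h s x - h s y) *\<^sub>R (\<gamma> t s - \<gamma> \<tau> s)) \<le> (Lf s * dist x y) * (1 / (2 * (N + 1)))"
        unfolding norm_scaleR using lip that Lf by (intro mult_mono) (auto simp: dist_norm)
    qed
    also have "\<dots> = N * dist x y / (2 * (N + 1))"
      by (simp add: N_def sum_distrib_right sum_divide_distrib)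
    also have "\<dots> \<le> 1 / 2 * dist x y"
      using \<open>N \<ge> 0\<close> by (simp add: field_simps)
    finally show ?thesis .
  qed
  have "\<forall>s\<in>S. \<exists>d>0. \<forall>t. dist t \<tau> < d \<longrightarrow> dist (\<gamma> t s) (\<gamma> \<tau> s) < 1 / (2 * (N + 1))"
  proof
    fix s assume "s \<in> S"
    have "1 / (2 * (N + 1)) > 0"
      using \<open>N \<ge> 0\<close> by simp
    then show "\<exists>d>0. \<forall>t. dist t \<tau> < d \<longrightarrow> dist (\<gamma> t s) (\<gamma> \<tau> s) < 1 / (2 * (N + 1))"
      using cont[OF \<open>s \<in> S\<close>] unfolding continuous_on_iff by blast
  qed
  from bchoice[OF this] obtain df where df: "\<forall>s\<in>S. df s > 0 \<and>
    (\<forall>t. dist t \<tau> < df s \<longrightarrow> dist (\<gamma> t s) (\<gamma> \<tau> s) < 1 / (2 * (N + 1)))" ..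
  define d where "d = Min (df ` S)"
  have "d > 0"
    unfolding d_def using df \<open>finite S\<close> \<open>S \<noteq> {}\<close> by simp
  have near: "dist (\<gamma> t s) (\<gamma> \<tau> s) \<le> 1 / (2 * (N + 1))" if "s \<in> S" "dist t \<tau> < d" for s t
  proof -
    have "d \<le> df s"
      unfolding d_def using \<open>finite S\<close> that by simp
    then have "dist t \<tau> < df s"
      using that by simp
    then show ?thesis
      using df \<open>s \<in> S\<close> less_imp_le by blast
  qed
  have homeo: "\<exists>g. homeomorphism UNIV UNIV (\<Phi> t) g" if "dist t \<tau> < d" for t
    unfolding \<Phi>_def by (rule homeomorphism_id_plus_contraction[of "1 / 2"]) (use \<phi>lip near that in auto)
  have \<Phi>v: "\<Phi> t (\<gamma> \<tau> r) = \<gamma> t r" if "r \<in> S" for t r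
    using \<open>finite S\<close> that by (simp add: \<Phi>_def \<phi>_def hv if_distrib[of "\<lambda>x. x *\<^sub>R _"] cong: if_cong)
  have \<Phi>e: "\<Phi> t ` closed_segment (\<gamma> \<tau> u) (\<gamma> \<tau> v) = closed_segment (\<gamma> t u) (\<gamma> t v)"
    if "{u, v} \<in> T" for t u v
  proof -
    have uv: "u \<in> S" "v \<in> S"
      using geometric_graph_edgeD[OF T that] by auto
    have eq: "\<Phi> t (\<gamma> \<tau> u + l *\<^sub>R (\<gamma> \<tau> v - \<gamma> \<tau> u)) = \<gamma> t u + l *\<^sub>R (\<gamma> t v - \<gamma> t u)"
      if "0 \<le> l" "l \<le> 1" for l
    proof -
      define D where "D s = \<gamma> t s - \<gamma> \<tau> s" for s
      have ind: "(\<Sum>s\<in>S. (if r = s then 1 else 0) *\<^sub>R D s) = D r" if "r \<in> S" for r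
        using \<open>finite S\<close> that by (simp add: if_distrib[of "\<lambda>x. x *\<^sub>R _"] cong: if_cong)
      have "\<phi> t (\<gamma> \<tau> u + l *\<^sub>R (\<gamma> \<tau> v - \<gamma> \<tau> u)) =
        (\<Sum>s\<in>S. ((if u = s then 1 else 0) + l * ((if v = s then 1 else 0) - (if u = s then 1 else 0))) *\<^sub>R D s)"
        unfolding \<phi>_def D_def using he \<open>{u, v} \<in> T\<close> that by (intro sum.cong) auto
      also have "\<dots> = (\<Sum>s\<in>S. (if u = s then 1 else 0) *\<^sub>R D s) +
        l *\<^sub>R ((\<Sum>s\<in>S. (if v = s then 1 else 0) *\<^sub>R D s) - (\<Sum>s\<in>S. (if u = s then 1 else 0) *\<^sub>R D s))"
        by (simp only: scaleR_add_left scaleR_left_diff_distrib scaleR_scaleR[symmetric] sum.distrib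
            sum_subtractf scaleR_sum_right scaleR_diff_right)
      also have "\<dots> = D u + l *\<^sub>R (D v - D u)"
        by (simp only: ind uv)
      finally show ?thesis
        by (simp add: \<Phi>_def D_def algebra_simps)
    qed
    have seg: "closed_segment x y = (\<lambda>l. x + l *\<^sub>R (y - x)) ` {0..1}" for x y :: point
      by (auto simp: closed_segment_def algebra_simps image_iff)
    show ?thesis
      unfolding seg image_image using eq by (intro image_cong) auto
  qed
  \<comment> \<open>\<open>\<Phi>\<close> is normalised at \<open>\<tau>\<close>, whereas the motion
    has to start at \<open>a\<close>; hence the composition with the inverse \<open>g\<close> of
    \<open>\<Phi> a\<close>.\<close>
  have "\<forall>a b. a \<le> \<tau> \<and> \<tau> \<le> b \<and> b - a < d \<longrightarrow> ?P a b"
  proof (intro allI impI)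
    fix a b assume ab: "a \<le> \<tau> \<and> \<tau> \<le> b \<and> b - a < d"
    then have nd: "dist t \<tau> < d" if "t \<in> {a..b}" for t
      using that by (auto simp: dist_real_def)
    obtain g where g: "homeomorphism UNIV UNIV (\<Phi> a) g"
      using homeo[of a] nd[of a] ab by auto
    then have g_cont: "continuous_on UNIV g" and \<Phi>g: "\<And>x. \<Phi> a (g x) = x" and g\<Phi>: "\<And>x. g (\<Phi> a x) = x"
      by (auto simp: homeomorphism_def)
    have "continuous_on (UNIV \<times> {a..b}) (\<lambda>z. \<Phi> (snd z) (g (fst z)))"
      unfolding \<Phi>_def \<phi>_def
      by (intro continuous_intros continuous_on_compose2[OF g_cont] continuous_on_compose2[OF hcont]
          continuous_on_compose2[OF cont]) auto
    then have ct: "continuous_on (UNIV \<times> {a..b}) (\<lambda>(x, t). (\<Phi> t \<circ> g) x)"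
      by (simp add: case_prod_unfold)
    have hm: "\<exists>g'. homeomorphism UNIV UNIV (\<Phi> t \<circ> g) g'" if "t \<in> {a..b}" for t
      using homeo[OF nd[OF that]] homeomorphism_symD[OF g] homeomorphism_compose by blast
    have id: "\<Phi> a \<circ> g = id"
      using \<Phi>g by (simp add: fun_eq_iff)
    have gv: "g (\<gamma> a s) = \<gamma> \<tau> s" if "s \<in> S" for s
      using g\<Phi>[of "\<gamma> \<tau> s"] \<Phi>v[OF that, of a] by simp
    have ge: "(\<Phi> t \<circ> g) ` closed_segment (\<gamma> a u) (\<gamma> a v) = closed_segment (\<gamma> t u) (\<gamma> t v)"
      if "{u, v} \<in> T" for t u v
    proof -
      have "g ` closed_segment (\<gamma> a u) (\<gamma> a v) = closed_segment (\<gamma> \<tau> u) (\<gamma> \<tau> v)"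
        unfolding \<Phi>e[OF that, of a, symmetric] image_image g\<Phi> by simp
      then show ?thesis
        unfolding image_comp[symmetric] by (simp only: \<Phi>e[OF that])
    qed
    have gs: "(\<Phi> t \<circ> g) (\<gamma> a s) = \<gamma> t s" if "s \<in> S" for t s
      using gv[OF that] \<Phi>v[OF that] by simp
    show "?P a b"
      using ct hm id gs ge by (intro exI[of _ "\<lambda>t. \<Phi> t \<circ> g"] conjI) blast+
  qed
  then show ?case
    using \<open>d > 0\<close> by blast
qed

lemma plane_config_isotopy:
  fixes \<gamma> :: "real \<Rightarrow> point \<Rightarrow> point"
  assumes "finite S" "S \<noteq> {}" and T: "geometric_graph_on S T"
    and cont: "\<And>s. s \<in> S \<Longrightarrow> continuous_on {0..1} (\<lambda>t. \<gamma> t s)"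
    and start: "\<And>s. s \<in> S \<Longrightarrow> \<gamma> 0 s = s"
    and pc: "\<And>t. t \<in> {0..1} \<Longrightarrow> plane_config S T (\<gamma> t)"
  obtains F where "ambient_isotopy F" "\<And>t s. t \<in> {0..1} \<Longrightarrow> s \<in> S \<Longrightarrow> F t s = \<gamma> t s"
    "\<And>t e. t \<in> {0..1} \<Longrightarrow> e \<in> T \<Longrightarrow> \<exists>a b. F t ` (convex hull e) = closed_segment a b"
proof -
  \<comment> \<open>Freezing the motion outside the unit interval makes it continuous and plane for
    all times.\<close>
  define \<gamma>' where "\<gamma>' t = \<gamma> (max 0 (min 1 t))" for t
  have cont': "continuous_on UNIV (\<lambda>t. \<gamma>' t s)" if "s \<in> S" for s
    unfolding \<gamma>'_def
    by (rule continuous_on_compose2[OF cont[OF that], of UNIV "\<lambda>t. max 0 (min 1 t)"])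
      (auto intro!: continuous_intros)
  have pc': "plane_config S T (\<gamma>' t)" for t
    unfolding \<gamma>'_def by (rule pc) auto
  obtain F where F: "continuous_on (UNIV \<times> {0..1}) (\<lambda>(x, t). F t x)"
     "\<forall>t\<in>{0..1}. \<exists>g. homeomorphism UNIV UNIV (F t) g" "F 0 = id"
     "\<And>t s. t\<in>{0..1} \<Longrightarrow> s \<in> S \<Longrightarrow> F t (\<gamma>' 0 s) = \<gamma>' t s"
     "\<And>t u v. t\<in>{0..1} \<Longrightarrow> {u, v} \<in> T \<Longrightarrow>
        F t ` closed_segment (\<gamma>' 0 u) (\<gamma>' 0 v) = closed_segment (\<gamma>' t u) (\<gamma>' t v)"
    using plane_config_isotopy_aux[OF assms(1-3) cont' pc' zero_le_one] by blast
  have *: "\<gamma>' t = \<gamma> t" if "t \<in> {0..1}" for t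
    using that by (simp add: \<gamma>'_def)
  show ?thesis
  proof (rule that[of F])
    show "ambient_isotopy F"
      unfolding ambient_isotopy_def using F(1-3) by blast
  next
    fix t :: real and s assume "t \<in> {0..1}" "s \<in> S"
    then show "F t s = \<gamma> t s"
      using F(4)[of t s] *[of 0] *[of t] start by simp
  next
    fix t :: real and e assume t: "t \<in> {0..1}" and "e \<in> T"
    then obtain u v where e: "u \<in> S" "v \<in> S" "e = {u, v}"
      using T unfolding geometric_graph_on_def by blast
    then have "F t ` (convex hull e) = closed_segment (\<gamma> t u) (\<gamma> t v)"
      using F(5)[OF t, of u v] \<open>e \<in> T\<close> *[of 0] *[OF t] start by (simp add: segment_convex_hull)
    then show "\<exists>a b. F t ` (convex hull e) = closed_segment a b"
      by blast
  qed
qed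

section \<open>Orientations and plane graphs\<close>

text \<open>Twice the signed area of the triangle. Unlike its sign \<open>orient\<close> it is
  continuous, so it can be followed along motions and into limits.\<close>

definition det3 :: "point \<Rightarrow> point \<Rightarrow> point \<Rightarrow> real" where
  "det3 p q r = (fst q - fst p) * (snd r - snd p) - (snd q - snd p) * (fst r - fst p)"

lemma orient_det3: "orient p q r = sgn (det3 p q r)"
  by (simp add: orient_def det3_def)

lemma det3_rot: "det3 q r p = det3 p q r"
  by (simp add: det3_def algebra_simps)

lemma det3_swap: "det3 q p r = - det3 p q r"
  by (simp add: det3_def algebra_simps)

lemma det3_swap': "det3 p r q = - det3 p q r"
  by (simp add: det3_def algebra_simps)

lemma det3_same [simp]: "det3 p p r = 0" "det3 p r p = 0" "det3 r p p = 0"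
  by (simp_all add: det3_def)

lemma det3_convex: "det3 a b ((1 - l) *\<^sub>R c + l *\<^sub>R d) = (1 - l) * det3 a b c + l * det3 a b d"
  by (simp add: det3_def algebra_simps)

lemma collinear_iff_det3: "collinear {p, q, r} \<longleftrightarrow> det3 p q r = 0"
proof -
  have "collinear {p, q, r} \<longleftrightarrow> collinear {0, p - q, r - q}"
    by (rule collinear_3) (simp add: NO_MATCH_def)
  also have "\<dots> \<longleftrightarrow> p - q = 0 \<or> r - q = 0 \<or> (\<exists>c. r - q = c *\<^sub>R (p - q))"
    by (rule collinear_lemma)
  also have "\<dots> \<longleftrightarrow> det3 p q r = 0"
  proof
    assume "p - q = 0 \<or> r - q = 0 \<or> (\<exists>c. r - q = c *\<^sub>R (p - q))"
    then consider "p = q" | "r = q" | c where "r - q = c *\<^sub>R (p - q)"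
      by auto
    then show "det3 p q r = 0"
    proof cases
      case 3
      then have "r = q + c *\<^sub>R (p - q)"
        by (simp add: algebra_simps)
      show ?thesis
        unfolding \<open>r = q + c *\<^sub>R (p - q)\<close> det3_def by (simp add: algebra_simps)
    qed auto
  next
    assume 0: "det3 p q r = 0"
    show "p - q = 0 \<or> r - q = 0 \<or> (\<exists>c. r - q = c *\<^sub>R (p - q))"
    proof (cases "p = q")
      case False
      define u v where "u = p - q" and "v = r - q"
      have uv: "fst u * snd v = snd u * fst v"
        using 0 by (simp add: u_def v_def det3_def algebra_simps)
      have "fst u \<noteq> 0 \<or> snd u \<noteq> 0"
        using False by (auto simp: u_def prod_eq_iff)
      then have "\<exists>c. v = c *\<^sub>R u"
      proof
        assume "fst u \<noteq> 0"
        then have "v = (fst v / fst u) *\<^sub>R u"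
          using uv by (simp add: prod_eq_iff field_simps)
        then show ?thesis by blast
      next
        assume "snd u \<noteq> 0"
        then have "v = (snd v / snd u) *\<^sub>R u"
          using uv by (simp add: prod_eq_iff field_simps)
        then show ?thesis by blast
      qed
      then show ?thesis
        by (auto simp: u_def v_def)
    qed simp
  qed
  finally show ?thesis .
qed

lemma det3_zero_on_line:
  assumes "det3 a b x = 0" "a \<noteq> b"
  obtains l where "x = a + l *\<^sub>R (b - a)"
proof -
  have "collinear {b, a, x}"
    unfolding collinear_iff_det3 using assms(1) det3_swap[of a b x] by simp
  then have "collinear {0, b - a, x - a}"
    by (simp add: collinear_3)
  then obtain c where "x - a = c *\<^sub>R (b - a)"
    using assms(2) unfolding collinear_lemma by (metis eq_iff_diff_eq_0 scaleR_zero_left)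
  then show ?thesis
    using that[of c] by (simp add: algebra_simps)
qed

lemma in_closed_segmentI:
  assumes "x = a + l *\<^sub>R (b - a)" "0 \<le> l" "l \<le> 1"
  shows "x \<in> closed_segment a b"
  unfolding in_segment using assms by (intro exI[of _ l]) (simp add: algebra_simps)

lemma in_closed_segmentE:
  assumes "x \<in> closed_segment a b"
  obtains l where "x = a + l *\<^sub>R (b - a)" "0 \<le> l" "l \<le> 1"
  using assms unfolding in_segment by (auto simp: algebra_simps)

lemma det3_closed_segment: "x \<in> closed_segment a b \<Longrightarrow> det3 a b x = 0"
proof -
  assume "x \<in> closed_segment a b"
  then obtain l where l: "x = a + l *\<^sub>R (b - a)"
    by (rule in_closed_segmentE)
  show "det3 a b x = 0"
    unfolding l det3_def by (simp add: algebra_simps)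
qed

text \<open>\<open>l\<close> and \<open>m\<close> are Cramer's solutions for the intersection of the
  two lines, and separation in both directions places them between 0 and 1. Up to sign the two
  denominators are the same cross product of directions.\<close>

lemma segments_cross:
  assumes ab: "det3 a b c * det3 a b d < 0" and cd: "det3 c d a * det3 c d b < 0"
  shows "closed_segment a b \<inter> closed_segment c d \<noteq> {}"
proof -
  define l where "l = det3 c d a / (det3 c d a - det3 c d b)"
  define m where "m = det3 a b c / (det3 a b c - det3 a b d)"
  have nz: "det3 c d a - det3 c d b \<noteq> 0" "det3 a b c - det3 a b d \<noteq> 0"
    using assms by (auto simp: mult_less_0_iff)
  have 1: "0 \<le> l" "l \<le> 1"
    using cd by (auto simp: l_def mult_less_0_iff field_simps divide_le_0_iff zero_le_divide_iff divide_le_eq_1)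
  have 2: "0 \<le> m" "m \<le> 1"
    using ab by (auto simp: m_def mult_less_0_iff field_simps divide_le_0_iff zero_le_divide_iff divide_le_eq_1)
  have key: "(det3 a b c - det3 a b d) = - (det3 c d a - det3 c d b)"
    by (simp add: det3_def algebra_simps)
  have "a + l *\<^sub>R (b - a) = c + m *\<^sub>R (d - c)"
  proof -
    have "(det3 c d a - det3 c d b) *\<^sub>R (a + l *\<^sub>R (b - a)) = (det3 c d a - det3 c d b) *\<^sub>R a + det3 c d a *\<^sub>R (b - a)"
      using nz by (simp add: l_def scaleR_add_right)
    also have "\<dots> = (det3 c d a - det3 c d b) *\<^sub>R c - det3 a b c *\<^sub>R (d - c)"
      by (simp add: prod_eq_iff det3_def algebra_simps)
    also have "\<dots> = (det3 c d a - det3 c d b) *\<^sub>R (c + m *\<^sub>R (d - c))"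
    proof -
      have "(det3 c d a - det3 c d b) * m = - det3 a b c"
      proof -
        have "det3 c d a - det3 c d b = - (det3 a b c - det3 a b d)"
          using key by linarith
        moreover have "- z * (y / z) = - y" if "z \<noteq> 0" for y z :: real
          using that by simp
        ultimately show ?thesis
          using nz(2) unfolding m_def by presburger
      qed
      then show ?thesis
        by (simp add: scaleR_add_right)
    qed
    finally show ?thesis
      using nz by simp
  qed
  then show ?thesis
    using in_closed_segmentI[OF refl 1, of a b] in_closed_segmentI[OF refl 2, of c d] by auto
qed

text \<open>Equality of orientations is written as positivity of a product, which has an obvious
  closed relaxation.\<close>

definition same_type :: "point set \<Rightarrow> (point \<Rightarrow> point) \<Rightarrow> bool" where
  "same_type S p \<longleftrightarrow> (\<forall>a\<in>S. \<forall>b\<in>S. \<forall>c\<in>S. a \<noteq> b \<longrightarrow> a \<noteq> c \<longrightarrow> b \<noteq> c \<longrightarrow>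
     det3 a b c * det3 (p a) (p b) (p c) > 0)"

text \<open>The closed counterpart of \<open>same_type\<close>: limits satisfy it, and triples may
  become collinear or vertices coincide.\<close>

definition weak_type :: "point set \<Rightarrow> (point \<Rightarrow> point) \<Rightarrow> bool" where
  "weak_type S p \<longleftrightarrow> (\<forall>a\<in>S. \<forall>b\<in>S. \<forall>c\<in>S. a \<noteq> b \<longrightarrow> a \<noteq> c \<longrightarrow> b \<noteq> c \<longrightarrow>
     det3 a b c * det3 (p a) (p b) (p c) \<ge> 0)"

lemma same_typeD: "same_type S p \<Longrightarrow> a \<in> S \<Longrightarrow> b \<in> S \<Longrightarrow> c \<in> S \<Longrightarrow> a \<noteq> b \<Longrightarrow> a \<noteq> c \<Longrightarrow> b \<noteq> c \<Longrightarrow>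
    det3 a b c * det3 (p a) (p b) (p c) > 0"
  unfolding same_type_def by blast

lemma weak_typeD: "weak_type S p \<Longrightarrow> a \<in> S \<Longrightarrow> b \<in> S \<Longrightarrow> c \<in> S \<Longrightarrow> a \<noteq> b \<Longrightarrow> a \<noteq> c \<Longrightarrow> b \<noteq> c \<Longrightarrow>
    det3 a b c * det3 (p a) (p b) (p c) \<ge> 0"
  unfolding weak_type_def by blast

lemma same_imp_weak: "same_type S p \<Longrightarrow> weak_type S p"
  unfolding same_type_def weak_type_def by (meson less_imp_le)

lemma weak_type_pos:
  assumes "weak_type S p" "a \<in> S" "b \<in> S" "c \<in> S" "det3 a b c > 0"
  shows "det3 (p a) (p b) (p c) \<ge> 0"
proof -
  have "a \<noteq> b" "a \<noteq> c" "b \<noteq> c"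
    using assms(5) by auto
  then show ?thesis
    using weak_typeD[OF assms(1-4)] assms(5) by (simp add: zero_le_mult_iff)
qed

text \<open>Crossings are excluded for edges without a common endpoint; edges that share one are
  kept apart elsewhere by general position.\<close>

locale plane_graph =
  fixes S :: "point set" and T :: "point set set"
  assumes finS: "finite S" and card3: "card S \<ge> 3"
    and gp: "a \<in> S \<Longrightarrow> b \<in> S \<Longrightarrow> c \<in> S \<Longrightarrow> a \<noteq> b \<Longrightarrow> a \<noteq> c \<Longrightarrow> b \<noteq> c \<Longrightarrow> det3 a b c \<noteq> 0"
    and graph: "geometric_graph_on S T"
    and noncross: "{a, b} \<in> T \<Longrightarrow> {c, d} \<in> T \<Longrightarrow> {a, b} \<inter> {c, d} = {} \<Longrightarrow>
      closed_segment a b \<inter> closed_segment c d = {}"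
begin

lemmas edgeD = geometric_graph_edgeD[OF graph]

text \<open>Planarity in terms of the order type: one of the two edges has both ends of the other
  strictly on one side. In this form it is inherited, weakly, by every \<open>weak_type\<close>
  drawing.\<close>

lemma noncross_det3:
  assumes "{a, b} \<in> T" "{c, d} \<in> T" "{a, b} \<inter> {c, d} = {}"
  shows "det3 a b c * det3 a b d > 0 \<or> det3 c d a * det3 c d b > 0"
proof -
  have "a \<in> S" "b \<in> S" "c \<in> S" "d \<in> S" "a \<noteq> b" "c \<noteq> d"
    using edgeD assms by auto
  then have "det3 a b c \<noteq> 0" "det3 a b d \<noteq> 0" "det3 c d a \<noteq> 0" "det3 c d b \<noteq> 0"
    using assms(3) gp[of a b c] gp[of a b d] gp[of c d a] gp[of c d b] by auto
  moreover have "\<not> (det3 a b c * det3 a b d < 0 \<and> det3 c d a * det3 c d b < 0)"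
    using segments_cross[of a b c d] noncross[OF assms] by blast
  ultimately show ?thesis
    by (metis linorder_neqE_linordered_idom mult_eq_0_iff)
qed

text \<open>By \<open>noncross_det3\<close> one edge stays weakly on one side of the other. If the
  images still meet, but not at a vertex, all four endpoints lie on one line, and of two overlapping
  segments on a line one contains an endpoint of the other, against \<open>vert\<close>.\<close>

lemma weak_type_plane_config:
  assumes weak: "weak_type S p"
    and inj: "\<And>a b. a \<in> S \<Longrightarrow> b \<in> S \<Longrightarrow> a \<noteq> b \<Longrightarrow> p a \<noteq> p b"
    and vert: "\<And>a b s. {a, b} \<in> T \<Longrightarrow> s \<in> S \<Longrightarrow> s \<noteq> a \<Longrightarrow> s \<noteq> b \<Longrightarrow> p s \<notin> closed_segment (p a) (p b)"
  shows "plane_config S T p"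
proof -
  have aux: False if e: "{a, b} \<in> T" "{c, d} \<in> T" "{a, b} \<inter> {c, d} = {}"
    and x: "x \<in> closed_segment (p a) (p b)" "x \<in> closed_segment (p c) (p d)"
    and pos: "det3 a b c > 0" "det3 a b d > 0" for a b c d x
  proof -
    have S: "a \<in> S" "b \<in> S" "c \<in> S" "d \<in> S" "a \<noteq> b" "c \<noteq> d" "a \<noteq> c" "a \<noteq> d" "b \<noteq> c" "b \<noteq> d"
      using edgeD e by auto
    have D: "det3 (p a) (p b) (p c) \<ge> 0" "det3 (p a) (p b) (p d) \<ge> 0"
      using weak_type_pos[OF weak] S pos by auto
    obtain m where m: "x = p c + m *\<^sub>R (p d - p c)" "0 \<le> m" "m \<le> 1"
      using x(2) by (rule in_closed_segmentE)
    have "x = (1 - m) *\<^sub>R p c + m *\<^sub>R p d"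
      using m by (simp add: algebra_simps)
    then have "(1 - m) * det3 (p a) (p b) (p c) + m * det3 (p a) (p b) (p d) = 0"
      using det3_closed_segment[OF x(1)] by (simp add: det3_convex)
    then have z: "(1 - m) * det3 (p a) (p b) (p c) = 0" "m * det3 (p a) (p b) (p d) = 0"
      using D m by (smt (verit) mult_nonneg_nonneg)+
    have nc: "p c \<notin> closed_segment (p a) (p b)" and nd: "p d \<notin> closed_segment (p a) (p b)"
      and na: "p a \<notin> closed_segment (p c) (p d)"
      using vert e S by auto
    have "m \<noteq> 0" "m \<noteq> 1"
      using nc nd x(1) m(1) by auto
    then have "det3 (p a) (p b) (p c) = 0" "det3 (p a) (p b) (p d) = 0"
      using z by auto
    moreover have "p a \<noteq> p b"
      using inj S by auto
    ultimately obtain \<gamma> \<delta> where g: "p c = p a + \<gamma> *\<^sub>R (p b - p a)" "p d = p a + \<delta> *\<^sub>R (p b - p a)"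
      using det3_zero_on_line by metis
    obtain l where l: "x = p a + l *\<^sub>R (p b - p a)" "0 \<le> l" "l \<le> 1"
      using x(1) by (rule in_closed_segmentE)
    have "x = p a + (\<gamma> + m * (\<delta> - \<gamma>)) *\<^sub>R (p b - p a)"
      unfolding m(1) g by (simp add: algebra_simps)
    then have lm: "l = \<gamma> + m * (\<delta> - \<gamma>)"
      using l(1) \<open>p a \<noteq> p b\<close> by simp
    have out: "\<gamma> < 0 \<or> \<gamma> > 1" "\<delta> < 0 \<or> \<delta> > 1"
      using nc nd in_closed_segmentI[OF g(1)] in_closed_segmentI[OF g(2)] by fastforce+
    \<comment> \<open>The images of \<open>c\<close> and \<open>d\<close> lie on the line but
      outside the segment from \<open>p a\<close> to \<open>p b\<close>, while a convex combination
      of them is inside. So they lie beyond different ends, and their segment contains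
      \<open>p a\<close>.\<close>
    have opp: "\<gamma> < 0 \<and> \<delta> > 1 \<or> \<gamma> > 1 \<and> \<delta> < 0"
    proof -
      have e: "l = (1 - m) * \<gamma> + m * \<delta>"
        using lm by (simp add: algebra_simps)
      have False if "\<gamma> < 0" "\<delta> < 0"
      proof -
        have "(1 - m) * \<gamma> < 0" "m * \<delta> < 0"
          using that m \<open>m \<noteq> 0\<close> \<open>m \<noteq> 1\<close> by (auto simp: mult_less_0_iff)
        then show False using e l by linarith
      qed
      moreover have False if "\<gamma> > 1" "\<delta> > 1"
      proof -
        have "(1 - m) * (\<gamma> - 1) > 0" "m * (\<delta> - 1) > 0"
          using that m \<open>m \<noteq> 0\<close> \<open>m \<noteq> 1\<close> by auto
        then have "(1 - m) * \<gamma> + m * \<delta> > 1" by (simp add: algebra_simps)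
        then show False using e l by linarith
      qed
      ultimately show ?thesis
        using out by blast
    qed
    then have "\<delta> - \<gamma> \<noteq> 0" by auto
    then have "p a = p c + (\<gamma> / (\<gamma> - \<delta>)) *\<^sub>R (p d - p c)"
    proof -
      have "\<gamma> + \<gamma> / (\<gamma> - \<delta>) * (\<delta> - \<gamma>) = 0"
        using \<open>\<delta> - \<gamma> \<noteq> 0\<close> by (simp add: field_simps)
      moreover have "p c + (\<gamma> / (\<gamma> - \<delta>)) *\<^sub>R (p d - p c) = p a + (\<gamma> + \<gamma> / (\<gamma> - \<delta>) * (\<delta> - \<gamma>)) *\<^sub>R (p b - p a)"
        unfolding g by (simp add: scaleR_left_diff_distrib[symmetric] scaleR_add_left)
      ultimately show ?thesis by simp
    qed
    moreover have "0 \<le> \<gamma> / (\<gamma> - \<delta>)" "\<gamma> / (\<gamma> - \<delta>) \<le> 1"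
      using opp by (auto simp: field_simps zero_le_divide_iff divide_le_eq_1)
    ultimately show False
      using na in_closed_segmentI by metis
  qed
  have aux2: False if e: "{a, b} \<in> T" "{c, d} \<in> T" "{a, b} \<inter> {c, d} = {}"
    and x: "x \<in> closed_segment (p a) (p b)" "x \<in> closed_segment (p c) (p d)"
    and pos: "det3 a b c * det3 a b d > 0" for a b c d x
  proof (cases "det3 a b c > 0")
    case True
    then show False
      using aux[OF e x] pos by (simp add: zero_less_mult_iff)
  next
    case False
    then have "det3 b a c > 0" "det3 b a d > 0"
      using pos by (auto simp: det3_swap[of a b] zero_less_mult_iff)
    then show False
      using aux[of b a c d x] e x by (simp add: insert_commute closed_segment_commute)
  qed
  show ?thesis
    unfolding plane_config_def
  proof (intro ballI impI)
    fix a b c d assume S: "a \<in> S" "b \<in> S" "c \<in> S" "d \<in> S"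
      and e: "a = b \<or> {a, b} \<in> T" "c = d \<or> {c, d} \<in> T" and dis: "{a, b} \<inter> {c, d} = {}"
    show "closed_segment (p a) (p b) \<inter> closed_segment (p c) (p d) = {}"
    proof (cases "a = b")
      case True
      then show ?thesis
        using e(2) inj[of a c] vert[of c d a] S dis by auto
    next
      case ab: False
      show ?thesis
      proof (cases "c = d")
        case True
        then show ?thesis
          using e(1) ab vert[of a b c] S dis by auto
      next
        case False
        then have "det3 a b c * det3 a b d > 0 \<or> det3 c d a * det3 c d b > 0"
          using noncross_det3 e ab dis by blast
        then show ?thesis
          using aux2[of a b c d] aux2[of c d a b] e ab False dis by blast
      qed
    qed
  qed
qed

lemma third_point:
  obtains c where "c \<in> S" "c \<noteq> a" "c \<noteq> b"
proof -
  have "card {a, b} < card S"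
    using card3 by (cases "a = b") auto
  then have "\<not> S \<subseteq> {a, b}"
    using card_mono[of "{a, b}" S] by auto
  then show ?thesis
    using that by blast
qed

lemma same_type_plane_config:
  assumes "same_type S p"
  shows "plane_config S T p"
proof (rule weak_type_plane_config)
  show "weak_type S p"
    using assms by (rule same_imp_weak)
  show "p a \<noteq> p b" if "a \<in> S" "b \<in> S" "a \<noteq> b" for a b
  proof -
    obtain c where "c \<in> S" "c \<noteq> a" "c \<noteq> b"
      by (rule third_point)
    then show ?thesis
      using same_typeD[OF assms that(1,2), of c] that by auto
  qed
  show "p s \<notin> closed_segment (p a) (p b)" if "{a, b} \<in> T" "s \<in> S" "s \<noteq> a" "s \<noteq> b" for a b s
    using same_typeD[OF assms, of a b s] edgeD[OF that(1)] that det3_closed_segment by fastforce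
qed

end

section \<open>Supporting graphs stay nondegenerate\<close>

text \<open>Finitely many pairs of disjoint compact segments have a positive least distance; moving
  all vertices by less than half of it keeps them apart.\<close>

lemma plane_config_open:
  assumes "finite S" and pc: "plane_config S T q"
  obtains \<delta> where "\<delta> > 0" "\<And>r. (\<And>s. s \<in> S \<Longrightarrow> dist (r s) (q s) < \<delta>) \<Longrightarrow> plane_config S T r"
proof -
  define Z where "Z = {(a, b, c, d). a \<in> S \<and> b \<in> S \<and> c \<in> S \<and> d \<in> S \<and> (a = b \<or> {a, b} \<in> T) \<and>
    (c = d \<or> {c, d} \<in> T) \<and> {a, b} \<inter> {c, d} = {}}"
  have "finite Z"
    by (rule finite_subset[of _ "S \<times> S \<times> S \<times> S"]) (use \<open>finite S\<close> in \<open>auto simp: Z_def\<close>)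
  have "\<forall>z\<in>Z. \<exists>e>0. \<forall>x y. x \<in> (case z of (a, b, c, d) \<Rightarrow> closed_segment (q a) (q b)) \<longrightarrow>
      y \<in> (case z of (a, b, c, d) \<Rightarrow> closed_segment (q c) (q d)) \<longrightarrow> e \<le> dist x y"
  proof
    fix z assume "z \<in> Z"
    obtain a b c d where z: "z = (a, b, c, d)"
      by (cases z) auto
    have "closed_segment (q a) (q b) \<inter> closed_segment (q c) (q d) = {}"
      by (rule plane_config_disjoint[OF pc]) (use \<open>z \<in> Z\<close> z in \<open>auto simp: Z_def\<close>)
    then obtain e where "e > 0" "\<And>x y. x \<in> closed_segment (q a) (q b) \<Longrightarrow>
        y \<in> closed_segment (q c) (q d) \<Longrightarrow> e \<le> dist x y"
      using separate_compact_closed[of "closed_segment (q a) (q b)" "closed_segment (q c) (q d)"]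
      by (metis closed_segment compact_segment)
    then show "\<exists>e>0. \<forall>x y. x \<in> (case z of (a, b, c, d) \<Rightarrow> closed_segment (q a) (q b)) \<longrightarrow>
      y \<in> (case z of (a, b, c, d) \<Rightarrow> closed_segment (q c) (q d)) \<longrightarrow> e \<le> dist x y"
      using z by auto
  qed
  from bchoice[OF this] obtain e where e: "\<forall>z\<in>Z. e z > 0 \<and> (\<forall>x y.
      x \<in> (case z of (a, b, c, d) \<Rightarrow> closed_segment (q a) (q b)) \<longrightarrow>
      y \<in> (case z of (a, b, c, d) \<Rightarrow> closed_segment (q c) (q d)) \<longrightarrow> e z \<le> dist x y)" ..
  \<comment> \<open>The inserted 1 keeps \<open>Min\<close> meaningful when there is no pair to
    consider.\<close>
  define \<delta> where "\<delta> = Min (insert 1 (e ` Z)) / 2"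
  have "\<delta> > 0"
    using e \<open>finite Z\<close> by (simp add: \<delta>_def)
  moreover have "plane_config S T r" if r: "\<And>s. s \<in> S \<Longrightarrow> dist (r s) (q s) < \<delta>" for r
    unfolding plane_config_def
  proof (intro ballI impI)
    fix a b c d assume S: "a \<in> S" "b \<in> S" "c \<in> S" "d \<in> S"
      and ed: "a = b \<or> {a, b} \<in> T" "c = d \<or> {c, d} \<in> T" and dis: "{a, b} \<inter> {c, d} = {}"
    then have Z: "(a, b, c, d) \<in> Z"
      by (auto simp: Z_def)
    then have "2 * \<delta> \<le> e (a, b, c, d)"
      using \<open>finite Z\<close> by (simp add: \<delta>_def)
    then have far: "2 * \<delta> \<le> dist x y" if "x \<in> closed_segment (q a) (q b)" "y \<in> closed_segment (q c) (q d)" for x y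
      using e Z that by fastforce
    have near: "\<exists>x\<in>closed_segment (q u) (q v). dist z x < \<delta>"
      if z: "z \<in> closed_segment (r u) (r v)" and uv: "u \<in> S" "v \<in> S" for u v z
    proof -
      obtain l where l: "z = r u + l *\<^sub>R (r v - r u)" "0 \<le> l" "l \<le> 1"
        using z by (rule in_closed_segmentE)
      define x where "x = q u + l *\<^sub>R (q v - q u)"
      have "x \<in> closed_segment (q u) (q v)"
        using in_closed_segmentI[OF x_def l(2,3)] .
      have "z - x = (1 - l) *\<^sub>R (r u - q u) + l *\<^sub>R (r v - q v)"
        by (simp add: l(1) x_def algebra_simps)
      moreover have "r u - q u \<in> ball 0 \<delta>" "r v - q v \<in> ball 0 \<delta>"
        using r[OF uv(1)] r[OF uv(2)] by (simp_all add: dist_norm norm_minus_commute)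
      then have "(1 - l) *\<^sub>R (r u - q u) + l *\<^sub>R (r v - q v) \<in> ball 0 \<delta>"
        by (rule convexD[OF convex_ball]) (use l in auto)
      ultimately have "z - x \<in> ball 0 \<delta>"
        by simp
      then show ?thesis
        using \<open>x \<in> closed_segment (q u) (q v)\<close> by (auto simp: dist_norm norm_minus_commute)
    qed
    show "closed_segment (r a) (r b) \<inter> closed_segment (r c) (r d) = {}"
    proof (rule ccontr)
      assume "\<not> ?thesis"
      then obtain z where z: "z \<in> closed_segment (r a) (r b)" "z \<in> closed_segment (r c) (r d)"
        by blast
      obtain x where x: "x \<in> closed_segment (q a) (q b)" "dist z x < \<delta>"
        using near[OF z(1)] S by blast
      obtain y where y: "y \<in> closed_segment (q c) (q d)" "dist z y < \<delta>"
        using near[OF z(2)] S by blast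
      show False
        using far[OF x(1) y(1)] x(2) y(2) dist_triangle3[of x y z] by linarith
    qed
  qed
  ultimately show ?thesis
    by (rule that)
qed

text \<open>Finitely many lines form a null set, which cannot cover a nonempty open set.\<close>

lemma avoid_lines:
  assumes "open U" "U \<noteq> {}" "finite A" "\<And>u v. (u, v) \<in> A \<Longrightarrow> u \<noteq> v"
  obtains x where "x \<in> U" "\<And>u v. (u, v) \<in> A \<Longrightarrow> det3 u v x \<noteq> 0"
proof -
  have "negligible (\<Union>z\<in>A. {x. det3 (fst z) (snd z) x = 0})"
  proof (intro negligible_Union[OF finite_imageI[OF \<open>finite A\<close>]])
    fix t assume "t \<in> (\<lambda>z. {x. det3 (fst z) (snd z) x = 0}) ` A"
    then obtain u v where uv: "(u, v) \<in> A" and t: "t = {x. det3 u v x = 0}"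
      by auto
    define w where "w = (snd u - snd v, fst v - fst u)"
    have "det3 u v x = 0 \<longleftrightarrow> w \<bullet> x = w \<bullet> u" for x
      by (auto simp: w_def det3_def inner_prod_def algebra_simps)
    moreover have "w \<noteq> 0"
      using assms(4)[OF uv] by (auto simp: w_def prod_eq_iff)
    ultimately show "negligible t"
      unfolding t using negligible_hyperplane[of w "w \<bullet> u"] by simp
  qed
  then have "\<not> U \<subseteq> (\<Union>z\<in>A. {x. det3 (fst z) (snd z) x = 0})"
    using open_not_negligible[OF assms(1,2)] negligible_subset by blast
  then show ?thesis
    using that by force
qed

lemma continuous_on_det3 [continuous_intros]:
  assumes "continuous_on A f" "continuous_on A g" "continuous_on A h"
  shows "continuous_on A (\<lambda>x. det3 (f x) (g x) (h x))"
  unfolding det3_def using assms by (intro continuous_intros)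

text \<open>Of four distinct image points at least three come from vertices other than
  \<open>c\<close>, so degeneracies involving \<open>c\<close> do no harm.\<close>

lemma no_four_collinear_image:
  assumes "\<And>x y z. x \<in> S - {c} \<Longrightarrow> y \<in> S - {c} \<Longrightarrow> z \<in> S - {c} \<Longrightarrow> x \<noteq> y \<Longrightarrow> x \<noteq> z \<Longrightarrow> y \<noteq> z \<Longrightarrow>
    det3 (r x) (r y) (r z) \<noteq> 0"
  shows "no_four_collinear (r ` S)"
  unfolding no_four_collinear_def
proof (intro ballI impI notI)
  fix p q u v assume im: "p \<in> r ` S" "q \<in> r ` S" "u \<in> r ` S" "v \<in> r ` S"
    and ne: "p \<noteq> q \<and> p \<noteq> u \<and> p \<noteq> v \<and> q \<noteq> u \<and> q \<noteq> v \<and> u \<noteq> v" and col: "collinear {p, q, u, v}"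
  obtain p' q' u' v' where S: "p' \<in> S" "q' \<in> S" "u' \<in> S" "v' \<in> S"
    and eq: "p = r p'" "q = r q'" "u = r u'" "v = r v'"
    using im by auto
  have *: False if "x \<in> S - {c}" "y \<in> S - {c}" "z \<in> S - {c}" "r x \<noteq> r y" "r x \<noteq> r z" "r y \<noteq> r z"
    "{r x, r y, r z} \<subseteq> {p, q, u, v}" for x y z
  proof -
    have "x \<noteq> y" "x \<noteq> z" "y \<noteq> z"
      using that by auto
    then have "det3 (r x) (r y) (r z) \<noteq> 0"
      using assms that by simp
    then show False
      using collinear_subset[OF col that(7)] by (simp add: collinear_iff_det3)
  qed
  have d: "r p' \<noteq> r q'" "r p' \<noteq> r u'" "r p' \<noteq> r v'" "r q' \<noteq> r u'" "r q' \<noteq> r v'" "r u' \<noteq> r v'"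
    using ne eq by auto
  have ne': "p' \<noteq> q'" "p' \<noteq> u'" "p' \<noteq> v'" "q' \<noteq> u'" "q' \<noteq> v'" "u' \<noteq> v'"
    using d by auto
  consider "p' = c" | "q' = c" | "u' = c" | "p' \<noteq> c" "q' \<noteq> c" "u' \<noteq> c"
    by blast
  then show False
  proof cases
    case 1
    show False by (rule *[of q' u' v']) (use S d ne' eq 1 in simp_all)
  next
    case 2
    show False by (rule *[of p' u' v']) (use S d ne' eq 2 in simp_all)
  next
    case 3
    show False by (rule *[of p' q' v']) (use S d ne' eq 3 in simp_all)
  next
    case 4
    show False by (rule *[of p' q' u']) (use S d ne' eq 4 in simp_all)
  qed
qed

locale supporting_plane_graph = plane_graph +
  assumes supp: "supporting S T"
begin

text \<open>If a triple is flat in a plane final drawing, stop slightly earlier and move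
  \<open>c\<close> alone across the line through \<open>a\<close> and \<open>b\<close>. All of this
  stays close to the final drawing, hence plane, and extends to an ambient isotopy. Four points
  never become collinear, since only triples with \<open>c\<close> can degenerate. The motion ends
  in general position with a reversed triple, which a supporting graph forbids.\<close>

lemma supporting_path_nondegenerate:
  fixes \<gamma> :: "real \<Rightarrow> point \<Rightarrow> point"
  assumes cont: "\<And>s. s \<in> S \<Longrightarrow> continuous_on {0..1} (\<lambda>t. \<gamma> t s)"
    and start: "\<And>s. s \<in> S \<Longrightarrow> \<gamma> 0 s = s"
    and same: "\<And>t. 0 \<le> t \<Longrightarrow> t < 1 \<Longrightarrow> same_type S (\<gamma> t)"
    and pc: "plane_config S T (\<gamma> 1)"
    and S: "a \<in> S" "b \<in> S" "c \<in> S" "a \<noteq> b" "a \<noteq> c" "b \<noteq> c"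
  shows "det3 (\<gamma> 1 a) (\<gamma> 1 b) (\<gamma> 1 c) \<noteq> 0"
proof
  assume flat: "det3 (\<gamma> 1 a) (\<gamma> 1 b) (\<gamma> 1 c) = 0"
  define q where "q = \<gamma> 1"
  define \<sigma> where "\<sigma> = det3 a b c"
  have "\<sigma> \<noteq> 0"
    unfolding \<sigma>_def by (rule gp[OF S])
  obtain \<delta> where "\<delta> > 0" and \<delta>: "\<And>r. (\<And>s. s \<in> S \<Longrightarrow> dist (r s) (q s) < \<delta>) \<Longrightarrow> plane_config S T r"
    using plane_config_open[OF finS pc] unfolding q_def by blast
  have "q a \<noteq> q b"
    using plane_config_inj[OF pc] S unfolding q_def by blast
  define n where "n = (- (snd (q b) - snd (q a)), fst (q b) - fst (q a))"
  define N where "N = (fst (q b) - fst (q a))\<^sup>2 + (snd (q b) - snd (q a))\<^sup>2"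
  have "N > 0"
    using \<open>q a \<noteq> q b\<close> by (auto simp: N_def prod_eq_iff sum_power2_gt_zero_iff)
  have detn: "det3 (q a) (q b) (q c + \<eta> *\<^sub>R n) = \<eta> * N" for \<eta>
  proof -
    have "det3 (q a) (q b) (q c + \<eta> *\<^sub>R n) = det3 (q a) (q b) (q c) + \<eta> * N"
      by (simp add: det3_def n_def N_def power2_eq_square algebra_simps)
    then show ?thesis
      using flat by (simp add: q_def)
  qed
  \<comment> \<open>A step along the normal \<open>n\<close> of length below
    \<open>\<delta>\<close>, signed so as to land on the wrong side of the line through
    \<open>q a\<close> and \<open>q b\<close>.\<close>
  define \<eta> where "\<eta> = - sgn \<sigma> * (\<delta> / (2 * (norm n + 1)))"
  define c1 where "c1 = q c + \<eta> *\<^sub>R n"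
  have n1: "norm n + 1 > 0"
    by (simp add: add_nonneg_pos)
  have "dist c1 (q c) < \<delta>"
  proof -
    have "dist c1 (q c) = \<delta> * (norm n / (2 * (norm n + 1)))"
      using \<open>\<delta> > 0\<close> \<open>\<sigma> \<noteq> 0\<close> n1 by (simp add: c1_def dist_norm \<eta>_def abs_mult abs_sgn_eq)
    also have "\<dots> < \<delta> * 1"
      using n1 \<open>\<delta> > 0\<close> by (intro mult_strict_left_mono) (auto simp: divide_less_eq)
    finally show ?thesis by simp
  qed
  have neg: "det3 (q a) (q b) c1 * \<sigma> < 0"
  proof -
    have "det3 (q a) (q b) c1 * \<sigma> = - (N * (\<delta> / (2 * (norm n + 1))) * \<bar>\<sigma>\<bar>)"
      unfolding c1_def detn \<eta>_def by (simp add: abs_sgn)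
    also have "\<dots> < 0"
      using \<open>N > 0\<close> \<open>\<delta> > 0\<close> \<open>\<sigma> \<noteq> 0\<close> n1 by simp
    finally show ?thesis .
  qed
  \<comment> \<open>The target \<open>c1\<close> is also on the wrong side of the line through
    \<open>a\<close> and \<open>b\<close> as placed slightly before time 1.\<close>
  have "continuous_on {0..1} (\<lambda>t. det3 (\<gamma> t a) (\<gamma> t b) c1 * \<sigma>)"
    using cont S by (intro continuous_intros)
  then have "((\<lambda>t. det3 (\<gamma> t a) (\<gamma> t b) c1 * \<sigma>) \<longlongrightarrow> det3 (q a) (q b) c1 * \<sigma>) (at 1 within {0..1})"
    unfolding continuous_on_def q_def by (rule bspec) simp
  then have ev1: "\<forall>\<^sub>F t in at 1 within {0..1}. det3 (\<gamma> t a) (\<gamma> t b) c1 * \<sigma> < 0"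
    using neg by (rule order_tendstoD)
  have "\<forall>\<^sub>F t in at 1 within {0..1}. dist (\<gamma> t s) (q s) < \<delta>" if "s \<in> S" for s
    using cont[OF that] \<open>\<delta> > 0\<close> unfolding continuous_on_def q_def
    by (auto intro: tendstoD)
  then have ev2: "\<forall>\<^sub>F t in at 1 within {0..1}. \<forall>s\<in>S. dist (\<gamma> t s) (q s) < \<delta>"
    using finS by (simp add: eventually_ball_finite)
  have "\<forall>\<^sub>F t in at 1 within {0..1}. t \<in> {0..1} \<and> t \<noteq> (1::real)"
    by (simp add: eventually_at_filter)
  with ev1 ev2 have "\<forall>\<^sub>F t in at 1 within {0..1}. det3 (\<gamma> t a) (\<gamma> t b) c1 * \<sigma> < 0 \<and>
      (\<forall>s\<in>S. dist (\<gamma> t s) (q s) < \<delta>) \<and> t \<in> {0..1} \<and> t \<noteq> (1::real)"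
    by eventually_elim auto
  moreover have "(at 1 within {0..1::real}) \<noteq> bot"
    by (simp add: trivial_limit_within islimpt_Icc)
  ultimately obtain t1 where t1: "det3 (\<gamma> t1 a) (\<gamma> t1 b) c1 * \<sigma> < 0"
      "\<And>s. s \<in> S \<Longrightarrow> dist (\<gamma> t1 s) (q s) < \<delta>" "0 \<le> t1" "t1 < 1"
    using eventually_happens' by (metis (mono_tags, lifting) atLeastAtMost_iff order_less_le)
  define r where "r = \<gamma> t1"
  have same_r: "same_type S r"
    unfolding r_def using same t1 by simp
  \<comment> \<open>Within the open set \<open>U\<close> the target is perturbed to
    \<open>c2\<close>, off all lines through two vertices of \<open>r\<close>, so that the motion
    ends in general position.\<close>
  define U where "U = {x. dist x (q c) < \<delta> \<and> det3 (r a) (r b) x * \<sigma> < 0}"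
  have "U = ball (q c) \<delta> \<inter> {x. det3 (r a) (r b) x * \<sigma> < 0}"
    by (auto simp: U_def dist_commute)
  moreover have "open {x. det3 (r a) (r b) x * \<sigma> < 0}"
    by (intro open_Collect_less continuous_intros)
  ultimately have "open U"
    by auto
  moreover have "c1 \<in> U"
    using t1 \<open>dist c1 (q c) < \<delta>\<close> by (simp add: U_def r_def)
  moreover have "finite {(u, v). u \<in> r ` S \<and> v \<in> r ` S \<and> u \<noteq> v}"
    by (rule finite_subset[of _ "r ` S \<times> r ` S"]) (use finS in auto)
  ultimately obtain c2 where c2: "c2 \<in> U"
    "\<And>u v. u \<in> r ` S \<Longrightarrow> v \<in> r ` S \<Longrightarrow> u \<noteq> v \<Longrightarrow> det3 u v c2 \<noteq> 0"
    by (rule_tac avoid_lines[of U "{(u, v). u \<in> r ` S \<and> v \<in> r ` S \<and> u \<noteq> v}"]) auto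
  \<comment> \<open>In the first half follow \<open>\<gamma>\<close> up to \<open>t1\<close>; in the
    second half move only \<open>c\<close>, straight from \<open>r c\<close> to
    \<open>c2\<close>.\<close>
  define \<zeta> where "\<zeta> t s = \<gamma> (t1 * min 1 (2 * t)) s + (if s = c then max 0 (2 * t - 1) *\<^sub>R (c2 - r c) else 0)" for t s
  have early: "same_type S (\<zeta> t)" if "0 \<le> t" "t \<le> 1 / 2" for t
  proof -
    have "\<zeta> t = \<gamma> (t1 * (2 * t))"
      using that by (auto simp: \<zeta>_def)
    have "t1 * (2 * t) \<le> t1 * 1"
      using that t1(3) by (intro mult_left_mono) auto
    moreover have "0 \<le> t1 * (2 * t)"
      using that t1(3) by simp
    ultimately have "same_type S (\<gamma> (t1 * (2 * t)))"
      using same t1 by simp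
    with \<open>\<zeta> t = \<gamma> (t1 * (2 * t))\<close> show ?thesis
      by simp
  qed
  have late: "\<zeta> t s = (if s = c then (1 - (2 * t - 1)) *\<^sub>R r c + (2 * t - 1) *\<^sub>R c2 else r s)"
    if "1 / 2 \<le> t" "t \<le> 1" for t s
    using that by (simp add: \<zeta>_def r_def min_def max_def algebra_simps scaleR_2)
  have \<zeta>_pc: "plane_config S T (\<zeta> t)" if "t \<in> {0..1}" for t
  proof (cases "t \<le> 1 / 2")
    case True
    then show ?thesis
      using early that same_type_plane_config by auto
  next
    case False
    show ?thesis
    proof (rule \<delta>)
      fix s assume "s \<in> S"
      show "dist (\<zeta> t s) (q s) < \<delta>"
      proof (cases "s = c")
        case True
        have "(1 - (2 * t - 1)) *\<^sub>R r c + (2 * t - 1) *\<^sub>R c2 \<in> ball (q c) \<delta>"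
          using False that t1(2)[OF S(3)] c2(1)
          by (intro convexD[OF convex_ball]) (auto simp: U_def dist_commute r_def)
        then show ?thesis
          using late[of t s] False that True by (simp add: dist_commute)
      next
        case False
        then show ?thesis
          using late[of t s] \<open>\<not> t \<le> 1 / 2\<close> that t1(2)[OF \<open>s \<in> S\<close>] by (simp add: r_def)
      qed
    qed
  qed
  have \<zeta>_cont: "continuous_on {0..1} (\<lambda>t. \<zeta> t s)" if "s \<in> S" for s
  proof -
    have *: "0 \<le> t1 * min 1 (2 * t)" "t1 * min 1 (2 * t) \<le> 1" if "0 \<le> t" for t
      using that t1 mult_mono[of t1 1 "min 1 (2 * t)" 1] by auto
    have "continuous_on {0..1} (\<lambda>t. \<gamma> (t1 * min 1 (2 * t)) s)"
      by (rule continuous_on_compose2[OF cont[OF that]]) (use * in \<open>auto intro!: continuous_intros\<close>)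
    then show ?thesis
      unfolding \<zeta>_def by (cases "s = c") (auto intro!: continuous_intros)
  qed
  have \<zeta>_start: "\<zeta> 0 s = s" if "s \<in> S" for s
    using start[OF that] by (simp add: \<zeta>_def)
  have "S \<noteq> {}"
    using S by auto
  obtain F where F: "ambient_isotopy F" "\<And>t s. t \<in> {0..1} \<Longrightarrow> s \<in> S \<Longrightarrow> F t s = \<zeta> t s"
    "\<And>t e. t \<in> {0..1} \<Longrightarrow> e \<in> T \<Longrightarrow> \<exists>a b. F t ` (convex hull e) = closed_segment a b"
    using plane_config_isotopy[OF finS \<open>S \<noteq> {}\<close> graph, of \<zeta>] \<zeta>_cont \<zeta>_start \<zeta>_pc by metis
  have img: "F t ` S = \<zeta> t ` S" if "t \<in> {0..1}" for t
    using F(2)[OF that] by (rule image_cong[OF refl])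
  have r_nz: "det3 (r x) (r y) (r z) \<noteq> 0" if "x \<in> S" "y \<in> S" "z \<in> S" "x \<noteq> y" "x \<noteq> z" "y \<noteq> z" for x y z
    using same_typeD[OF same_r that] by auto
  have no4: "no_four_collinear (F t ` S)" if "t \<in> {0..1}" for t
  proof -
    have "no_four_collinear (\<zeta> t ` S)"
    proof (rule no_four_collinear_image[of S c])
      fix x y z assume *: "x \<in> S - {c}" "y \<in> S - {c}" "z \<in> S - {c}" "x \<noteq> y" "x \<noteq> z" "y \<noteq> z"
      show "det3 (\<zeta> t x) (\<zeta> t y) (\<zeta> t z) \<noteq> 0"
      proof (cases "t \<le> 1 / 2")
        case True
        then show ?thesis
          using early[of t] same_typeD[of S "\<zeta> t" x y z] * that by auto
      next
        case False
        then show ?thesis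
          using r_nz[of x y z] * that by (auto simp: late)
      qed
    qed
    then show ?thesis
      using img[OF that] by simp
  qed
  have end_c: "\<zeta> 1 c = c2" and end_o: "\<And>s. s \<noteq> c \<Longrightarrow> \<zeta> 1 s = r s"
    using late[of 1] by auto
  have r_inj: "r x \<noteq> r y" if "x \<in> S" "y \<in> S" "x \<noteq> y" for x y
    using plane_config_inj[OF same_type_plane_config[OF same_r] that] .
  have nz1: "det3 (\<zeta> 1 x) (\<zeta> 1 y) (\<zeta> 1 z) \<noteq> 0"
    if "x \<in> S" "y \<in> S" "z \<in> S" "x \<noteq> y" "x \<noteq> z" "y \<noteq> z" for x y z
  proof -
    have new: "det3 (r u) (r v) c2 \<noteq> 0" if "u \<in> S" "v \<in> S" "u \<noteq> v" for u v
      using c2(2) r_inj[OF that] that by blast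
    consider "x = c" | "y = c" | "z = c" | "x \<noteq> c" "y \<noteq> c" "z \<noteq> c"
      by blast
    then show ?thesis
    proof cases
      case 1
      then show ?thesis
        using new[of y z] that det3_rot[of "r y" "r z" c2] det3_rot[of c2 "r y" "r z"]
        by (simp add: end_c end_o)
    next
      case 2
      then show ?thesis
        using new[of z x] that det3_rot[of "r z" "r x" c2] det3_rot[of "r x" c2 "r z"]
        by (simp add: end_c end_o)
    next
      case 3
      then show ?thesis
        using new[of x y] that by (simp add: end_c end_o)
    next
      case 4
      then show ?thesis
        using r_nz that by (simp add: end_o)
    qed
  qed
  have "general_position (F 1 ` S)"
    unfolding general_position_def img[of 1, simplified]
  proof (intro ballI impI)
    fix x y z assume "x \<in> \<zeta> 1 ` S" "y \<in> \<zeta> 1 ` S" "z \<in> \<zeta> 1 ` S" "x \<noteq> y \<and> x \<noteq> z \<and> y \<noteq> z"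
    then show "\<not> collinear {x, y, z}"
      unfolding collinear_iff_det3 using nz1 by fastforce
  qed
  moreover have "\<forall>t\<in>{0..1}. (\<forall>e\<in>T. \<exists>a b. F t ` (convex hull e) = closed_segment a b) \<and> no_four_collinear (F t ` S)"
    using F(3) no4 by blast
  ultimately have "same_order_type S (F 1)"
    using supp F(1) unfolding supporting_def by (metis atLeastAtMost_iff order_refl zero_le_one)
  then have "orient (F 1 a) (F 1 b) (F 1 c) = orient a b c"
    using S unfolding same_order_type_def by blast
  then have "sgn (det3 (r a) (r b) c2) = sgn \<sigma>"
    using F(2)[of 1] S by (simp add: orient_det3 end_c end_o \<sigma>_def)
  moreover have "det3 (r a) (r b) c2 * \<sigma> < 0"
    using c2(1) by (simp add: U_def)
  ultimately show False
    by (metis linorder_not_less mult_less_0_iff not_less_iff_gr_or_eq sgn_greater sgn_less)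
qed

end

section \<open>Balanced drawings\<close>

definition cross2 :: "point \<Rightarrow> point \<Rightarrow> real" where
  "cross2 u v = fst u * snd v - snd u * fst v"

lemma det3_cross2: "det3 a b c = cross2 (b - a) (c - a)"
  by (simp add: det3_def cross2_def)

lemma cross2_parallel:
  assumes "cross2 u v = 0" "cross2 u w = 0" "u \<noteq> 0"
  shows "cross2 v w = 0"
proof -
  have "fst u * cross2 v w = fst v * cross2 u w - fst w * cross2 u v"
    "snd u * cross2 v w = snd v * cross2 u w - snd w * cross2 u v"
    by (simp_all add: cross2_def algebra_simps)
  then show ?thesis
    using assms by (auto simp: prod_eq_iff)
qed

lemma det3_line_transfer:
  assumes "det3 A B P = 0" "det3 A B Q = 0" "P \<noteq> Q" "det3 P Q z = 0"
  shows "det3 A B z = 0"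
proof (cases "A = B")
  case False
  obtain k l where kl: "P = A + k *\<^sub>R (B - A)" "Q = A + l *\<^sub>R (B - A)"
    using det3_zero_on_line[OF assms(1) False] det3_zero_on_line[OF assms(2) False] by metis
  have "det3 P Q z = (l - k) * det3 A B z"
    unfolding kl det3_def by (simp add: algebra_simps)
  moreover have "l \<noteq> k"
    using assms(3) kl by auto
  ultimately show ?thesis
    using assms(4) by simp
qed simp

lemma halfplane_extreme:
  assumes "finite A" "A \<noteq> {}" "\<And>x. x \<in> A \<Longrightarrow> \<sigma> * det3 a x b > 0"
  obtains x0 where "x0 \<in> A" "\<And>x. x \<in> A \<Longrightarrow> \<sigma> * det3 a x x0 \<ge> 0"
proof -
  \<comment> \<open>Up to a constant factor this is the cotangent of the angle between the rays from
    \<open>a\<close> to \<open>x\<close> and to \<open>b\<close>; its maximum picks the ray closest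
    to \<open>b\<close>.\<close>
  define f where "f x = ((x - a) \<bullet> (b - a)) / (\<sigma> * det3 a x b)" for x
  obtain x0 where x0: "x0 \<in> A" and max: "\<And>x. x \<in> A \<Longrightarrow> f x \<le> f x0"
    using finite_imageI[OF assms(1), of f] assms(2) Max_in[of "f ` A"] Max_ge[of "f ` A"]
    by (metis (no_types, lifting) empty_is_image imageE imageI)
  have "\<sigma> * det3 a x x0 \<ge> 0" if "x \<in> A" for x
  proof -
    have pos: "\<sigma> * det3 a x b > 0" "\<sigma> * det3 a x0 b > 0"
      using assms(3) that x0 by auto
    have "a \<noteq> b"
      using pos(1) by auto
    then have "(b - a) \<bullet> (b - a) > 0"
      by simp
    have frac: "A * d' \<le> A' * d" if "A / d \<le> A' / d'" "d > 0" "d' > 0" for A A' d d' :: real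
      using that by (simp add: field_simps)
    have "((x - a) \<bullet> (b - a)) * (\<sigma> * det3 a x0 b) \<le> ((x0 - a) \<bullet> (b - a)) * (\<sigma> * det3 a x b)"
      by (rule frac[OF max[OF that, unfolded f_def] pos])
    moreover have "((x0 - a) \<bullet> (b - a)) * (\<sigma> * det3 a x b) - ((x - a) \<bullet> (b - a)) * (\<sigma> * det3 a x0 b)
      = (\<sigma> * det3 a x x0) * ((b - a) \<bullet> (b - a))"
      by (simp add: det3_def inner_prod_def algebra_simps)
    ultimately have "(\<sigma> * det3 a x x0) * ((b - a) \<bullet> (b - a)) \<ge> 0"
      by simp
    then show ?thesis
      using \<open>(b - a) \<bullet> (b - a) > 0\<close> by (simp add: zero_le_mult_iff)
  qed
  then show ?thesis
    using that x0 by blast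
qed

context plane_graph
begin

definition nb :: "point \<Rightarrow> point set" where
  "nb u = {v. {u, v} \<in> T}"

text \<open>The vertices of the convex hull, described as exposed points: strict maximisers of a
  linear functional, which is the form that maximum principles need.\<close>

definition outer :: "point set" where
  "outer = {h \<in> S. \<exists>g. \<forall>s\<in>S - {h}. g \<bullet> s < g \<bullet> h}"

definition inner :: "point set" where
  "inner = S - outer"

lemma nb_sym: "v \<in> nb u \<Longrightarrow> u \<in> nb v"
  by (simp add: nb_def insert_commute)

lemma nbD: "v \<in> nb u \<Longrightarrow> {u, v} \<in> T" "v \<in> nb u \<Longrightarrow> v \<in> S" "v \<in> nb u \<Longrightarrow> v \<noteq> u"
  using edgeD[of u v] by (simp_all add: nb_def)

lemma finite_nb: "finite (nb u)"
  by (rule finite_subset[OF _ finS]) (use nbD in blast)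

lemma inner_S: "u \<in> inner \<Longrightarrow> u \<in> S"
  by (simp add: inner_def)

end

text \<open>No closed half-plane bounded by a line through an inner vertex contains all its
  neighbours. In this form maximality will enter the arguments about balanced drawings.\<close>

locale surrounded_plane_graph = plane_graph +
  assumes surrounded: "u \<in> inner \<Longrightarrow> g \<noteq> 0 \<Longrightarrow> \<exists>x\<in>nb u. g \<bullet> x > g \<bullet> u"
begin

text \<open>A linear functional with equal values at \<^term>\<open>e\<close> and \<^term>\<open>e'\<close> would attain both of its extrema
  over \<^term>\<open>Y\<close> there.\<close>

lemma inner_set_boundary:
  assumes "Y \<subseteq> inner" "Y \<noteq> {}" and nb: "\<And>u. u \<in> Y \<Longrightarrow> nb u \<subseteq> Y \<union> {e, e'}"
  shows False
proof -
  obtain g where "g \<noteq> 0" and ge: "g \<bullet> e = g \<bullet> e'"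
  proof (cases "e = e'")
    case True
    then show ?thesis
      using that[of "(1, 0)"] by (simp add: zero_prod_def)
  next
    case False
    then show ?thesis
      using that[of "(snd e - snd e', fst e' - fst e)"] by (auto simp: prod_eq_iff inner_prod_def algebra_simps)
  qed
  have "finite Y"
    using assms(1) finS inner_S by (meson finite_subset subsetI subset_trans)
  have below: "f \<bullet> y < f \<bullet> e" if f: "f \<noteq> 0" "f \<bullet> e = f \<bullet> e'" "y \<in> Y" for f y
  proof -
    obtain m where m: "m \<in> Y" "\<And>y. y \<in> Y \<Longrightarrow> f \<bullet> y \<le> f \<bullet> m"
      using finite_imageI[OF \<open>finite Y\<close>, of "\<lambda>y. f \<bullet> y"] \<open>Y \<noteq> {}\<close> Max_in[of "(\<lambda>y. f \<bullet> y) ` Y"]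
        Max_ge[of "(\<lambda>y. f \<bullet> y) ` Y"] by (metis (no_types, lifting) empty_is_image imageE imageI)
    obtain x where "x \<in> nb m" "f \<bullet> x > f \<bullet> m"
      using surrounded[of m f] m assms(1) f by blast
    then have "f \<bullet> e > f \<bullet> m"
      using nb[OF m(1)] m(2)[of x] f(2) by force
    then show ?thesis
      using m(2)[OF f(3)] by simp
  qed
  obtain y where "y \<in> Y"
    using \<open>Y \<noteq> {}\<close> by blast
  then show False
    using below[of g y] below[of "- g" y] \<open>g \<noteq> 0\<close> ge by simp
qed

text \<open>Tutte's equilibrium condition, with directed weights: each inner vertex has its own row
  \<open>w u\<close>, unrelated to the rows of its neighbours.\<close>

definition balanced :: "(point \<Rightarrow> point \<Rightarrow> real) \<Rightarrow> (point \<Rightarrow> point) \<Rightarrow> bool" where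
  "balanced w p \<longleftrightarrow> (\<forall>u\<in>inner. (\<forall>x\<in>nb u. w u x > 0) \<and> (\<Sum>x\<in>nb u. w u x *\<^sub>R (p x - p u)) = 0)"

lemma balanced_one_sided:
  assumes "balanced w p" "u \<in> inner" "\<And>x. x \<in> nb u \<Longrightarrow> g \<bullet> (p x - p u) \<ge> 0" "x \<in> nb u"
  shows "g \<bullet> (p x - p u) = 0"
proof -
  have w: "\<And>x. x \<in> nb u \<Longrightarrow> w u x > 0" and 0: "(\<Sum>x\<in>nb u. w u x *\<^sub>R (p x - p u)) = 0"
    using assms(1,2) by (auto simp: balanced_def)
  have "(\<Sum>x\<in>nb u. w u x * (g \<bullet> (p x - p u))) = g \<bullet> (\<Sum>x\<in>nb u. w u x *\<^sub>R (p x - p u))"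
    by (simp add: inner_sum_right)
  then have "(\<Sum>x\<in>nb u. w u x * (g \<bullet> (p x - p u))) = 0"
    using 0 by simp
  then have "w u x * (g \<bullet> (p x - p u)) = 0"
    using finite_nb assms(3,4) w by (subst (asm) sum_nonneg_eq_0_iff) (auto simp: less_imp_le)
  then show ?thesis
    using w[OF assms(4)] by simp
qed

lemma balanced_one_sided_det3:
  assumes "balanced w p" "u \<in> inner" "det3 A B (p u) = 0"
    "\<And>x. x \<in> nb u \<Longrightarrow> \<sigma> * det3 A B (p x) \<ge> 0" "\<sigma> \<noteq> 0" "x \<in> nb u"
  shows "det3 A B (p x) = 0"
proof -
  define g where "g = \<sigma> *\<^sub>R (snd A - snd B, fst B - fst A)"
  have "g \<bullet> (y - p u) = \<sigma> * (det3 A B y - det3 A B (p u))" for y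
    by (simp add: g_def inner_prod_def det3_def algebra_simps)
  then have "g \<bullet> (y - p u) = \<sigma> * det3 A B y" for y
    using assms(3) by simp
  then show ?thesis
    using balanced_one_sided[OF assms(1,2), of g x] assms(4-6) by simp
qed

end

section \<open>Balanced drawings with possibly degenerate triples\<close>

locale weak_drawing = surrounded_plane_graph +
  fixes p :: "point \<Rightarrow> point" and w :: "point \<Rightarrow> point \<Rightarrow> real"
  assumes weak: "weak_type S p"
    and outer_fixed: "h \<in> outer \<Longrightarrow> p h = h"
    and bal: "balanced w p"
begin

lemma weak_pos: "a \<in> S \<Longrightarrow> b \<in> S \<Longrightarrow> c \<in> S \<Longrightarrow> det3 a b c > 0 \<Longrightarrow> det3 (p a) (p b) (p c) \<ge> 0"
  by (rule weak_type_pos[OF weak])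

lemma image_pos_imp_pos:
  assumes "a \<in> S" "b \<in> S" "c \<in> S" "\<sigma> * det3 (p a) (p b) (p c) > 0" "\<sigma> \<noteq> 0"
  shows "\<sigma> * det3 a b c > 0"
proof -
  have "a \<noteq> b" "a \<noteq> c" "b \<noteq> c"
    using assms(4) by auto
  then have "det3 a b c \<noteq> 0" "det3 a b c * det3 (p a) (p b) (p c) \<ge> 0"
    using gp weak_typeD[OF weak] assms by auto
  then show ?thesis
    using assms(4) by (auto simp: zero_less_mult_iff zero_le_mult_iff)
qed

text \<open>Maximum principle. If the maximum of \<open>g\<close> over the other images reached the
  level of \<open>h\<close>, the vertices attaining it would be inner, and balance would put their
  neighbours at the same level, leaving \<open>h\<close> as the only exit from this set.\<close>

lemma outer_strict:
  assumes "h \<in> S" "\<forall>s\<in>S - {h}. g \<bullet> s < g \<bullet> h" "u \<in> S" "u \<noteq> h"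
  shows "g \<bullet> p u < g \<bullet> h"
proof (rule ccontr)
  assume neg: "\<not> g \<bullet> p u < g \<bullet> h"
  define M where "M = (\<lambda>u. g \<bullet> p u) ` (S - {h})"
  have M: "finite M" "M \<noteq> {}"
    using finS assms by (auto simp: M_def)
  define m where "m = Max M"
  have m_ge: "g \<bullet> p v \<le> m" if "v \<in> S" "v \<noteq> h" for v
    unfolding m_def by (rule Max_ge[OF M(1)]) (use that in \<open>auto simp: M_def\<close>)
  have hm: "g \<bullet> h \<le> m"
    using m_ge[OF assms(3,4)] neg by simp
  define Y where "Y = {v \<in> S - {h}. g \<bullet> p v = m}"
  have "m \<in> M"
    unfolding m_def by (rule Max_in[OF M])
  then have "Y \<noteq> {}"
    by (auto simp: Y_def M_def)
  have h_out: "h \<in> outer"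
    unfolding outer_def using assms(1,2) by blast
  have Y_inner: "Y \<subseteq> inner"
  proof
    fix v assume v: "v \<in> Y"
    then have "v \<notin> outer"
      using outer_fixed[of v] bspec[OF assms(2), of v] hm by (auto simp: Y_def)
    then show "v \<in> inner"
      using v by (simp add: inner_def Y_def)
  qed
  have "nb v \<subseteq> Y \<union> {h, h}" if "v \<in> Y" for v
  proof
    fix x assume x: "x \<in> nb v"
    have gle: "g \<bullet> p y \<le> m" if "y \<in> nb v" for y
      using m_ge[of y] nbD(2)[OF that] hm outer_fixed[OF h_out] by (cases "y = h") auto
    have "(- g) \<bullet> (p x - p v) = 0"
      by (rule balanced_one_sided[OF bal _ _ x])
        (use gle Y_inner \<open>v \<in> Y\<close> in \<open>auto simp: Y_def inner_diff_right\<close>)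
    then have "g \<bullet> p x = m"
      using \<open>v \<in> Y\<close> by (simp add: Y_def inner_diff_right)
    then show "x \<in> Y \<union> {h, h}"
      using nbD(2)[OF x] by (auto simp: Y_def)
  qed
  then show False
    using inner_set_boundary[OF Y_inner \<open>Y \<noteq> {}\<close>] by blast
qed

text \<open>By \<open>outer_strict\<close> an extreme point stays strictly exposed in the drawing,
  so no other vertex can fall on it.\<close>

lemma coincident_inner:
  assumes "a \<in> S" "b \<in> S" "a \<noteq> b" "p a = p b"
  shows "a \<in> inner"
proof (rule ccontr)
  assume "a \<notin> inner"
  then have "a \<in> outer"
    using assms by (simp add: inner_def)
  then obtain g where "\<forall>s\<in>S - {a}. g \<bullet> s < g \<bullet> a"
    by (auto simp: outer_def)
  then show False
    using outer_strict[OF assms(1) _ assms(2)] assms outer_fixed[OF \<open>a \<in> outer\<close>] by fastforce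
qed

lemma between_inner:
  assumes "c \<in> S" "d \<in> S" "e \<in> S" "e \<noteq> c" "e \<noteq> d" "p e \<in> closed_segment (p c) (p d)"
  shows "e \<in> inner"
proof (rule ccontr)
  assume "e \<notin> inner"
  then have e: "e \<in> outer"
    using assms by (simp add: inner_def)
  then obtain g where g: "\<forall>s\<in>S - {e}. g \<bullet> s < g \<bullet> e"
    by (auto simp: outer_def)
  obtain l where l: "p e = (1 - l) *\<^sub>R p c + l *\<^sub>R p d" "0 \<le> l" "l \<le> 1"
    using assms(6) unfolding in_segment by blast
  have "g \<bullet> p c < g \<bullet> e" "g \<bullet> p d < g \<bullet> e"
    using outer_strict[OF assms(3) g] assms by auto
  then have "(1 - l) * (g \<bullet> p c) + l * (g \<bullet> p d) < g \<bullet> e"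
    using l by (intro convex_bound_lt) auto
  then show False
    using l(1) outer_fixed[OF e] by (metis inner_add_right inner_scaleR_right order_less_irrefl)
qed

text \<open>A neighbour \<open>y\<close> of \<open>c\<close> separated from \<open>c\<close> by the
  line \<open>a b\<close> has \<open>a\<close> and \<open>b\<close> on one side of the edge
  \<open>c y\<close>. With the image of \<open>c\<close> between those of \<open>a\<close> and
  \<open>b\<close>, this is possible only if \<open>y\<close> is drawn on their line. Thus all
  neighbours lie weakly on one side, and balance puts them on the line.\<close>

lemma on_edge_neighbours_collinear:
  assumes ab: "{a, b} \<in> T" and c: "c \<in> inner" "c \<noteq> a" "c \<noteq> b"
    and pc: "p c = p a + l *\<^sub>R (p b - p a)" "0 < l" "l < 1" and x: "x \<in> nb c"
  shows "det3 (p a) (p b) (p x) = 0"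
proof -
  have S: "a \<in> S" "b \<in> S" "c \<in> S" "a \<noteq> b"
    using edgeD[OF ab] inner_S[OF c(1)] by auto
  define \<sigma> where "\<sigma> = det3 a b c"
  have "\<sigma> \<noteq> 0"
    unfolding \<sigma>_def using gp S c by metis
  have "\<sigma> * det3 (p a) (p b) (p y) \<ge> 0" if y: "y \<in> nb c" for y
  proof (cases "y = a \<or> y = b")
    case False
    have yS: "y \<in> S" "y \<noteq> c" "{c, y} \<in> T"
      using nbD[OF y] by auto
    have wk: "det3 a b y * det3 (p a) (p b) (p y) \<ge> 0"
      using weak_typeD[OF weak S(1,2) yS(1)] S False by auto
    have "det3 a b y \<noteq> 0"
      using gp[OF S(1,2) yS(1)] S False by auto
    then consider "\<sigma> * det3 a b y > 0" | "\<sigma> * det3 a b y < 0"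
      using \<open>\<sigma> \<noteq> 0\<close> by (metis linorder_neqE_linordered_idom mult_eq_0_iff)
    then show ?thesis
    proof cases
      case 1
      then show ?thesis
        using wk by (auto simp: zero_less_mult_iff zero_le_mult_iff)
    next
      case 2
      then have "det3 c y a * det3 c y b > 0"
        using noncross_det3[OF ab yS(3)] c False unfolding \<sigma>_def by fastforce
      moreover have "det3 c y a * det3 (p c) (p y) (p a) \<ge> 0" "det3 c y b * det3 (p c) (p y) (p b) \<ge> 0"
        using weak_typeD[OF weak S(3) yS(1)] S c yS False by auto
      moreover have "det3 (p c) (p y) (p a) = l * det3 (p a) (p b) (p y)"
        "det3 (p c) (p y) (p b) = - (1 - l) * det3 (p a) (p b) (p y)"
        unfolding pc(1) det3_def by (simp_all add: algebra_simps)
      ultimately have "det3 (p a) (p b) (p y) = 0"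
        using pc(2,3) by (auto simp: zero_less_mult_iff zero_le_mult_iff mult_le_0_iff)
      then show ?thesis
        by simp
    qed
  qed auto
  moreover have "det3 (p a) (p b) (p c) = 0"
    unfolding pc(1) det3_def by (simp add: algebra_simps)
  ultimately show ?thesis
    using balanced_one_sided_det3[OF bal c(1), of "p a" "p b" \<sigma> x] \<open>\<sigma> \<noteq> 0\<close> x by blast
qed

end

section \<open>Obstructions to planarity in terms of orientations\<close>

context plane_graph
begin

text \<open>For positive \<open>\<sigma>\<close>: \<open>b\<close> lies in the triangle
  \<open>a x y\<close>, whose sides \<open>a x\<close> and \<open>a y\<close> are edges. So the edge
  from \<open>b\<close> ends inside the triangle or leaves it through the side \<open>x y\<close>,
  that is, to the left of the ray from \<open>b\<close> to \<open>x\<close>. Negative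
  \<open>\<sigma>\<close> gives the mirror image.\<close>

lemma cone_neighbours:
  assumes e: "{a, x} \<in> T" "{a, y} \<in> T" "{b, y'} \<in> T"
    and ne: "a \<noteq> y'" "x \<noteq> y'" "y \<noteq> y'" and "\<sigma> \<noteq> 0"
    and s: "\<sigma> * det3 a x b > 0" "\<sigma> * det3 a b y > 0" "\<sigma> * det3 b x y > 0"
  shows "\<sigma> * det3 a x y' > 0 \<or> \<sigma> * det3 b x y' > 0"
proof (rule ccontr)
  assume neg: "\<not> (\<sigma> * det3 a x y' > 0 \<or> \<sigma> * det3 b x y' > 0)"
  define D where "D u v w = \<sigma> * det3 u v w" for u v w
  have rot: "D v w u = D u v w" for u v w
    unfolding D_def by (simp add: det3_rot)
  have swap: "D u w v = - D u v w" for u v w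
    unfolding D_def by (simp add: det3_swap'[of u v w])
  have dist: "a \<noteq> b" "x \<noteq> b" "y \<noteq> b" "x \<noteq> y" "x \<noteq> a" "y \<noteq> a"
    using s by auto
  have S: "a \<in> S" "b \<in> S" "x \<in> S" "y \<in> S" "y' \<in> S" "b \<noteq> y'"
    using edgeD e by blast+
  have nz: "D u v w \<noteq> 0" if "u \<in> S" "v \<in> S" "w \<in> S" "u \<noteq> v" "u \<noteq> w" "v \<noteq> w" for u v w
    using gp that \<open>\<sigma> \<noteq> 0\<close> by (simp add: D_def)
  have "D a x y' \<noteq> 0" "D b x y' \<noteq> 0"
    using nz[of a x y'] nz[of b x y'] dist ne S by auto
  then have D: "D a x b > 0" "D a b y > 0" "D b x y > 0" "D a x y' < 0" "D b x y' < 0"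
    using s neg unfolding D_def by linarith+
  have DD: "D u v c * D u' v' c' > 0 \<longleftrightarrow> det3 u v c * det3 u' v' c' > 0" for u v c u' v' c'
  proof -
    have "D u v c * D u' v' c' = (\<sigma> * \<sigma>) * (det3 u v c * det3 u' v' c')"
      by (simp add: D_def)
    moreover have "\<sigma> * \<sigma> > 0"
      using \<open>\<sigma> \<noteq> 0\<close> by (auto simp: zero_less_mult_iff)
    ultimately show ?thesis
      by (simp add: zero_less_mult_iff)
  qed
  have nc: "D a x b * D a x y' > 0 \<or> D b y' a * D b y' x > 0"
    "D a y b * D a y y' > 0 \<or> D b y' a * D b y' y > 0"
    unfolding DD using noncross_det3[of a x b y'] noncross_det3[of a y b y'] e dist ne S by auto
  have "D a x b * D a x y' < 0"
    using D by (simp add: mult_pos_neg)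
  then have "D b y' a * D b y' x > 0"
    using nc(1) by linarith
  moreover have "D b y' x > 0"
    using D swap[of b x y'] by simp
  ultimately have 1: "D b y' a > 0"
    by (simp add: zero_less_mult_iff)
  \<comment> \<open>A Pluecker relation among the determinants. Such identities replace the picture:
    known signs of the other factors decide the missing one.\<close>
  have idb: "D b x y * D b y' a + D b y a * D b y' x + D b a x * D b y' y = 0"
    by (simp add: D_def det3_def algebra_simps)
  have pos: "D b y a > 0" "D b a x > 0"
    using D rot[of b y a] rot[of b a x] rot[of x b a] by linarith+
  have 2: "D b y' y < 0"
  proof (rule ccontr)
    assume "\<not> D b y' y < 0"
    then have "D b a x * D b y' y \<ge> 0"
      using pos by simp
    moreover have "D b x y * D b y' a > 0" "D b y a * D b y' x > 0"
      using D 1 pos \<open>D b y' x > 0\<close> by auto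
    ultimately show False
      using idb by linarith
  qed
  have "\<not> D b y' a * D b y' y > 0"
    using 1 2 by (simp add: zero_less_mult_iff)
  then have "D a y b * D a y y' > 0"
    using nc(2) by blast
  moreover have "D a y b < 0"
    using D swap[of a b y] by simp
  ultimately have 3: "D a y y' < 0"
    by (simp add: zero_less_mult_iff)
  have "D a x y = D b x y + D a x b + D a b y"
    by (simp add: D_def det3_def algebra_simps)
  then have 4: "D a x y > 0"
    using D by simp
  have 5: "D a b y' > 0"
    using 1 rot[of b y' a] by linarith
  have "D a x y * D a b y' = D a b y * D a x y' + D a x b * D a y y'"
    by (simp add: D_def det3_def algebra_simps)
  moreover have "D a x y * D a b y' > 0" "D a b y * D a x y' < 0" "D a x b * D a y y' < 0"
    using 3 4 5 D by (auto simp: mult_less_0_iff)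
  ultimately show False
    by linarith
qed

text \<open>One case of \<open>no_interleaved_stars\<close>: by \<open>C\<close>, the point
  \<open>a\<close> is seen from \<open>b\<close> in the sector between \<open>x'\<close> and
  \<open>y\<close>. Comparing edges of the two stars fixes further signs around \<open>b\<close>
  until a Pluecker relation fails.\<close>

lemma no_interleaved_stars_aux:
  assumes e: "{a, x} \<in> T" "{a, x'} \<in> T" "{b, y} \<in> T" "{b, y'} \<in> T"
    and S: "a \<noteq> b" and "\<sigma> \<noteq> 0"
    and A: "\<sigma> * det3 a x' y > 0" "\<sigma> * det3 a y x > 0" "\<sigma> * det3 a x y' > 0" "\<sigma> * det3 a y' x' > 0"
    and B: "\<sigma> * det3 b x' y > 0" "\<sigma> * det3 b y x > 0" "\<sigma> * det3 b x y' > 0" "\<sigma> * det3 b y' x' > 0"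
    and C: "\<sigma> * det3 b x' a > 0" "\<sigma> * det3 b a y > 0"
  shows False
proof -
  define D where "D u v w = \<sigma> * det3 u v w" for u v w
  have rot: "D v w u = D u v w" for u v w
    unfolding D_def by (simp add: det3_rot)
  have swap: "D u w v = - D u v w" for u v w
    unfolding D_def by (simp add: det3_swap'[of u v w])
  have dist: "x \<noteq> y" "x \<noteq> y'" "x' \<noteq> y" "x' \<noteq> y'" "a \<noteq> y" "a \<noteq> y'" "b \<noteq> x" "b \<noteq> x'"
    using A B by auto
  have inS: "b \<in> S" "y \<in> S" "y' \<in> S" "b \<noteq> y" "b \<noteq> y'"
    using edgeD e by blast+
  have "y \<noteq> y'"
    using A swap[of a x y] by (auto simp: D_def)
  then have "D b y y' \<noteq> 0"
    using gp[of b y y'] inS \<open>\<sigma> \<noteq> 0\<close> by (simp add: D_def)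
  note A' = A[folded D_def] and B' = B[folded D_def] and C' = C[folded D_def]
  have DD: "D u v c * D u' v' c' > 0 \<longleftrightarrow> det3 u v c * det3 u' v' c' > 0" for u v c u' v' c'
  proof -
    have "D u v c * D u' v' c' = (\<sigma> * \<sigma>) * (det3 u v c * det3 u' v' c')"
      by (simp add: D_def)
    moreover have "\<sigma> * \<sigma> > 0"
      using \<open>\<sigma> \<noteq> 0\<close> by (auto simp: zero_less_mult_iff)
    ultimately show ?thesis
      by (simp add: zero_less_mult_iff)
  qed
  have nc: "D a x b * D a x y > 0 \<or> D b y a * D b y x > 0"
    "D a x b * D a x y' > 0 \<or> D b y' a * D b y' x > 0"
    unfolding DD using noncross_det3[of a x b y] noncross_det3[of a x b y'] e dist S by auto
  have "D b y a < 0"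
    using C'(2) swap[of b a y] by simp
  then have "D b y a * D b y x < 0"
    using B'(2) by (simp add: mult_neg_pos)
  then have "D a x b * D a x y > 0"
    using nc(1) by linarith
  moreover have "D a x y < 0"
    using A'(2) swap[of a y x] by simp
  ultimately have 1: "D a x b < 0"
    by (simp add: zero_less_mult_iff)
  then have "D a x b * D a x y' < 0"
    using A'(3) by (simp add: mult_neg_pos)
  then have "D b y' a * D b y' x > 0"
    using nc(2) by linarith
  moreover have "D b y' x < 0"
    using B'(3) swap[of b x y'] by simp
  ultimately have "D b y' a < 0"
    by (simp add: zero_less_mult_iff)
  then have 2: "D b a y' > 0"
    using swap[of b a y'] by simp
  have 3: "D b x a > 0"
    using 1 swap[of a x b] rot[of b x a] by linarith
  show False
  proof (cases "D b y y' > 0")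
    case True
    have "D b x y * D b a y' = D b x a * D b y y' + D b x y' * D b a y"
      by (simp add: D_def det3_def algebra_simps)
    moreover have "D b x a * D b y y' > 0" "D b x y' * D b a y > 0"
      using 3 True B' C' by auto
    moreover have "D b x y * D b a y' < 0"
      using 2 B'(2) swap[of b y x] by (simp add: mult_less_0_iff)
    ultimately show False
      by linarith
  next
    case False
    then have "D b y' y > 0"
      using \<open>D b y y' \<noteq> 0\<close> swap[of b y y'] by simp
    have "D b y' a * D b x' y = D b y' x' * D b a y + D b y' y * D b x' a"
      by (simp add: D_def det3_def algebra_simps)
    moreover have "D b y' x' * D b a y > 0" "D b y' y * D b x' a > 0"
      using B' C' \<open>D b y' y > 0\<close> by auto
    moreover have "D b y' a * D b x' y < 0"
      using \<open>D b y' a < 0\<close> B'(1) by (simp add: mult_less_0_iff)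
    ultimately show False
      by linarith
  qed
qed

text \<open>Seen from \<open>a\<close> and from \<open>b\<close> alike, the points come in the
  cyclic order \<open>x'\<close>, \<open>y\<close>, \<open>x\<close>, \<open>y'\<close>. So the
  paths \<open>x a x'\<close> and \<open>y b y'\<close> interleave and would have to cross. The four
  sectors at \<open>b\<close> in which \<open>a\<close> may lie are exchanged by renaming and, with
  \<open>\<sigma>\<close> equal to -1, reflection.\<close>

lemma no_interleaved_stars:
  assumes e: "{a, x} \<in> T" "{a, x'} \<in> T" "{b, y} \<in> T" "{b, y'} \<in> T" and "a \<noteq> b"
    and A: "det3 a x' y > 0" "det3 a y x > 0" "det3 a x y' > 0" "det3 a y' x' > 0"
    and B: "det3 b x' y > 0" "det3 b y x > 0" "det3 b x y' > 0" "det3 b y' x' > 0"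
  shows False
proof -
  have inS: "a \<in> S" "b \<in> S" "x \<in> S" "x' \<in> S" "y \<in> S" "y' \<in> S" "x \<noteq> a" "x' \<noteq> a"
    using edgeD e by blast+
  have dist: "a \<noteq> y" "a \<noteq> y'" "b \<noteq> x" "b \<noteq> x'" "b \<noteq> y" "b \<noteq> y'"
    using A B by auto
  have nz: "det3 b x' a \<noteq> 0" "det3 b y a \<noteq> 0" "det3 b x a \<noteq> 0" "det3 b y' a \<noteq> 0"
    using gp[of b x' a] gp[of b y a] gp[of b x a] gp[of b y' a] inS dist \<open>a \<noteq> b\<close> by auto
  note aux = no_interleaved_stars_aux[of a _ _ b]
  have sw: "det3 u w v = - det3 u v w" for u v w
    by (rule det3_swap')
  have 1: False if "det3 b x' a > 0" "det3 b a y > 0"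
    using aux[of x x' y y' 1] e A B \<open>a \<noteq> b\<close> that by simp
  have 2: False if "det3 b y a > 0" "det3 b a x > 0"
    using aux[of x' x y y' "-1"] e A B \<open>a \<noteq> b\<close> that
      sw[of a x' y] sw[of a y x] sw[of a x y'] sw[of a y' x']
      sw[of b x' y] sw[of b y x] sw[of b x y'] sw[of b y' x'] sw[of b a x] sw[of b y a] by simp
  have 3: False if "det3 b x a > 0" "det3 b a y' > 0"
    using aux[of x' x y' y 1] e A B \<open>a \<noteq> b\<close> that by simp
  have 4: False if "det3 b y' a > 0" "det3 b a x' > 0"
    using aux[of x x' y' y "-1"] e A B \<open>a \<noteq> b\<close> that
      sw[of a x' y] sw[of a y x] sw[of a x y'] sw[of a y' x']
      sw[of b x' y] sw[of b y x] sw[of b x y'] sw[of b y' x'] sw[of b a x'] sw[of b y' a] by simp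
  have flip: "det3 b a v > 0 \<longleftrightarrow> det3 b v a < 0" for v
    using sw[of b a v] by simp
  have id1: "det3 b x' x * det3 b y a = det3 b x' y * det3 b x a + det3 b x' a * det3 b y x"
    by (simp add: det3_def algebra_simps)
  have id2: "det3 b x x' * det3 b y' a = det3 b x y' * det3 b x' a + det3 b x a * det3 b y' x'"
    by (simp add: det3_def algebra_simps)
  \<comment> \<open>If \<open>a\<close> is in none of the four sectors, all four points lie on one
    side of the line \<open>a b\<close>, although they wind around \<open>b\<close>.\<close>
  consider "det3 b x' a > 0" "det3 b y a > 0" "det3 b x a > 0" "det3 b y' a > 0"
    | "det3 b x' a < 0" "det3 b y a < 0" "det3 b x a < 0" "det3 b y' a < 0"
    using 1 2 3 4 nz flip by (metis linorder_neqE_linordered_idom)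
  then show False
  proof cases
    case 1
    have "det3 b x' x * det3 b y a > 0"
      unfolding id1 using 1 B by (simp add: add_pos_pos)
    moreover have "det3 b x x' * det3 b y' a > 0"
      unfolding id2 using 1 B by (simp add: add_pos_pos)
    ultimately have "det3 b x' x > 0" "det3 b x x' > 0"
      using 1 by (meson zero_less_mult_pos2)+
    then show False
      using sw[of b x x'] by simp
  next
    case 2
    have "det3 b x' x * det3 b y a < 0"
      unfolding id1 using 2 B by (intro add_neg_neg) (auto simp: mult_less_0_iff)
    moreover have "det3 b x x' * det3 b y' a < 0"
      unfolding id2 using 2 B by (intro add_neg_neg) (auto simp: mult_less_0_iff)
    ultimately have "det3 b x' x > 0" "det3 b x x' > 0"
      using 2 by (simp_all add: mult_less_0_iff)
    then show False
      using sw[of b x x'] by simp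
  qed
qed

end

section \<open>Coinciding vertices\<close>

context weak_drawing
begin

text \<open>\<open>x\<close> and \<open>x'\<close> are drawn on opposite rays from \<open>a\<close>.
  Neighbours of \<open>b\<close> strictly on both sides of their line would interleave with them,
  and already so in \<open>S\<close>, because strict orientations of images agree with those of
  \<open>S\<close>. So the neighbours of \<open>b\<close> lie on one side, and balance puts them on
  the line.\<close>

lemma coincident_straight_neighbours:
  assumes ab: "a \<in> S" "b \<in> inner" "a \<noteq> b" "p a = p b"
    and x: "x \<in> nb a" "x' \<in> nb a" "p x' = p a + \<alpha> *\<^sub>R v" "p x = p a - \<beta> *\<^sub>R v" "\<alpha> > 0" "\<beta> > 0"
    and y: "y \<in> nb b"
  shows "cross2 v (p y - p a) = 0"
proof -
  define W where "W z = cross2 v (p z - p a)" for z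
  have Wd: "W z = det3 (p a) (p a + v) (p z)" for z
    by (simp add: W_def det3_cross2)
  have "W b = 0"
    using ab by (simp add: W_def cross2_def)
  have not_both: False if y: "y \<in> nb b" "W y > 0" and y': "y' \<in> nb b" "W y' < 0" for y y'
  proof -
    have S: "b \<in> S" "x \<in> S" "x' \<in> S" "y \<in> S" "y' \<in> S"
      using inner_S ab(2) nbD(2) x(1,2) y(1) y'(1) by blast+
    have im: "det3 (p a) (p x') (p y) = \<alpha> * W y" "det3 (p a) (p y) (p x) = \<beta> * W y"
      "det3 (p a) (p x) (p y') = \<beta> * - W y'" "det3 (p a) (p y') (p x') = \<alpha> * - W y'"
      unfolding x(3,4) by (simp_all add: det3_def W_def cross2_def algebra_simps)
    have im': "det3 (p c) (p x') (p y) > 0" "det3 (p c) (p y) (p x) > 0"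
      "det3 (p c) (p x) (p y') > 0" "det3 (p c) (p y') (p x') > 0" if "p c = p a" for c
      unfolding that im using x(5,6) y(2) y'(2) by (simp_all add: mult_pos_pos mult_pos_neg)
    have pos: "det3 c x' y > 0" "det3 c y x > 0" "det3 c x y' > 0" "det3 c y' x' > 0"
      if "p c = p a" "c \<in> S" for c
      using image_pos_imp_pos[of c x' y 1] image_pos_imp_pos[of c y x 1]
        image_pos_imp_pos[of c x y' 1] image_pos_imp_pos[of c y' x' 1] im'[OF that(1)] that(2) S
      by simp_all
    show False
      by (rule no_interleaved_stars[of a x x' b y y'])
        (use pos[of a] pos[of b] ab S nbD(1)[OF x(1)] nbD(1)[OF x(2)] nbD(1)[OF y(1)] nbD(1)[OF y'(1)] in auto)
  qed
  obtain \<sigma> :: real where "\<sigma> \<noteq> 0" "\<And>z. z \<in> nb b \<Longrightarrow> \<sigma> * W z \<ge> 0"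
  proof (cases "\<exists>z\<in>nb b. W z < 0")
    case True
    then have "-1 * W z \<ge> 0" if "z \<in> nb b" for z
      using not_both that by fastforce
    then show ?thesis
      using that[of "-1"] by simp
  next
    case False
    then show ?thesis
      using that[of 1] by force
  qed
  then have "det3 (p a) (p a + v) (p y) = 0"
    using balanced_one_sided_det3[OF bal ab(2), of "p a" "p a + v" \<sigma> y] \<open>W b = 0\<close> y
    unfolding Wd by blast
  then show ?thesis
    by (simp add: det3_cross2)
qed

text \<open>If the star of \<open>a\<close> spanned the plane, any other vertex \<open>b'\<close>
  drawn at the same place would lie, in \<open>S\<close>, inside a triangle formed by
  \<open>a\<close> and two neighbours of \<open>a\<close>. Then \<open>cone_neighbours\<close>
  confines the images of the neighbours of \<open>b'\<close> to a convex cone with apex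
  \<open>p a\<close>, and balance puts them at the apex. So the vertices coinciding with
  \<open>a\<close> would have no exit but \<open>a\<close>.\<close>

lemma coincident_collinear_star:
  assumes ab: "a \<in> S" "b \<in> S" "a \<noteq> b" "p a = p b" and xy: "x \<in> nb a" "y \<in> nb a"
  shows "det3 (p a) (p x) (p y) = 0"
proof (rule ccontr)
  assume span: "det3 (p a) (p x) (p y) \<noteq> 0"
  have a_in: "a \<in> inner"
    using coincident_inner ab by blast
  define X where "X z = p z - p a" for z
  have wpos: "\<And>z. z \<in> nb a \<Longrightarrow> w a z > 0" and sum0: "(\<Sum>z\<in>nb a. w a z *\<^sub>R X z) = 0"
    using bal a_in by (auto simp: balanced_def X_def)
  have parallel: False if c: "c \<in> nb a" "X c \<noteq> 0"
    and side: "\<And>z. z \<in> nb a \<Longrightarrow> \<sigma> * cross2 (X c) (X z) \<ge> 0" "\<sigma> \<noteq> 0" for c \<sigma>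
  proof -
    have "det3 (p a) (p c) (p z) = cross2 (X c) (X z)" for z
      by (simp add: det3_cross2 X_def)
    then have "cross2 (X c) (X z) = 0" if "z \<in> nb a" for z
      using balanced_one_sided_det3[OF bal a_in, of "p a" "p c" \<sigma> z] side that by simp
    then have "cross2 (X x) (X y) = 0"
      using cross2_parallel c xy by blast
    then show False
      using span by (simp add: det3_cross2 X_def)
  qed
  have key: "p z = p a" if b': "b' \<in> S" "b' \<noteq> a" "p b' = p a" and z: "z \<in> nb b'" for b' z
  proof -
    \<comment> \<open>The neighbours of \<open>a\<close> drawn elsewhere, split according to their
      position in \<open>S\<close>: \<open>R\<close> to the right and \<open>L\<close> to the left
      of the ray from \<open>a\<close> to \<open>b'\<close>.\<close>
    define R where "R = {x \<in> nb a. X x \<noteq> 0 \<and> det3 a x b' > 0}"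
    define L where "L = {x \<in> nb a. X x \<noteq> 0 \<and> det3 a b' x > 0}"
    have b'_in: "b' \<in> inner"
      using coincident_inner[OF b'(1) ab(1)] b' by simp
    have RL: "z \<in> R \<union> L" if "z \<in> nb a" "X z \<noteq> 0" for z
    proof -
      have "z \<noteq> b'"
        using that b' by (auto simp: X_def)
      then have "det3 a z b' \<noteq> 0"
        using gp[of a z b'] nbD(2,3)[OF that(1)] ab b' by auto
      then show ?thesis
        using that det3_swap'[of a z b'] by (auto simp: R_def L_def)
    qed
    have fin: "finite R" "finite L"
      using finite_nb by (auto simp: R_def L_def)
    have order: "cross2 (X u) (X v) * \<sigma> \<ge> 0" if "u \<in> nb a" "v \<in> nb a" "\<sigma> * det3 a u v \<ge> 0" "\<sigma> \<noteq> 0" for u v \<sigma>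
    proof (cases "u = v")
      case False
      have "det3 a u v * cross2 (X u) (X v) \<ge> 0"
        using weak_typeD[OF weak, of a u v] nbD[OF that(1)] nbD[OF that(2)] ab False
        by (auto simp: det3_cross2 X_def)
      moreover have "det3 a u v \<noteq> 0"
        using gp[of a u v] nbD[OF that(1)] nbD[OF that(2)] ab False by auto
      ultimately show ?thesis
        using that(3,4) by (auto simp: zero_le_mult_iff)
    qed (simp add: cross2_def)
    have "R \<noteq> {}"
    proof
      assume "R = {}"
      then have L: "z \<in> L" if "z \<in> nb a" "X z \<noteq> 0" for z
        using RL that by blast
      have "x \<in> L"
      proof -
        have "p x \<noteq> p a"
          using span by auto
        then show ?thesis
          using L[OF xy(1)] by (simp add: X_def)
      qed
      then obtain c where c: "c \<in> L" "\<And>z. z \<in> L \<Longrightarrow> -1 * det3 a z c \<ge> 0"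
        using halfplane_extreme[of L "-1" a b'] fin det3_swap'[of a b']
        by (metis (no_types, lifting) L_def empty_iff mem_Collect_eq mult_minus1)
      show False
      proof (rule parallel[of c 1])
        show "c \<in> nb a" "X c \<noteq> 0"
          using c by (auto simp: L_def)
        show "1 * cross2 (X c) (X z) \<ge> 0" if "z \<in> nb a" for z
        proof (cases "X z = 0")
          case False
          then have "1 * det3 a c z \<ge> 0"
            using c(2)[OF L[OF that]] det3_swap'[of a z c] by simp
          then show ?thesis
            using order[of c z 1] c that by (simp add: L_def)
        qed (simp add: cross2_def)
      qed simp
    qed
    \<comment> \<open>\<open>c\<close> is the member of \<open>R\<close> closest in angle to the ray
      towards \<open>b'\<close>. If no \<open>d\<close> in \<open>L\<close> turned strictly left
      from it in the drawing, all neighbours would lie on one side of the line through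
      \<open>c\<close>, and balance would flatten the star.\<close>
    then obtain c where c: "c \<in> R" "\<And>z. z \<in> R \<Longrightarrow> 1 * det3 a z c \<ge> 0"
      using halfplane_extreme[of R 1 a b'] fin
      by (metis (no_types, lifting) R_def mem_Collect_eq mult_1)
    have c': "c \<in> nb a" "X c \<noteq> 0"
      using c by (auto simp: R_def)
    have "\<exists>d\<in>L. cross2 (X c) (X d) > 0"
    proof (rule ccontr)
      assume none: "\<not> ?thesis"
      show False
      proof (rule parallel[OF c', of "-1"])
        show "-1 * cross2 (X c) (X z) \<ge> 0" if "z \<in> nb a" for z
        proof (cases "z \<in> R")
          case True
          then have "cross2 (X z) (X c) \<ge> 0"
            using order[of z c 1] c that by (simp add: R_def)
          then show ?thesis
            by (simp add: cross2_def algebra_simps)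
        next
          case False
          then show ?thesis
            using none RL[OF that] by (cases "X z = 0") (auto simp: cross2_def not_less)
        qed
      qed simp
    qed
    then obtain d where d: "d \<in> nb a" "X d \<noteq> 0" "det3 a b' d > 0" "cross2 (X c) (X d) > 0"
      by (auto simp: L_def)
    have im: "det3 (p a) (p c) (p d) > 0"
      using d by (simp add: det3_cross2 X_def)
    have cS: "c \<in> S" "d \<in> S"
      using nbD c' d by blast+
    \<comment> \<open>The strict orientation of the images carries back to \<open>S\<close>; now
      \<open>b'\<close> is known to lie inside the triangle \<open>a c d\<close>.\<close>
    have pb: "det3 b' c d > 0"
      using image_pos_imp_pos[of b' c d 1] im cS b' by simp
    have side: "det3 (p a) (p c) (p z') \<ge> 0 \<and> det3 (p a) (p z') (p d) \<ge> 0" if z': "z' \<in> nb b'" for z'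
    proof -
      have zS: "z' \<in> S" "{b', z'} \<in> T"
        using nbD[OF z'] by auto
      have e: "{a, c} \<in> T" "{a, d} \<in> T"
        using c' d nbD by blast+
      have sg: "det3 a c b' > 0"
        using c by (simp add: R_def)
      show ?thesis
      proof (cases "z' = a \<or> z' = c \<or> z' = d")
        case True
        then show ?thesis
          using im by auto
      next
        case False
        have "det3 a c z' > 0 \<or> det3 b' c z' > 0"
          using cone_neighbours[OF e zS(2), of 1] False sg d pb by auto
        then have "det3 (p a) (p c) (p z') \<ge> 0"
          using weak_pos[of a c z'] weak_pos[of b' c z'] ab cS zS b' by auto
        moreover have "-1 * det3 a d z' > 0 \<or> -1 * det3 b' d z' > 0"
          using cone_neighbours[OF e(2,1) zS(2), of "-1"] False sg d pb
            det3_swap'[of a c b'] det3_swap'[of a b' d] det3_swap'[of b' c d] by auto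
        then have "det3 a z' d > 0 \<or> det3 b' z' d > 0"
          using det3_swap'[of a d z'] det3_swap'[of b' d z'] by auto
        then have "det3 (p a) (p z') (p d) \<ge> 0"
          using weak_pos[of a z' d] weak_pos[of b' z' d] ab cS zS b' by auto
        ultimately show ?thesis ..
      qed
    qed
    have "det3 (p a) (p c) (p z) = 0"
      by (rule balanced_one_sided_det3[OF bal b'_in, of _ _ 1]) (use side z b' in auto)
    moreover have "det3 (p a) (p d) (p z) = 0"
      by (rule balanced_one_sided_det3[OF bal b'_in, of _ _ "-1"])
        (use side z b' det3_swap'[of "p a" "p d"] in auto)
    ultimately have 0: "cross2 (X c) (X z) = 0" "cross2 (X d) (X z) = 0"
      by (simp_all add: det3_cross2 X_def)
    show "p z = p a"
    proof (rule ccontr)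
      assume "p z \<noteq> p a"
      then have "cross2 (X c) (X d) = 0"
        using cross2_parallel[of "X z" "X c" "X d"] 0 by (simp add: X_def cross2_def algebra_simps)
      then show False
        using d by simp
    qed
  qed
  define Y where "Y = {u \<in> S. u \<noteq> a \<and> p u = p a}"
  have "Y \<subseteq> inner"
    using coincident_inner[OF _ ab(1)] by (auto simp: Y_def)
  moreover have "b \<in> Y"
    using ab by (auto simp: Y_def)
  moreover have "nb u \<subseteq> Y \<union> {a, a}" if "u \<in> Y" for u
  proof
    fix z assume "z \<in> nb u"
    then show "z \<in> Y \<union> {a, a}"
      using key[of u z] nbD(2)[of z u] that by (auto simp: Y_def)
  qed
  ultimately show False
    using inner_set_boundary[of Y a a] by blast
qed

text \<open>The star of \<open>a\<close> is collinear and balanced, so it has a neighbour on the ray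
  opposite to \<open>x\<close>; \<open>coincident_straight_neighbours\<close> then applies to every
  other vertex \<open>c\<close> at the same place.\<close>

lemma coincident_line:
  assumes ab: "a \<in> S" "b \<in> S" "a \<noteq> b" "p a = p b"
    and x: "x \<in> nb a" "p x \<noteq> p a" and c: "c \<in> S" "p c = p a" and y: "y \<in> nb c"
  shows "det3 (p a) (p x) (p y) = 0"
proof (cases "c = a")
  case True
  then show ?thesis
    using coincident_collinear_star[OF ab x(1)] y by simp
next
  case False
  have a_in: "a \<in> inner"
    using coincident_inner ab by blast
  define v where "v = p x - p a"
  have "\<exists>x'\<in>nb a. v \<bullet> (p x' - p a) < 0"
  proof (rule ccontr)
    assume "\<not> ?thesis"
    then have "v \<bullet> (p x - p a) = 0"
      using balanced_one_sided[OF bal a_in, of v x] x by force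
    then show False
      using x by (simp add: v_def)
  qed
  then obtain x' where x': "x' \<in> nb a" "v \<bullet> (p x' - p a) < 0"
    by blast
  have "det3 (p a) (p x) (p x') = 0"
    by (rule coincident_collinear_star[OF ab x(1) x'(1)])
  then obtain l where l: "p x' = p a + l *\<^sub>R v"
    using det3_zero_on_line x(2) unfolding v_def by metis
  then have "l * (v \<bullet> v) < 0"
    using x'(2) by simp
  then have "l < 0"
    by (metis inner_ge_zero mult_nonneg_nonneg not_less)
  have "cross2 v (p y - p a) = 0"
    by (rule coincident_straight_neighbours[of a c x' x 1 v "- l" y])
      (use ab(1) coincident_inner[OF c(1) ab(1)] False c x x' l y \<open>l < 0\<close> in \<open>auto simp: v_def\<close>)
  then show ?thesis
    by (simp add: det3_cross2 v_def)
qed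

end

section \<open>Vertices trapped on a line\<close>

context weak_drawing
begin

text \<open>Call an inner vertex on the line saturated if all vertices at its place have only
  neighbours on the line. A connected component of saturated vertices can be left only through
  unsaturated vertices on the line. Nothing coincides with such an exit and no edge along the line
  passes over it, so there are at most two exits, against \<open>inner_set_boundary\<close>.\<close>

lemma no_saturated_line:
  assumes "A \<noteq> B"
  defines "onl u \<equiv> det3 A B (p u) = 0"
  defines "Sat \<equiv> {u \<in> inner. onl u \<and> (\<forall>b\<in>S. p b = p u \<longrightarrow> (\<forall>x\<in>nb b. onl x))}"
  assumes "u0 \<in> Sat"
  shows False
proof -
  define \<tau> where "\<tau> u = (p u - A) \<bullet> (B - A)" for u
  have BA: "(B - A) \<bullet> (B - A) > 0"
    using \<open>A \<noteq> B\<close> by simp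
  have param: "p u = A + (\<tau> u / ((B - A) \<bullet> (B - A))) *\<^sub>R (B - A)" if u: "onl u" for u
  proof -
    obtain l where l: "p u = A + l *\<^sub>R (B - A)"
      using det3_zero_on_line[of A B "p u"] u \<open>A \<noteq> B\<close> unfolding onl_def by blast
    then have "\<tau> u = l * ((B - A) \<bullet> (B - A))"
      by (simp add: \<tau>_def)
    then show ?thesis
      using l BA by simp
  qed
  have \<tau>_eq: "p u = p v" if "onl u" "onl v" "\<tau> u = \<tau> v" for u v
    using param[OF that(1)] param[OF that(2)] that(3) by simp
  have between: "\<exists>l. 0 < l \<and> l < 1 \<and> p e = p c + l *\<^sub>R (p d - p c)"
    if "onl c" "onl d" "onl e" "\<tau> c < \<tau> e" "\<tau> e < \<tau> d" for c d e
  proof -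
    define n where "n = (B - A) \<bullet> (B - A)"
    define l where "l = (\<tau> e - \<tau> c) / (\<tau> d - \<tau> c)"
    have "\<tau> c / n + l * (\<tau> d / n - \<tau> c / n) = (\<tau> c + l * (\<tau> d - \<tau> c)) / n"
      by (simp add: add_divide_distrib diff_divide_distrib right_diff_distrib)
    also have "\<dots> = \<tau> e / n"
      using that by (simp add: l_def)
    finally have *: "\<tau> c / n + l * (\<tau> d / n - \<tau> c / n) = \<tau> e / n" .
    have "p c + l *\<^sub>R (p d - p c) = A + (\<tau> c / n + l * (\<tau> d / n - \<tau> c / n)) *\<^sub>R (B - A)"
      unfolding param[OF that(1)] param[OF that(2)] n_def by (simp add: algebra_simps)
    then have "p c + l *\<^sub>R (p d - p c) = A + (\<tau> e / n) *\<^sub>R (B - A)"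
      by (simp only: *)
    then have "p e = p c + l *\<^sub>R (p d - p c)"
      using param[OF that(3)] unfolding n_def by (simp only:)
    moreover have "0 < l" "l < 1"
      using that by (auto simp: l_def)
    ultimately show ?thesis
      by blast
  qed
  have Sat_inner: "Sat \<subseteq> inner"
    by (auto simp: Sat_def)
  define Y where "Y = {u. (u0, u) \<in> {(u, v). u \<in> Sat \<and> v \<in> Sat \<and> {u, v} \<in> T}\<^sup>*}"
  have "u0 \<in> Y"
    by (simp add: Y_def)
  have Y_Sat: "u \<in> Sat" if "u \<in> Y" for u
  proof -
    have "(u0, u) \<in> {(u, v). u \<in> Sat \<and> v \<in> Sat \<and> {u, v} \<in> T}\<^sup>*"
      using that by (simp add: Y_def)
    then show ?thesis
      by (induction) (use \<open>u0 \<in> Sat\<close> in auto)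
  qed
  have Y_step: "v \<in> Y" if "u \<in> Y" "v \<in> Sat" "{u, v} \<in> T" for u v
    using that Y_Sat[OF that(1)] unfolding Y_def by (auto intro: rtrancl_into_rtrancl)
  have nb_onl: "onl x" if "u \<in> Y" "x \<in> nb u" for u x
  proof -
    have "u \<in> inner" "\<forall>b\<in>S. p b = p u \<longrightarrow> (\<forall>x\<in>nb b. onl x)"
      using Y_Sat[OF that(1)] by (simp_all add: Sat_def)
    then show ?thesis
      using inner_S[of u] that(2) by blast
  qed
  define Bd where "Bd = (\<Union>u\<in>Y. nb u) - Y"
  have BdE: "\<exists>u\<in>Y. e \<in> nb u \<and> onl e \<and> e \<in> S \<and> e \<notin> Sat" if "e \<in> Bd" for e
    using that nb_onl nbD Y_step unfolding Bd_def by blast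
  \<comment> \<open>The exit \<open>e\<close> has the neighbour \<open>u\<close> on the line at a
    different place. If another vertex coincided with \<open>e\<close>, then
    \<open>coincident_line\<close> would put all neighbours of the vertices at this place on the
    line, making \<open>e\<close> saturated.\<close>
  have uniq: "p b \<noteq> p e" if e: "e \<in> Bd" and b: "b \<in> S" "b \<noteq> e" for e b
  proof
    assume eq: "p b = p e"
    obtain u where u: "u \<in> Y" "e \<in> nb u" "onl e" "e \<in> S" "e \<notin> Sat"
      using BdE[OF e] by blast
    have e_in: "e \<in> inner"
      using coincident_inner[OF u(4) b(1)] b eq by simp
    have uS: "u \<in> inner" "onl u" "\<And>b x. b \<in> S \<Longrightarrow> p b = p u \<Longrightarrow> x \<in> nb b \<Longrightarrow> onl x"
      using Y_Sat[OF u(1)] by (auto simp: Sat_def)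
    have "\<exists>c\<in>S. p c = p e \<and> (\<exists>x\<in>nb c. \<not> onl x)"
      using u e_in by (auto simp: Sat_def)
    then obtain c x where c: "c \<in> S" "p c = p e" "x \<in> nb c" "\<not> onl x"
      by blast
    have ne: "p u \<noteq> p e"
      using uS(3)[of c x] c by auto
    have "det3 (p e) (p u) (p x) = 0"
      by (rule coincident_line[of e b u c x]) (use u b eq ne c nb_sym in auto)
    then have "onl x"
      using det3_line_transfer[of A B "p e" "p u" "p x"] u(3) uS(2) ne unfolding onl_def by auto
    then show False
      using c by simp
  qed
  \<comment> \<open>An exit inside an edge along the line would be saturated by
    \<open>on_edge_neighbours_collinear\<close>, since by \<open>uniq\<close> it is alone at its
    place.\<close>
  have noover: False if e: "e \<in> Bd" and cd: "{c, d} \<in> T" "onl c" "onl d" "\<tau> c < \<tau> e" "\<tau> e < \<tau> d" for e c d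
  proof -
    obtain u where u: "u \<in> Y" "e \<in> nb u" "onl e" "e \<in> S" "e \<notin> Sat"
      using BdE[OF e] by blast
    obtain l where l: "0 < l" "l < 1" "p e = p c + l *\<^sub>R (p d - p c)"
      using between[OF cd(2,3) u(3) cd(4,5)] by blast
    have ne: "e \<noteq> c" "e \<noteq> d" "p c \<noteq> p d"
      using cd(4,5) by (auto simp: \<tau>_def)
    have "e \<in> inner"
      by (rule between_inner[of c d e])
        (use edgeD[OF cd(1)] u(4) ne in_closed_segmentI[OF l(3)] l in auto)
    have "onl x" if "x \<in> nb e" for x
      using on_edge_neighbours_collinear[OF cd(1) \<open>e \<in> inner\<close> ne(1,2) l(3,1,2) that]
        det3_line_transfer[of A B "p c" "p d" "p x"] cd(2,3) ne(3) unfolding onl_def by blast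
    then have "e \<in> Sat"
      using \<open>e \<in> inner\<close> u(3) uniq[OF e] by (auto simp: Sat_def)
    then show False
      using u by simp
  qed
  \<comment> \<open>Edges within \<open>Y\<close> cannot pass over \<open>e\<close>, so all of
    \<open>Y\<close> lies on the same side of \<open>e\<close>.\<close>
  have side: "(\<tau> u < \<tau> e) = (\<tau> u0 < \<tau> e) \<and> \<tau> u \<noteq> \<tau> e" if e: "e \<in> Bd" and "u \<in> Y" for e u
  proof -
    have ne: "\<tau> v \<noteq> \<tau> e" if "v \<in> Y" for v
    proof
      assume "\<tau> v = \<tau> e"
      have v: "v \<in> inner" "onl v"
        using Y_Sat[OF that] by (simp_all add: Sat_def)
      have "onl e"
        using BdE[OF e] by blast
      then have "p v = p e"
        using \<tau>_eq[OF v(2)] \<open>\<tau> v = \<tau> e\<close> by blast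
      moreover have "v \<noteq> e"
        using e that by (auto simp: Bd_def)
      ultimately show False
        using uniq[OF e inner_S[OF v(1)]] by blast
    qed
    have "(u0, u) \<in> {(u, v). u \<in> Sat \<and> v \<in> Sat \<and> {u, v} \<in> T}\<^sup>*"
      using \<open>u \<in> Y\<close> by (simp add: Y_def)
    then have "u \<in> Y \<and> (\<tau> u < \<tau> e) = (\<tau> u0 < \<tau> e)"
    proof induction
      case base
      then show ?case
        using \<open>u0 \<in> Y\<close> by simp
    next
      case (step u v)
      then have uv: "u \<in> Sat" "v \<in> Sat" "{u, v} \<in> T" "{v, u} \<in> T"
        by (auto simp: insert_commute)
      have v: "v \<in> Y"
        using Y_step step uv by blast
      have on: "onl u" "onl v"
        using uv by (auto simp: Sat_def)
      have "\<not> (\<tau> u < \<tau> e \<and> \<tau> e < \<tau> v)" "\<not> (\<tau> v < \<tau> e \<and> \<tau> e < \<tau> u)"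
        using noover[OF e uv(3) on] noover[OF e uv(4) on(2,1)] by blast+
      then have "(\<tau> v < \<tau> e) = (\<tau> u < \<tau> e)"
        using ne[OF v] ne[of u] step by linarith
      then show ?case
        using step v by simp
    qed
    then show ?thesis
      using ne[OF \<open>u \<in> Y\<close>] by simp
  qed
  \<comment> \<open>The middle one of three exits would have members of \<open>Y\<close> on both
    sides, namely neighbours of the other two.\<close>
  have no3: False if e: "e1 \<in> Bd" "e2 \<in> Bd" "e3 \<in> Bd" and lt: "\<tau> e1 < \<tau> e2" "\<tau> e2 < \<tau> e3" for e1 e2 e3
  proof -
    obtain u1 where u1: "u1 \<in> Y" "e1 \<in> nb u1" "onl e1"
      using BdE[OF e(1)] by blast
    obtain u3 where u3: "u3 \<in> Y" "e3 \<in> nb u3" "onl e3"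
      using BdE[OF e(3)] by blast
    have on: "onl u1" "onl u3"
      using Y_Sat u1(1) u3(1) by (auto simp: Sat_def)
    have "\<not> \<tau> e2 < \<tau> u1"
      using noover[OF e(2), of e1 u1] nbD(1)[OF u1(2)] u1(3) on(1) lt(1) by (auto simp: insert_commute)
    moreover have "\<not> \<tau> u3 < \<tau> e2"
      using noover[OF e(2), of u3 e3] nbD(1)[OF u3(2)] u3(3) on(2) lt(2) by (auto simp: insert_commute)
    ultimately show False
      using side[OF e(2) u1(1)] side[OF e(2) u3(1)] by linarith
  qed
  have "finite Bd"
    by (rule finite_subset[OF _ finS]) (use BdE in blast)
  have "Bd \<subseteq> S"
    using BdE by blast
  obtain e e' where ee: "Bd \<subseteq> {e, e'}"
  proof (cases "Bd = {}")
    case True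
    then show ?thesis using that by blast
  next
    case False
    obtain e where e: "e \<in> Bd" "\<And>x. x \<in> Bd \<Longrightarrow> \<tau> e \<le> \<tau> x"
      using finite_imageI[OF \<open>finite Bd\<close>, of \<tau>] False Min_in[of "\<tau> ` Bd"] Min_le[of "\<tau> ` Bd"]
      by (metis (no_types, lifting) empty_is_image imageE imageI)
    obtain e' where e': "e' \<in> Bd" "\<And>x. x \<in> Bd \<Longrightarrow> \<tau> x \<le> \<tau> e'"
      using finite_imageI[OF \<open>finite Bd\<close>, of \<tau>] False Max_in[of "\<tau> ` Bd"] Max_ge[of "\<tau> ` Bd"]
      by (metis (no_types, lifting) empty_is_image imageE imageI)
    have "x \<in> {e, e'}" if "x \<in> Bd" for x
    proof (rule ccontr)
      assume "x \<notin> {e, e'}"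
      then have ne: "x \<noteq> e" "x \<noteq> e'"
        by auto
      have "\<tau> a \<noteq> \<tau> b" if "a \<in> Bd" "b \<in> Bd" "a \<noteq> b" for a b
        using uniq[OF that(1), of b] \<tau>_eq[of a b] BdE[OF that(1)] BdE[OF that(2)] that(3) by auto
      then have "\<tau> e < \<tau> x" "\<tau> x < \<tau> e'"
        using e e' that ne by (metis order_less_le)+
      then show False
        using no3 e e' that by blast
    qed
    then show ?thesis
      using that by blast
  qed
  have "nb u \<subseteq> Y \<union> {e, e'}" if "u \<in> Y" for u
    using ee that by (auto simp: Bd_def)
  moreover have "Y \<subseteq> inner"
    using Y_Sat Sat_inner by blast
  ultimately show False
    using inner_set_boundary[of Y e e'] \<open>u0 \<in> Y\<close> by blast
qed

text \<open>Both degeneracies create a saturated vertex: a cluster of coinciding vertices with a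
  neighbour elsewhere, by \<open>coincident_line\<close>, and, once images are distinct, a vertex
  inside an edge, by \<open>on_edge_neighbours_collinear\<close>.\<close>

theorem weak_drawing_plane: "plane_config S T p"
proof (rule weak_type_plane_config[OF weak])
  show inj: "p a \<noteq> p b" if ab: "a \<in> S" "b \<in> S" "a \<noteq> b" for a b
  proof
    assume eq: "p a = p b"
    define Q where "Q = {u \<in> S. p u = p a}"
    have "Q \<subseteq> inner"
    proof
      fix u assume "u \<in> Q"
      then have u: "u \<in> S" "p u = p a"
        by (simp_all add: Q_def)
      show "u \<in> inner"
      proof (cases "u = a")
        case True
        then show ?thesis
          using coincident_inner[OF ab eq] by simp
      next
        case False
        then show ?thesis
          using coincident_inner[OF u(1) ab(1) _ u(2)] by blast
      qed
    qed
    have "\<exists>u\<in>Q. \<exists>x\<in>nb u. p x \<noteq> p a"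
    proof (rule ccontr)
      assume neg: "\<not> ?thesis"
      have "nb u \<subseteq> Q \<union> {a, a}" if u: "u \<in> Q" for u
      proof
        fix x assume x: "x \<in> nb u"
        then have "p x = p a"
          using neg u by blast
        then show "x \<in> Q \<union> {a, a}"
          using nbD(2)[OF x] by (simp add: Q_def)
      qed
      moreover have "a \<in> Q"
        using ab by (simp add: Q_def)
      ultimately show False
        using inner_set_boundary[OF \<open>Q \<subseteq> inner\<close>] by blast
    qed
    then obtain u x where u: "u \<in> Q" "x \<in> nb u" "p x \<noteq> p a"
      by blast
    have uS: "u \<in> S" "p u = p a" "u \<in> inner"
      using u(1) \<open>Q \<subseteq> inner\<close> by (auto simp: Q_def)
    obtain u' where u': "u' \<in> S" "u' \<noteq> u" "p u = p u'"
      using ab eq uS by (cases "u = a") metis+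
    have ne: "p x \<noteq> p u" "p u \<noteq> p x"
      using u(3) uS(2) by auto
    have "det3 (p u) (p x) (p y) = 0" if "c \<in> S" "p c = p u" "y \<in> nb c" for c y
      by (rule coincident_line[OF uS(1) u'(1) u'(2)[symmetric] u'(3) u(2) ne(1) that])
    then show False
      using no_saturated_line[OF ne(2), of u] uS(3) by simp
  qed
  show "p s \<notin> closed_segment (p a) (p b)" if e: "{a, b} \<in> T" and s: "s \<in> S" "s \<noteq> a" "s \<noteq> b" for a b s
  proof
    assume seg: "p s \<in> closed_segment (p a) (p b)"
    have ab: "a \<in> S" "b \<in> S" "a \<noteq> b"
      using edgeD[OF e] by auto
    obtain l where l: "p s = p a + l *\<^sub>R (p b - p a)" "0 \<le> l" "l \<le> 1"
      using seg by (rule in_closed_segmentE)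
    have "l \<noteq> 0" "l \<noteq> 1"
      using inj[OF s(1) ab(1)] inj[OF s(1) ab(2)] s l(1) by auto
    then have l': "0 < l" "l < 1"
      using l by auto
    have s_in: "s \<in> inner"
      by (rule between_inner[OF ab(1,2) s seg])
    have "c = s" if "c \<in> S" "p c = p s" for c
      using inj[OF that(1) s(1)] that(2) by blast
    then show False
      using no_saturated_line[of "p a" "p b" s] inj[OF ab] s_in det3_closed_segment[OF seg]
        on_edge_neighbours_collinear[OF e s_in s(2,3) l(1) l'] by blast
  qed
qed

end

section \<open>Rigidity for all positive weights\<close>

text \<open>The hypothesis forces 0 into the interior of the convex hull. So a small negative
  multiple of the sum of all \<open>f x\<close> is still a convex combination, and adding
  \<open>\<epsilon>\<close> to its coefficients makes them strictly positive and the total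
  zero.\<close>

lemma positive_combination:
  fixes f :: "'i \<Rightarrow> 'a::euclidean_space"
  assumes "finite A" "inj_on f A" and dir: "\<And>g. g \<noteq> 0 \<Longrightarrow> \<exists>x\<in>A. g \<bullet> f x > 0"
  obtains c where "\<And>x. x \<in> A \<Longrightarrow> c x > (0::real)" "(\<Sum>x\<in>A. c x *\<^sub>R f x) = 0"
proof -
  define C where "C = convex hull (f ` A)"
  have conv: "convex C"
    by (simp add: C_def)
  have fC: "f x \<in> C" if "x \<in> A" for x
    using that by (simp add: C_def hull_inc)
  have "0 \<in> interior C"
  proof (rule ccontr)
    assume "0 \<notin> interior C"
    show False
    proof (cases "interior C = {}")
      case True
      then obtain a b where ab: "a \<noteq> 0" "C \<subseteq> {x. a \<bullet> x = b}"
        using empty_interior_subset_hyperplane[OF conv] by blast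
      obtain x y where "x \<in> A" "a \<bullet> f x > 0" "y \<in> A" "- a \<bullet> f y > 0"
        using dir[of a] dir[of "- a"] ab(1) by auto
      moreover have "a \<bullet> f x = b" "a \<bullet> f y = b"
        using subsetD[OF ab(2) fC] \<open>x \<in> A\<close> \<open>y \<in> A\<close> by auto
      ultimately show False
        by simp
    next
      case False
      obtain a b where ab: "a \<noteq> 0" "a \<bullet> 0 \<le> b" "\<forall>x\<in>interior C. a \<bullet> x \<ge> b"
        using separating_hyperplane_sets[of "{0}" "interior C"] conv False \<open>0 \<notin> interior C\<close>
        by auto
      have "interior C \<subseteq> {x. a \<bullet> x \<ge> 0}"
        using ab(2,3) by auto
      then have "closure (interior C) \<subseteq> {x. a \<bullet> x \<ge> 0}"
        by (rule closure_minimal) (simp add: closed_halfspace_ge)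
      then have "C \<subseteq> {x. a \<bullet> x \<ge> 0}"
        using convex_closure_interior[OF conv False] closure_subset[of C] by blast
      moreover obtain x where "x \<in> A" "- a \<bullet> f x > 0"
        using dir[of "- a"] ab(1) by auto
      moreover have "a \<bullet> f x \<ge> 0"
        using subsetD[OF calculation(1) fC[OF calculation(2)]] by simp
      ultimately show False
        by simp
    qed
  qed
  then obtain e where "e > 0" and e: "ball 0 e \<subseteq> C"
    by (auto simp: mem_interior)
  define b where "b = (\<Sum>x\<in>A. f x)"
  define \<epsilon> where "\<epsilon> = e / (2 * (norm b + 1))"
  have n1: "norm b + 1 > 0"
    by (simp add: add_nonneg_pos)
  have "\<epsilon> > 0"
    using \<open>e > 0\<close> n1 by (simp add: \<epsilon>_def)
  have "norm (- (\<epsilon> *\<^sub>R b)) = e * (norm b / (2 * (norm b + 1)))"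
    using \<open>\<epsilon> > 0\<close> \<open>e > 0\<close> by (simp add: \<epsilon>_def)
  also have "\<dots> < e * 1"
    using \<open>e > 0\<close> n1 by (intro mult_strict_left_mono) (auto simp: divide_less_eq)
  finally have "- (\<epsilon> *\<^sub>R b) \<in> C"
    using e by auto
  then obtain u where u: "\<And>y. y \<in> f ` A \<Longrightarrow> 0 \<le> u y" "(\<Sum>y\<in>f ` A. u y *\<^sub>R y) = - (\<epsilon> *\<^sub>R b)"
    unfolding C_def convex_hull_finite[OF finite_imageI[OF \<open>finite A\<close>]] by blast
  have "(\<Sum>x\<in>A. u (f x) *\<^sub>R f x) = - (\<epsilon> *\<^sub>R b)"
    using u(2) sum.reindex[OF \<open>inj_on f A\<close>, of "\<lambda>y. u y *\<^sub>R y"] by simp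
  then have "(\<Sum>x\<in>A. (\<epsilon> + u (f x)) *\<^sub>R f x) = 0"
    by (simp add: scaleR_add_left sum.distrib b_def scaleR_sum_right[symmetric])
  then show ?thesis
    using u(1) \<open>\<epsilon> > 0\<close> by (intro that[of "\<lambda>x. \<epsilon> + u (f x)"]) (auto simp: add_pos_nonneg)
qed

context surrounded_plane_graph
begin

definition positive :: "(point \<Rightarrow> point \<Rightarrow> real) \<Rightarrow> bool" where
  "positive w \<longleftrightarrow> (\<forall>u\<in>inner. \<forall>x\<in>nb u. w u x > 0)"

lemma nb_nonempty: "u \<in> inner \<Longrightarrow> nb u \<noteq> {}"
  using surrounded[of u "(1, 0)"] by (auto simp: zero_prod_def)

text \<open>The given points are themselves balanced for suitable weights; the deformation starts
  from these.\<close>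

lemma initial_weights: obtains w where "balanced w id"
proof -
  have "\<forall>u\<in>inner. \<exists>c. (\<forall>x\<in>nb u. c x > 0) \<and> (\<Sum>x\<in>nb u. c x *\<^sub>R (x - u)) = 0"
  proof
    fix u assume u: "u \<in> inner"
    have "\<exists>x\<in>nb u. g \<bullet> (x - u) > 0" if "g \<noteq> 0" for g
      using surrounded[OF u that] by (auto simp: inner_diff_right)
    then obtain c where "\<And>x. x \<in> nb u \<Longrightarrow> c x > 0" "(\<Sum>x\<in>nb u. c x *\<^sub>R (x - u)) = 0"
      using positive_combination[OF finite_nb[of u], of "\<lambda>x. x - u"] by (auto simp: inj_on_def)
    then show "\<exists>c. (\<forall>x\<in>nb u. c x > 0) \<and> (\<Sum>x\<in>nb u. c x *\<^sub>R (x - u)) = 0"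
      by blast
  qed
  from bchoice[OF this] show ?thesis
    using that by (auto simp: balanced_def)
qed

text \<open>The equilibrium potential of \<open>z\<close>: how far the other inner vertices follow
  when \<open>z\<close> moves and the outer ones are held. It is the limit of an increasing
  iteration of the averaging operator \<open>P\<close>. If it were 1 at all neighbours of
  \<open>z\<close>, the vertices where it is 1 would form an inner set without exit.\<close>

lemma harmonic_extension:
  assumes "positive w" "z \<in> inner"
  obtains G where "G z = 1" "\<And>h. h \<in> outer \<Longrightarrow> G h = 0" "\<And>u. 0 \<le> G u \<and> G u \<le> (1::real)"
    "\<And>u. u \<in> inner \<Longrightarrow> u \<noteq> z \<Longrightarrow> (\<Sum>x\<in>nb u. w u x * (G x - G u)) = 0"
    "\<exists>x\<in>nb z. G x < 1"
proof -
  define W where "W u = (\<Sum>x\<in>nb u. w u x)" for u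
  have wpos: "w u x > 0" if "u \<in> inner" "x \<in> nb u" for u x
    using assms(1) that by (auto simp: positive_def)
  have Wpos: "W u > 0" if "u \<in> inner" for u
    unfolding W_def using finite_nb nb_nonempty[OF that] wpos[OF that] by (intro sum_pos) auto
  define P where "P g u = (if u = z then 1 else if u \<in> inner then (\<Sum>x\<in>nb u. w u x * g x) / W u else 0)"
    for g u
  have mono: "P g u \<le> P h u" if "\<And>x. g x \<le> h x" for g h u
  proof (cases "u \<noteq> z \<and> u \<in> inner")
    case True
    have "(\<Sum>x\<in>nb u. w u x * g x) \<le> (\<Sum>x\<in>nb u. w u x * h x)"
      using that wpos True by (intro sum_mono mult_left_mono) (auto simp: less_imp_le)
    then show ?thesis
      using True Wpos[of u] by (simp add: P_def divide_right_mono)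
  qed (auto simp: P_def)
  define g where "g k = (P ^^ k) (\<lambda>u. if u = z then 1 else 0)" for k
  have gS: "g (Suc k) = P (g k)" for k
    by (simp add: g_def)
  have g01: "0 \<le> g k u \<and> g k u \<le> 1" for k u
  proof (induction k arbitrary: u)
    case 0
    then show ?case by (simp add: g_def)
  next
    case (Suc k)
    have "0 \<le> (\<Sum>x\<in>nb u. w u x * g k x) / W u \<and> (\<Sum>x\<in>nb u. w u x * g k x) / W u \<le> 1" if "u \<in> inner"
    proof -
      have "(\<Sum>x\<in>nb u. w u x * g k x) \<le> W u"
        unfolding W_def using Suc wpos[OF that] by (intro sum_mono) (simp add: mult_left_le)
      moreover have "0 \<le> (\<Sum>x\<in>nb u. w u x * g k x)"
        using Suc wpos[OF that] by (intro sum_nonneg) (simp add: less_imp_le)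
      ultimately show ?thesis
        using Wpos[OF that] by simp
    qed
    then show ?case
      by (simp add: gS P_def)
  qed
  have inc: "g k u \<le> g (Suc k) u" for k u
  proof (induction k arbitrary: u)
    case 0
    show ?case
    proof (cases "u = z")
      case True
      then show ?thesis
        by (simp add: gS P_def g01)
    next
      case False
      then have "g 0 u = 0"
        by (simp add: g_def)
      then show ?thesis
        using g01[of "Suc 0" u] by simp
    qed
  next
    case (Suc k)
    show ?case
      unfolding gS[of k] gS[of "Suc k"] by (rule mono) (use Suc in \<open>simp only: gS[symmetric]\<close>)
  qed
  define G where "G u = lim (\<lambda>k. g k u)" for u
  have lim: "(\<lambda>k. g k u) \<longlonglongrightarrow> G u" for u
  proof -
    have "incseq (\<lambda>k. g k u)"
      using inc by (rule incseq_SucI)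
    then have "convergent (\<lambda>k. g k u)"
      using incseq_convergent[of "\<lambda>k. g k u" 1] g01 by (metis convergent_def)
    then show ?thesis
      by (simp add: G_def convergent_LIMSEQ_iff)
  qed
  have "(\<lambda>k. P (g k) u) \<longlonglongrightarrow> P G u" for u
  proof (cases "u \<noteq> z \<and> u \<in> inner")
    case True
    then have "W u \<noteq> 0"
      using Wpos[of u] by simp
    then have "(\<lambda>k. (\<Sum>x\<in>nb u. w u x * g k x) / W u) \<longlonglongrightarrow> (\<Sum>x\<in>nb u. w u x * G x) / W u"
      by (intro tendsto_intros lim)
    then show ?thesis
      using True by (simp add: P_def)
  qed (auto simp: P_def)
  moreover have "(\<lambda>k. P (g k) u) \<longlonglongrightarrow> G u" for u
    using LIMSEQ_Suc[OF lim[of u]] by (simp add: gS)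
  ultimately have G_fix: "G u = P G u" for u
    using LIMSEQ_unique by blast
  have G01: "0 \<le> G u \<and> G u \<le> 1" for u
    using LIMSEQ_le_const[OF lim] LIMSEQ_le_const2[OF lim] g01 by blast
  have harm: "(\<Sum>x\<in>nb u. w u x * (G x - G u)) = 0" if "u \<in> inner" "u \<noteq> z" for u
  proof -
    have "W u * G u = (\<Sum>x\<in>nb u. w u x * G x)"
      using G_fix[of u] that Wpos[OF that(1)] by (simp add: P_def)
    then show ?thesis
      by (simp add: right_diff_distrib sum_subtractf W_def sum_distrib_right)
  qed
  have G0: "G h = 0" if "h \<in> outer" for h
    using G_fix[of h] that assms(2) by (auto simp: P_def inner_def)
  have Gz: "G z = 1"
    using G_fix[of z] by (simp add: P_def)
  have "\<exists>x\<in>nb z. G x < 1"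
  proof (rule ccontr)
    assume "\<not> ?thesis"
    then have z1: "G x = 1" if "x \<in> nb z" for x
      using G01[of x] that by force
    define M where "M = {u \<in> inner. G u = 1}"
    have in_M: "x \<in> M" if "G x = 1" "x \<in> S" for x
      using that G0[of x] by (auto simp: M_def inner_def)
    have "nb u \<subseteq> M \<union> {z, z}" if u: "u \<in> M" for u
    proof
      fix x assume x: "x \<in> nb u"
      have "G x = 1"
      proof (cases "u = z")
        case False
        have ui: "u \<in> inner" "G u = 1"
          using u by (auto simp: M_def)
        have "(\<Sum>x\<in>nb u. w u x * (1 - G x)) = - (\<Sum>x\<in>nb u. w u x * (G x - G u))"
          by (simp add: ui sum_negf[symmetric] right_diff_distrib)
        also have "\<dots> = 0"
          using harm[OF ui(1) False] by simp
        finally have "w u x * (1 - G x) = 0"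
          using finite_nb x wpos[OF ui(1)] G01 by (subst (asm) sum_nonneg_eq_0_iff) (auto simp: less_imp_le)
        then show ?thesis
          using wpos[OF ui(1) x] by simp
      qed (use z1 x in simp)
      then show "x \<in> M \<union> {z, z}"
        using in_M nbD(2)[OF x] by blast
    qed
    moreover have "z \<in> M"
      using Gz assms(2) by (simp add: M_def)
    moreover have "M \<subseteq> inner"
      by (auto simp: M_def)
    ultimately show False
      using inner_set_boundary[of M z z] by blast
  qed
  then show ?thesis
    using that Gz G0 G01 harm by blast
qed

end

locale rigid_graph = supporting_plane_graph + surrounded_plane_graph
begin

text \<open>The path is remembered besides the order type, because later deformations are appended
  to it and the supporting property applies only to motions starting at \<open>S\<close>
  itself.\<close>

definition reachable :: "(point \<Rightarrow> point) \<Rightarrow> bool" where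
  "reachable p \<longleftrightarrow> (\<exists>\<gamma>. (\<forall>s\<in>S. path (\<lambda>t. \<gamma> t s)) \<and> (\<forall>s\<in>S. \<gamma> 0 s = s) \<and> \<gamma> 1 = p \<and>
     (\<forall>t\<in>{0..1}. same_type S (\<gamma> t)))"

lemma reachable_same_type: "reachable p \<Longrightarrow> same_type S p"
  unfolding reachable_def by fastforce

lemma reachable_id: "reachable id"
  unfolding reachable_def
proof (intro exI[of _ "\<lambda>t. id"] conjI ballI)
  show "same_type S id"
    unfolding same_type_def id_apply
  proof (intro ballI impI)
    fix a b c assume "a \<in> S" "b \<in> S" "c \<in> S" "a \<noteq> b" "a \<noteq> c" "b \<noteq> c"
    from gp[OF this] show "det3 a b c * det3 a b c > 0"
      by (metis not_real_square_gt_zero)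
  qed
qed (auto simp: path_def)

text \<open>At the first time \<open>t1\<close> where the order type fails, the drawing is still
  \<open>weak_type\<close> by continuity, hence plane by \<open>pc\<close>. The old path followed by
  the new one up to \<open>t1\<close> then contradicts
  \<open>supporting_path_nondegenerate\<close>.\<close>

lemma reachable_extend:
  assumes "reachable p" and cont: "\<And>s. s \<in> S \<Longrightarrow> path (\<lambda>t. \<delta> t s)" and "\<delta> 0 = p"
    and pc: "\<And>t. t \<in> {0..1} \<Longrightarrow> weak_type S (\<delta> t) \<Longrightarrow> plane_config S T (\<delta> t)"
  shows "reachable (\<delta> 1)"
proof -
  obtain \<gamma> where \<gamma>: "\<And>s. s \<in> S \<Longrightarrow> path (\<lambda>t. \<gamma> t s)" "\<And>s. s \<in> S \<Longrightarrow> \<gamma> 0 s = s" "\<gamma> 1 = p"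
     "\<And>t. t \<in> {0..1} \<Longrightarrow> same_type S (\<gamma> t)"
    using assms(1) unfolding reachable_def by blast
  define join where "join \<eta> t = (if t \<le> 1/2 then \<gamma> (2 * t) else \<eta> (2 * t - 1))"
    for \<eta> :: "real \<Rightarrow> point \<Rightarrow> point" and t :: real
  have join_path: "path (\<lambda>t. join \<eta> t s)" if "s \<in> S" "path (\<lambda>t. \<eta> t s)" "\<eta> 0 = p" for \<eta> s
  proof -
    have "(\<lambda>t. join \<eta> t s) = (\<lambda>t. \<gamma> t s) +++ (\<lambda>t. \<eta> t s)"
      by (auto simp: join_def joinpaths_def)
    then show ?thesis
      using path_join_imp[OF \<gamma>(1)[OF that(1)] that(2)] \<gamma>(3) that(3)
      by (simp add: pathstart_def pathfinish_def)
  qed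
  define Tr where "Tr = {(a, b, c). a \<in> S \<and> b \<in> S \<and> c \<in> S \<and> a \<noteq> b \<and> a \<noteq> c \<and> b \<noteq> c}"
  have "finite Tr"
    by (rule finite_subset[of _ "S \<times> S \<times> S"]) (use finS in \<open>auto simp: Tr_def\<close>)
  define f where "f z t = (case z of (a, b, c) \<Rightarrow> det3 a b c * det3 (\<delta> t a) (\<delta> t b) (\<delta> t c))"
    for z and t :: real
  have fcont: "continuous_on {0..1} (f z)" if "z \<in> Tr" for z
  proof -
    obtain a b c where z: "z = (a, b, c)"
      by (cases z) auto
    show ?thesis
      unfolding f_def z prod.case
      by (intro continuous_intros) (use cont that z in \<open>auto simp: Tr_def path_def\<close>)
  qed
  have TrE: "\<exists>a b c. z = (a, b, c) \<and> a \<in> S \<and> b \<in> S \<and> c \<in> S \<and> a \<noteq> b \<and> a \<noteq> c \<and> b \<noteq> c" if "z \<in> Tr" for z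
    using that unfolding Tr_def by blast
  have TrI: "(a, b, c) \<in> Tr" if "a \<in> S" "b \<in> S" "c \<in> S" "a \<noteq> b" "a \<noteq> c" "b \<noteq> c" for a b c
    using that by (simp add: Tr_def)
  have f_eq: "f (a, b, c) t = det3 a b c * det3 (\<delta> t a) (\<delta> t b) (\<delta> t c)" for a b c t
    by (simp add: f_def)
  have same_iff: "same_type S (\<delta> t) \<longleftrightarrow> (\<forall>z\<in>Tr. f z t > 0)" for t
    unfolding same_type_def using TrE TrI f_eq by metis
  have weak_iff: "weak_type S (\<delta> t) \<longleftrightarrow> (\<forall>z\<in>Tr. f z t \<ge> 0)" for t
    unfolding weak_type_def using TrE TrI f_eq by metis
  \<comment> \<open>The times of failure. Finitely many non-strict inequalities make this set
    closed, so its infimum is a first failure.\<close>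
  define B where "B = (\<Union>z\<in>Tr. {t \<in> {0..1}. f z t \<le> 0})"
  have B_iff: "t \<in> B \<longleftrightarrow> \<not> same_type S (\<delta> t)" if "t \<in> {0..1}" for t
    using that by (auto simp: B_def same_iff not_less)
  have "B = {}"
  proof (rule ccontr)
    assume "B \<noteq> {}"
    have "closed B"
      unfolding B_def using \<open>finite Tr\<close> fcont
      by (intro closed_UN ballI continuous_on_closed_Collect_le continuous_on_const) auto
    moreover have "bdd_below B"
      by (rule bdd_belowI[of _ 0]) (auto simp: B_def)
    ultimately have inf: "Inf B \<in> B"
      using \<open>B \<noteq> {}\<close> by (simp add: closed_contains_Inf)
    define t1 where "t1 = Inf B"
    have t1: "t1 \<in> B" "t1 \<in> {0..1}" "\<not> same_type S (\<delta> t1)"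
      using inf B_iff by (auto simp: t1_def B_def)
    have below: "same_type S (\<delta> t)" if "0 \<le> t" "t < t1" for t
      using B_iff[of t] cInf_lower[OF _ \<open>bdd_below B\<close>, of t] that t1(2) unfolding t1_def by auto
    have "t1 \<noteq> 0"
      using t1(3) assms(3) reachable_same_type[OF assms(1)] by auto
    then have "t1 > 0"
      using t1(2) by auto
    have weak1: "weak_type S (\<delta> t1)"
      unfolding weak_iff
    proof
      fix z assume z: "z \<in> Tr"
      have "continuous_on {0..t1} (f z)"
        using fcont[OF z] by (rule continuous_on_subset) (use t1 in auto)
      then have "closed {t \<in> {0..t1}. 0 \<le> f z t}"
        by (intro continuous_on_closed_Collect_le) auto
      moreover have "{0..<t1} \<subseteq> {t \<in> {0..t1}. 0 \<le> f z t}"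
        using below z unfolding same_iff by (auto simp: less_imp_le)
      ultimately have "closure {0..<t1} \<subseteq> {t \<in> {0..t1}. 0 \<le> f z t}"
        by (rule closure_minimal[rotated])
      moreover have "t1 \<in> closure {0..<t1}"
        using \<open>t1 > 0\<close> by simp
      ultimately have "t1 \<in> {t \<in> {0..t1}. 0 \<le> f z t}"
        by (rule subsetD)
      then show "0 \<le> f z t1"
        by simp
    qed
    define \<eta> where "\<eta> t = \<delta> (t1 * t)" for t
    have \<eta>path: "path (\<lambda>t. \<eta> t s)" if "s \<in> S" for s
      unfolding \<eta>_def path_def
      by (rule continuous_on_compose2[OF cont[OF that, unfolded path_def]])
        (use t1 in \<open>auto intro!: continuous_intros mult_le_one\<close>)
    have \<eta>0: "\<eta> 0 = p"
      by (simp add: \<eta>_def assms(3))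
    obtain a b c where abc: "(a, b, c) \<in> Tr" "f (a, b, c) t1 \<le> 0"
      using t1(1) by (auto simp: B_def)
    have "det3 (join \<eta> 1 a) (join \<eta> 1 b) (join \<eta> 1 c) \<noteq> 0"
    proof (rule supporting_path_nondegenerate[where \<gamma> = "join \<eta>"])
      show "continuous_on {0..1} (\<lambda>t. join \<eta> t s)" if "s \<in> S" for s
        using join_path[of s \<eta>] \<eta>path \<eta>0 that by (simp add: path_def)
      show "join \<eta> 0 s = s" if "s \<in> S" for s
        using \<gamma>(2) that by (simp add: join_def)
      show "same_type S (join \<eta> t)" if "0 \<le> t" "t < 1" for t
      proof (cases "t \<le> 1/2")
        case True
        then show ?thesis
          using \<gamma>(4) that by (simp add: join_def)
      next
        case False
        then have "t1 * (2 * t - 1) < t1" "0 \<le> t1 * (2 * t - 1)"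
          using that \<open>t1 > 0\<close> by auto
        then show ?thesis
          using below False by (simp add: join_def \<eta>_def)
      qed
      show "plane_config S T (join \<eta> 1)"
        using pc[OF t1(2) weak1] by (simp add: join_def \<eta>_def)
    qed (use abc in \<open>auto simp: Tr_def\<close>)
    then have "det3 (\<delta> t1 a) (\<delta> t1 b) (\<delta> t1 c) \<noteq> 0"
      by (simp add: join_def \<eta>_def)
    moreover have "f (a, b, c) t1 = 0"
      using abc weak1 unfolding weak_iff by force
    moreover have "det3 a b c \<noteq> 0"
      using gp abc(1) by (auto simp: Tr_def)
    ultimately show False
      by (simp add: f_def)
  qed
  then have same: "same_type S (\<delta> t)" if "t \<in> {0..1}" for t
    using B_iff that by blast
  show ?thesis
    unfolding reachable_def
  proof (intro exI[of _ "join \<delta>"] conjI ballI)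
    show "path (\<lambda>t. join \<delta> t s)" if "s \<in> S" for s
      using join_path that cont assms(3) by blast
    show "join \<delta> 0 s = s" if "s \<in> S" for s
      using \<gamma>(2) that by (simp add: join_def)
    show "join \<delta> 1 = \<delta> 1"
      by (simp add: join_def)
    show "same_type S (join \<delta> t)" if "t \<in> {0..1}" for t
      using \<gamma>(4) same that by (simp add: join_def)
  qed
qed

text \<open>Only the balance at \<open>z\<close> is disturbed. Displacing each \<open>u\<close> by
  \<open>G u\<close> times a common vector keeps the other rows balanced, and the vector needed is a
  multiple of the imbalance \<open>d\<close>. So the drawings for all intermediate rows are explicit
  and depend continuously on the row.\<close>

lemma change_row:
  assumes "reachable p" and outer_fix: "\<And>h. h \<in> outer \<Longrightarrow> p h = h" and bal: "balanced w p"
    and z: "z \<in> inner" and \<omega>: "\<And>x. x \<in> nb z \<Longrightarrow> \<omega> x > 0"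
  obtains p' where "reachable p'" "\<And>h. h \<in> outer \<Longrightarrow> p' h = h" "balanced (w(z := \<omega>)) p'"
proof -
  have wpos: "w u x > 0" if "u \<in> inner" "x \<in> nb u" for u x
    using bal that by (auto simp: balanced_def)
  obtain G where G: "G z = 1" "\<And>h. h \<in> outer \<Longrightarrow> G h = 0" "\<And>u. 0 \<le> G u \<and> G u \<le> (1::real)"
    "\<And>u. u \<in> inner \<Longrightarrow> u \<noteq> z \<Longrightarrow> (\<Sum>x\<in>nb u. w u x * (G x - G u)) = 0" "\<exists>x\<in>nb z. G x < 1"
    using harmonic_extension[of w z] wpos z by (auto simp: positive_def)
  define d where "d = (\<Sum>x\<in>nb z. \<omega> x *\<^sub>R (p x - p z))"
  define v where "v \<tau> x = (1 - \<tau>) * w z x + \<tau> * \<omega> x" for \<tau> x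
  define m where "m \<tau> = (\<Sum>x\<in>nb z. v \<tau> x * (1 - G x))" for \<tau>
  have vpos: "v \<tau> x > 0" if "\<tau> \<in> {0..1}" "x \<in> nb z" for \<tau> x
  proof (cases "\<tau> = 1")
    case False
    then have "(1 - \<tau>) * w z x > 0" "\<tau> * \<omega> x \<ge> 0"
      using that wpos[OF z that(2)] \<omega>[OF that(2)] by auto
    then show ?thesis
      by (simp add: v_def)
  qed (use \<omega> that in \<open>simp add: v_def\<close>)
  have mpos: "m \<tau> > 0" if "\<tau> \<in> {0..1}" for \<tau>
  proof -
    obtain x where x: "x \<in> nb z" "G x < 1"
      using G(5) by blast
    have "v \<tau> x * (1 - G x) \<le> m \<tau>"
      unfolding m_def using vpos[OF that] G(3) finite_nb x
      by (intro member_le_sum) (auto simp: less_imp_le)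
    moreover have "v \<tau> x * (1 - G x) > 0"
      using vpos[OF that x(1)] x(2) by simp
    ultimately show ?thesis
      by simp
  qed
  \<comment> \<open>With the row \<open>v \<tau>\<close> the old positions leave the imbalance
    \<open>\<tau> *\<^sub>R d\<close> at \<open>z\<close>; a displacement by \<open>G\<close> times
    \<open>s *\<^sub>R d\<close> reduces it by \<open>s * m \<tau>\<close> times \<open>d\<close>.
    Hence the factor \<open>\<tau> / m \<tau>\<close>.\<close>
  define \<delta> where "\<delta> \<tau> u = p u + (\<tau> / m \<tau> * G u) *\<^sub>R d" for \<tau> u
  have \<delta>0: "\<delta> 0 = p"
    by (auto simp: \<delta>_def)
  have \<delta>path: "path (\<lambda>t. \<delta> t s)" for s
  proof -
    have "continuous_on {0..1} m"
      unfolding m_def v_def by (intro continuous_intros)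
    moreover have "m \<tau> \<noteq> 0" if "\<tau> \<in> {0..1}" for \<tau>
      using mpos[OF that] by simp
    ultimately show ?thesis
      unfolding path_def \<delta>_def by (intro continuous_intros) auto
  qed
  have \<delta>out: "\<delta> \<tau> h = h" if "h \<in> outer" for \<tau> h
    using that outer_fix G(2) by (simp add: \<delta>_def)
  have \<delta>bal: "balanced (w(z := v \<tau>)) (\<delta> \<tau>)" if \<tau>: "\<tau> \<in> {0..1}" for \<tau>
    unfolding balanced_def
  proof (intro ballI conjI)
    fix u x assume "u \<in> inner" "x \<in> nb u"
    then show "(w(z := v \<tau>)) u x > 0"
      using wpos[of u x] vpos[OF \<tau>, of x] by (cases "u = z") simp_all
  next
    fix u assume u: "u \<in> inner"
    define s where "s = \<tau> / m \<tau>"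
    have diff: "\<delta> \<tau> x - \<delta> \<tau> u = (p x - p u) + (s * (G x - G u)) *\<^sub>R d" for x
      by (simp add: \<delta>_def s_def algebra_simps)
    have split: "(\<Sum>x\<in>nb u. c x *\<^sub>R (\<delta> \<tau> x - \<delta> \<tau> u)) =
        (\<Sum>x\<in>nb u. c x *\<^sub>R (p x - p u)) + (s * (\<Sum>x\<in>nb u. c x * (G x - G u))) *\<^sub>R d" for c
      unfolding diff
      by (simp add: scaleR_add_right sum.distrib scaleR_sum_left[symmetric] sum_distrib_left mult.left_commute)
    show "(\<Sum>x\<in>nb u. (w(z := v \<tau>)) u x *\<^sub>R (\<delta> \<tau> x - \<delta> \<tau> u)) = 0"
    proof (cases "u = z")
      case False
      then show ?thesis
        using split[of "w u"] G(4)[OF u False] bal u by (simp add: balanced_def)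
    next
      case True
      have "(\<Sum>x\<in>nb z. v \<tau> x *\<^sub>R (p x - p z)) =
          (1 - \<tau>) *\<^sub>R (\<Sum>x\<in>nb z. w z x *\<^sub>R (p x - p z)) + \<tau> *\<^sub>R d"
        by (simp only: v_def d_def scaleR_add_left sum.distrib scaleR_scaleR[symmetric] scaleR_sum_right)
      also have "\<dots> = \<tau> *\<^sub>R d"
        using bal z by (simp add: balanced_def)
      finally have 1: "(\<Sum>x\<in>nb z. v \<tau> x *\<^sub>R (p x - p z)) = \<tau> *\<^sub>R d" .
      have "(\<Sum>x\<in>nb z. v \<tau> x * (G x - G z)) = - m \<tau>"
        by (simp add: m_def G(1) sum_negf[symmetric] right_diff_distrib)
      then have "s * (\<Sum>x\<in>nb z. v \<tau> x * (G x - G z)) = - \<tau>"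
        using mpos[OF \<tau>] by (simp add: s_def)
      then show ?thesis
        using split[of "v \<tau>"] 1 True by simp
    qed
  qed
  have "reachable (\<delta> 1)"
  proof (rule reachable_extend[OF assms(1) \<delta>path \<delta>0])
    fix t :: real assume t: "t \<in> {0..1}" "weak_type S (\<delta> t)"
    interpret weak_drawing S T "\<delta> t" "w(z := v t)"
      by unfold_locales (use t \<delta>out \<delta>bal in auto)
    show "plane_config S T (\<delta> t)"
      by (rule weak_drawing_plane)
  qed
  moreover have "v 1 = \<omega>"
    by (auto simp: v_def)
  ultimately show ?thesis
    using that[of "\<delta> 1"] \<delta>out \<delta>bal[of 1] by simp
qed

text \<open>The weights are exchanged row by row, from those of the identity drawing to
  \<open>W\<close>.\<close>

theorem balanced_drawing_exists:
  assumes "positive W"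
  obtains p where "same_type S p" "\<And>h. h \<in> outer \<Longrightarrow> p h = h" "balanced W p"
proof -
  obtain w0 where w0: "balanced w0 id"
    by (rule initial_weights)
  have ex: "\<exists>p. reachable p \<and> (\<forall>h\<in>outer. p h = h) \<and> balanced (\<lambda>u. if u \<in> A then W u else w0 u) p"
    if "finite A" "A \<subseteq> inner" for A
    using that
  proof induction
    case empty
    then show ?case
      using w0 reachable_id by auto
  next
    case (insert z A)
    then obtain p where p: "reachable p" "\<And>h. h \<in> outer \<Longrightarrow> p h = h"
      "balanced (\<lambda>u. if u \<in> A then W u else w0 u) p"
      by blast
    obtain p' where p': "reachable p'" "\<And>h. h \<in> outer \<Longrightarrow> p' h = h"
      "balanced ((\<lambda>u. if u \<in> A then W u else w0 u)(z := W z)) p'"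
      using change_row[OF p, of z "W z"] insert.prems assms by (auto simp: positive_def)
    moreover have "(\<lambda>u. if u \<in> A then W u else w0 u)(z := W z) = (\<lambda>u. if u \<in> insert z A then W u else w0 u)"
      by auto
    ultimately show ?case
      by auto
  qed
  have "finite inner"
    using finS by (simp add: inner_def)
  from ex[OF this subset_refl] obtain p where p: "reachable p" "\<forall>h\<in>outer. p h = h"
    and bal: "balanced (\<lambda>u. if u \<in> inner then W u else w0 u) p"
    by blast
  have "balanced W p"
    using bal by (simp add: balanced_def)
  then show ?thesis
    using that[of p] reachable_same_type[OF p(1)] p(2) by blast
qed

end

section \<open>Maximal plane graphs\<close>

locale maximal_plane_graph = plane_graph +
  assumes maximal: "u \<in> S \<Longrightarrow> v \<in> S \<Longrightarrow> u \<noteq> v \<Longrightarrow> {u, v} \<notin> T \<Longrightarrow>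
    \<exists>a b. {a, b} \<in> T \<and> {a, b} \<inter> {u, v} = {} \<and> closed_segment a b \<inter> closed_segment u v \<noteq> {}"
begin

text \<open>Visibility of \<open>m\<close> from \<open>c\<close>: edges at \<open>c\<close> do not
  count as obstacles, and \<open>t < 1\<close> exempts the end \<open>m\<close>, which will lie on
  the blocking edge.\<close>

definition unblocked :: "point \<Rightarrow> point \<Rightarrow> bool" where
  "unblocked c m \<longleftrightarrow> (\<forall>a b t. {a, b} \<in> T \<longrightarrow> c \<noteq> a \<longrightarrow> c \<noteq> b \<longrightarrow> 0 \<le> t \<longrightarrow> t < 1 \<longrightarrow>
     c + t *\<^sub>R (m - c) \<notin> closed_segment a b)"

lemma vertex_not_on_edge:
  assumes "{a, b} \<in> T" "s \<in> S" "s \<noteq> a" "s \<noteq> b"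
  shows "s \<notin> closed_segment a b"
  using gp[of a b s] edgeD[OF assms(1)] assms det3_closed_segment by metis

lemma edges_meet_only_at_endpoint:
  assumes "{p, q} \<in> T" "{a, b} \<in> T" "q \<noteq> a" "q \<noteq> b" "x \<in> closed_segment p q" "x \<in> closed_segment a b"
  shows "x = p"
proof (rule ccontr)
  assume "x \<noteq> p"
  have S: "p \<in> S" "q \<in> S" "a \<in> S" "b \<in> S" "p \<noteq> q" "a \<noteq> b"
    using edgeD assms by blast+
  obtain l where l: "x = p + l *\<^sub>R (q - p)" "0 \<le> l" "l \<le> 1"
    using assms(5) by (rule in_closed_segmentE)
  have "l \<noteq> 0"
    using l(1) \<open>x \<noteq> p\<close> by auto
  have "p = a \<or> p = b"
    using noncross[OF assms(1,2)] assms by blast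
  then have "p \<in> {a, b}" and "det3 a b q \<noteq> 0"
    using gp[of a b q] S assms(3,4) by auto
  have "det3 a b x = (1 - l) * det3 a b p + l * det3 a b q"
    unfolding l(1) det3_def by (simp add: algebra_simps)
  moreover have "det3 a b p = 0"
    using \<open>p \<in> {a, b}\<close> by auto
  ultimately show False
    using det3_closed_segment[OF assms(6)] \<open>l \<noteq> 0\<close> \<open>det3 a b q \<noteq> 0\<close> by simp
qed

text \<open>Take the point nearest to \<open>c\<close> at which the segment meets an edge not
  incident to \<open>c\<close>; general position keeps it off the vertices.\<close>

lemma first_block:
  assumes cy: "c \<in> S" "y \<in> S" "c \<noteq> y" "{c, y} \<notin> T"
  obtains m p q \<tau> where "{p, q} \<in> T" "{p, q} \<inter> {c, y} = {}" "m \<in> closed_segment p q" "m \<noteq> p" "m \<noteq> q"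
    "m = c + \<tau> *\<^sub>R (y - c)" "0 < \<tau>" "\<tau> < 1" "unblocked c m"
proof -
  define K where "K = (\<Union>z\<in>{z \<in> S \<times> S. {fst z, snd z} \<in> T \<and> c \<noteq> fst z \<and> c \<noteq> snd z}. closed_segment (fst z) (snd z))"
  have K: "x \<in> K \<longleftrightarrow> (\<exists>a b. {a, b} \<in> T \<and> c \<noteq> a \<and> c \<noteq> b \<and> x \<in> closed_segment a b)" for x
    unfolding K_def using edgeD by fastforce
  have "compact K"
    unfolding K_def using finS
    by (intro compact_UN finite_subset[OF _ finite_cartesian_product[OF finS finS]]) auto
  then have "compact (K \<inter> closed_segment c y)"
    by (intro compact_Int_closed) auto
  obtain a0 b0 x0 where x0: "{a0, b0} \<in> T" "{a0, b0} \<inter> {c, y} = {}" "x0 \<in> closed_segment a0 b0" "x0 \<in> closed_segment c y"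
    using maximal[OF cy] by blast
  have "x0 \<in> K"
    unfolding K using x0 by blast
  then obtain m where m: "m \<in> K" "m \<in> closed_segment c y"
    and min: "\<And>x. x \<in> K \<Longrightarrow> x \<in> closed_segment c y \<Longrightarrow> dist c m \<le> dist c x"
  proof -
    have "\<exists>m\<in>K \<inter> closed_segment c y. \<forall>x\<in>K \<inter> closed_segment c y. dist c m \<le> dist c x"
      using \<open>x0 \<in> K\<close> x0(4)
      by (intro continuous_attains_inf[OF \<open>compact (K \<inter> closed_segment c y)\<close>] continuous_intros) blast
    then show ?thesis
      using that by blast
  qed
  obtain \<tau> where \<tau>: "m = c + \<tau> *\<^sub>R (y - c)" "0 \<le> \<tau>" "\<tau> \<le> 1"
    using m(2) by (rule in_closed_segmentE)
  obtain p q where pq: "{p, q} \<in> T" "c \<noteq> p" "c \<noteq> q" "m \<in> closed_segment p q"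
    using m(1) unfolding K by blast
  have S: "p \<in> S" "q \<in> S" "p \<noteq> q"
    using edgeD[OF pq(1)] by auto
  have "m \<noteq> c"
    using vertex_not_on_edge[OF pq(1) cy(1) pq(2,3)] pq(4) by auto
  then have "\<tau> \<noteq> 0"
    using \<tau> by auto
  have "x0 \<noteq> y"
    using vertex_not_on_edge[OF x0(1) cy(2)] x0 by auto
  obtain \<tau>0 where \<tau>0: "x0 = c + \<tau>0 *\<^sub>R (y - c)" "0 \<le> \<tau>0" "\<tau>0 \<le> 1"
    using x0(4) by (rule in_closed_segmentE)
  have "\<tau> * norm (y - c) \<le> \<tau>0 * norm (y - c)"
    using min[OF \<open>x0 \<in> K\<close> x0(4)] \<tau> \<tau>0 by (simp add: dist_norm)
  then have "\<tau> \<le> \<tau>0"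
    using cy(3) by (simp add: mult_le_cancel_right)
  moreover have "\<tau>0 \<noteq> 1"
    using \<tau>0(1) \<open>x0 \<noteq> y\<close> by auto
  ultimately have \<tau>01: "0 < \<tau>" "\<tau> < 1"
    using \<tau> \<tau>0 \<open>\<tau> \<noteq> 0\<close> by auto
  then have "m \<noteq> y"
    using \<tau>(1) cy(3) by (metis add_diff_cancel_left' eq_iff_diff_eq_0 less_irrefl scaleR_cancel_right
        scaleR_one)
  have off: "det3 c y m = 0"
    unfolding \<tau>(1) det3_def by (simp add: algebra_simps)
  have ends: "r \<noteq> y \<and> m \<noteq> r" if e: "{r, r'} \<in> T" "c \<noteq> r" "c \<noteq> r'" "m \<in> closed_segment r r'" for r r'
  proof -
    have rS: "r \<in> S" "r' \<in> S" "r \<noteq> r'"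
      using edgeD[OF e(1)] by auto
    obtain l where l: "m = r + l *\<^sub>R (r' - r)" "0 \<le> l" "l \<le> 1"
      using e(4) by (rule in_closed_segmentE)
    have "r \<noteq> y"
    proof
      assume "r = y"
      then have "l \<noteq> 0"
        using l(1) \<open>m \<noteq> y\<close> by auto
      have "det3 c y m = l * det3 c y r'"
        unfolding l(1) \<open>r = y\<close> det3_def by (simp add: algebra_simps)
      then show False
        using off \<open>l \<noteq> 0\<close> gp[of c y r'] cy rS e \<open>r = y\<close> by auto
    qed
    moreover have "m \<noteq> r"
      using off gp[of c y r] cy rS e \<open>r \<noteq> y\<close> by auto
    ultimately show ?thesis ..
  qed
  have qp: "{q, p} \<in> T" "m \<in> closed_segment q p"
    using pq by (simp_all add: insert_commute closed_segment_commute)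
  have *: "p \<noteq> y" "q \<noteq> y" "m \<noteq> p" "m \<noteq> q"
    using ends[OF pq] ends[OF qp(1) pq(3,2) qp(2)] by blast+
  have "unblocked c m"
    unfolding unblocked_def
  proof (intro allI impI notI)
    fix a b and t :: real assume ab: "{a, b} \<in> T" "c \<noteq> a" "c \<noteq> b" "0 \<le> t" "t < 1"
      and in_seg: "c + t *\<^sub>R (m - c) \<in> closed_segment a b"
    have "c + t *\<^sub>R (m - c) = c + (t * \<tau>) *\<^sub>R (y - c)"
      by (simp add: \<tau>(1))
    moreover have "0 \<le> t * \<tau>" "t * \<tau> \<le> 1"
      using ab \<tau> by (auto intro: mult_le_one)
    ultimately have "c + t *\<^sub>R (m - c) \<in> closed_segment c y"
      by (rule in_closed_segmentI)
    moreover have "c + t *\<^sub>R (m - c) \<in> K"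
      unfolding K using ab in_seg by blast
    ultimately have "dist c m \<le> t * dist c m"
      using min[of "c + t *\<^sub>R (m - c)"] ab(4) by (simp add: dist_norm norm_minus_commute)
    then show False
      using ab(5) \<open>m \<noteq> c\<close> by simp
  qed
  then show ?thesis
    using that[OF pq(1) _ pq(4) *(3,4) \<tau>(1) \<tau>01] pq(2,3) * by auto
qed

text \<open>Barycentric coordinates by Cramer's rule.\<close>

lemma triangle_coords:
  fixes c m q x :: point
  assumes "D = det3 c m q" "D \<noteq> 0"
  shows "det3 x m q / D + det3 c x q / D + det3 c m x / D = 1"
    "x = (det3 x m q / D) *\<^sub>R c + (det3 c x q / D) *\<^sub>R m + (det3 c m x / D) *\<^sub>R q"
proof -
  have "det3 x m q + det3 c x q + det3 c m x = D"
    unfolding assms(1) by (simp add: det3_def algebra_simps)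
  then show 1: "det3 x m q / D + det3 c x q / D + det3 c m x / D = 1"
    using assms(2) by (simp add: add_divide_distrib[symmetric])
  have "D *\<^sub>R x = det3 x m q *\<^sub>R c + det3 c x q *\<^sub>R m + det3 c m x *\<^sub>R q"
    unfolding assms(1) by (simp add: prod_eq_iff det3_def algebra_simps)
  then have "(1 / D) *\<^sub>R (D *\<^sub>R x) = (1 / D) *\<^sub>R (det3 x m q *\<^sub>R c + det3 c x q *\<^sub>R m + det3 c m x *\<^sub>R q)"
    by simp
  then show "x = (det3 x m q / D) *\<^sub>R c + (det3 c x q / D) *\<^sub>R m + (det3 c m x / D) *\<^sub>R q"
    using assms(2) by (simp add: scaleR_add_right)
qed

text \<open>Descent: if \<open>q\<close> itself is not a neighbour, then the first edge blocking the segment from \<open>c\<close> to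
  \<open>q\<close> has an endpoint in the triangle \<open>c m q\<close>, and the triangle it spans no longer contains \<open>q\<close>.\<close>

lemma neighbour_in_triangle:
  assumes "c \<in> S" "{p, q} \<in> T" "c \<noteq> p" "c \<noteq> q" "m \<in> closed_segment p q" "m \<noteq> p" "m \<noteq> q" "unblocked c m"
  shows "\<exists>z\<in>nb c. z \<in> convex hull {c, m, q}"
  using assms(2-)
proof (induction "card (S \<inter> convex hull {c, m, q})" arbitrary: p q m rule: less_induct)
  case less
  note pq = less.prems
  have S: "p \<in> S" "q \<in> S" "p \<noteq> q"
    using edgeD[OF pq(1)] by auto
  show ?case
  proof (cases "{c, q} \<in> T")
    case True
    then show ?thesis
      by (intro bexI[of _ q]) (auto simp: nb_def hull_inc)
  next
    case False
    obtain m' a0 b0 \<tau> where blk: "{a0, b0} \<in> T" "{a0, b0} \<inter> {c, q} = {}" "m' \<in> closed_segment a0 b0"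
      "m' \<noteq> a0" "m' \<noteq> b0" "m' = c + \<tau> *\<^sub>R (q - c)" "0 < \<tau>" "\<tau> < 1" "unblocked c m'"
      by (rule first_block[OF \<open>c \<in> S\<close> S(2) pq(3) False])
    obtain k where k: "m = p + k *\<^sub>R (q - p)" "0 \<le> k" "k \<le> 1"
      using pq(4) by (rule in_closed_segmentE)
    define D where "D = det3 c m q"
    have "D = (1 - k) * det3 c p q"
      unfolding D_def k(1) det3_def by (simp add: algebra_simps)
    moreover have "k \<noteq> 1"
      using k(1) pq(6) by auto
    ultimately have "D \<noteq> 0"
      using gp[of c p q] \<open>c \<in> S\<close> S pq by simp
    \<comment> \<open>Barycentric coordinates with respect to \<open>c\<close>, \<open>m\<close> and
      \<open>q\<close>, in this order.\<close>
    define \<alpha> where "\<alpha> x = det3 x m q / D" for x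
    define \<beta> where "\<beta> x = det3 c x q / D" for x
    define \<gamma> where "\<gamma> x = det3 c m x / D" for x
    have sum1: "\<alpha> x + \<beta> x + \<gamma> x = 1" and comb: "x = \<alpha> x *\<^sub>R c + \<beta> x *\<^sub>R m + \<gamma> x *\<^sub>R q" for x
      using triangle_coords[OF D_def \<open>D \<noteq> 0\<close>, of x] unfolding \<alpha>_def \<beta>_def \<gamma>_def by auto
    have aff: "\<alpha> (u + s *\<^sub>R (v - u)) = \<alpha> u + s * (\<alpha> v - \<alpha> u)" "\<beta> (u + s *\<^sub>R (v - u)) = \<beta> u + s * (\<beta> v - \<beta> u)"
      "\<gamma> (u + s *\<^sub>R (v - u)) = \<gamma> u + s * (\<gamma> v - \<gamma> u)" for u v s
      unfolding \<alpha>_def \<beta>_def \<gamma>_def diff_divide_distrib[symmetric] times_divide_eq_right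
        add_divide_distrib[symmetric]
      by (simp_all add: det3_def algebra_simps)
    have corner: "\<alpha> c = 1" "\<beta> c = 0" "\<gamma> c = 0" "\<alpha> q = 0" "\<beta> q = 0" "\<gamma> q = 1"
      using \<open>D \<noteq> 0\<close> by (auto simp: \<alpha>_def \<beta>_def \<gamma>_def D_def)
    have m'c: "\<alpha> m' = 1 - \<tau>" "\<beta> m' = 0" "\<gamma> m' = \<tau>"
      unfolding blk(6) aff corner by auto
    have \<beta>_nz: "\<beta> s \<noteq> 0" if "s \<in> S" "s \<noteq> c" "s \<noteq> q" for s
      using gp[of c s q] that \<open>c \<in> S\<close> S pq \<open>D \<noteq> 0\<close> by (simp add: \<beta>_def)
    \<comment> \<open>The blocking edge crosses the line \<open>c q\<close>; \<open>a\<close> is its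
      end on the side of \<open>m\<close>, where \<open>\<beta>\<close> is positive.\<close>
    obtain a b where ab: "{a, b} \<in> T" "{a, b} \<inter> {c, q} = {}" "m' \<in> closed_segment b a" "m' \<noteq> a" "m' \<noteq> b" "\<beta> a > 0"
    proof -
      obtain l where l: "m' = a0 + l *\<^sub>R (b0 - a0)" "0 \<le> l" "l \<le> 1"
        using blk(3) by (rule in_closed_segmentE)
      have "\<beta> a0 + l * (\<beta> b0 - \<beta> a0) = 0"
        using m'c(2) unfolding l(1) aff .
      then have "(1 - l) * \<beta> a0 + l * \<beta> b0 = 0"
        by (simp add: algebra_simps)
      moreover have "l \<noteq> 0" "l \<noteq> 1"
        using l(1) blk(4,5) by auto
      moreover have "\<beta> a0 \<noteq> 0" "\<beta> b0 \<noteq> 0"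
        using \<beta>_nz[of a0] \<beta>_nz[of b0] edgeD[OF blk(1)] blk(2) by auto
      ultimately have "\<beta> a0 > 0 \<or> \<beta> b0 > 0"
        using l by (smt (verit) mult_nonneg_nonpos mult_pos_neg)
      then show ?thesis
      proof
        assume "\<beta> a0 > 0"
        then show ?thesis
          using that[of a0 b0] blk by (simp add: closed_segment_commute)
      next
        assume "\<beta> b0 > 0"
        then show ?thesis
          using that[of b0 a0] blk by (auto simp: insert_commute)
      qed
    qed
    have abS: "a \<in> S" "b \<in> S" "a \<noteq> c" "b \<noteq> c" "a \<noteq> q" "b \<noteq> q"
      using edgeD[OF ab(1)] ab(2) by auto
    \<comment> \<open>On the way from \<open>m'\<close> to \<open>a\<close> the edge cannot leave
      the triangle: the side \<open>c m\<close> is unblocked, and on the side \<open>m q\<close> it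
      would meet the edge \<open>p q\<close> away from \<open>p\<close>.\<close>
    have no_exit: False if x: "x = m' + s *\<^sub>R (a - m')" "0 \<le> s" "s \<le> 1" and
      pos: "\<alpha> x \<ge> 0" "\<beta> x > 0" "\<gamma> x \<ge> 0" and zero: "\<alpha> x = 0 \<or> \<gamma> x = 0" for x s
    proof -
      have "x \<in> closed_segment m' a"
        by (rule in_closed_segmentI[OF x])
      also have "\<dots> \<subseteq> closed_segment a b"
        using ab(3) by (simp add: subset_closed_segment closed_segment_commute)
      finally have x_ab: "x \<in> closed_segment a b" .
      have le1: "\<beta> x \<le> 1"
        using sum1[of x] pos by linarith
      show False
      proof (cases "\<gamma> x = 0 \<and> \<beta> x < 1")
        case True
        then have ag: "\<alpha> x = 1 - \<beta> x" "\<gamma> x = 0"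
          using sum1[of x] by simp_all
        have "\<alpha> x *\<^sub>R c + \<beta> x *\<^sub>R m + \<gamma> x *\<^sub>R q = c + \<beta> x *\<^sub>R (m - c)"
          unfolding ag by (simp add: algebra_simps)
        then have x_eq: "x = c + \<beta> x *\<^sub>R (m - c)"
          by (rule trans[OF comb[of x]])
        have "c + \<beta> x *\<^sub>R (m - c) \<notin> closed_segment a b"
          using pq(7)[unfolded unblocked_def, rule_format, OF ab(1) abS(3)[symmetric] abS(4)[symmetric]]
            True pos(2) by simp
        then have "x \<notin> closed_segment a b"
          using x_eq by metis
        then show False
          using x_ab by blast
      next
        case False
        then have "\<alpha> x = 0"
          using zero sum1[of x] pos le1 by auto
        then have \<gamma>: "\<gamma> x = 1 - \<beta> x"
          using sum1[of x] by simp
        have bg: "\<beta> x = 1 - \<gamma> x"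
          using \<gamma> by simp
        have "\<alpha> x *\<^sub>R c + \<beta> x *\<^sub>R m + \<gamma> x *\<^sub>R q = m + \<gamma> x *\<^sub>R (q - m)"
          unfolding \<open>\<alpha> x = 0\<close> bg by (simp add: algebra_simps)
        also have "\<dots> = p + (k + \<gamma> x * (1 - k)) *\<^sub>R (q - p)"
          unfolding k(1) by (simp add: algebra_simps)
        finally have x_eq: "x = p + (k + \<gamma> x * (1 - k)) *\<^sub>R (q - p)"
          by (rule trans[OF comb[of x]])
        have k01: "0 < k" "k < 1"
          using k pq(5) \<open>k \<noteq> 1\<close> by (auto simp: order_less_le)
        have "\<gamma> x \<le> 1" "0 \<le> \<gamma> x"
          using pos \<gamma> by auto
        then have "\<gamma> x * (1 - k) \<le> 1 - k" "0 \<le> \<gamma> x * (1 - k)"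
          using k01 mult_left_le_one_le[of "1 - k" "\<gamma> x"] by auto
        then have "0 < k + \<gamma> x * (1 - k)" "k + \<gamma> x * (1 - k) \<le> 1"
          using k01 by linarith+
        then have "x \<in> closed_segment p q" "x \<noteq> p"
          using in_closed_segmentI[OF x_eq] x_eq S(3) by auto
        then show False
          using edges_meet_only_at_endpoint[OF pq(1) ab(1) _ _ _ x_ab] abS by auto
      qed
    qed
    have along: "\<beta> (m' + s *\<^sub>R (a - m')) = s * \<beta> a" for s
      unfolding aff m'c by simp
    have a_in: "\<alpha> a \<ge> 0 \<and> \<gamma> a \<ge> 0"
    proof (rule ccontr)
      assume neg: "\<not> (\<alpha> a \<ge> 0 \<and> \<gamma> a \<ge> 0)"
      \<comment> \<open>\<open>sa\<close> and \<open>sc\<close> are the parameters at which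
        \<open>\<alpha>\<close> and \<open>\<gamma>\<close> vanish on the way to \<open>a\<close>;
        the smaller one marks the forbidden exit.\<close>
      define sa where "sa = (1 - \<tau>) / ((1 - \<tau>) - \<alpha> a)"
      define sc where "sc = \<tau> / (\<tau> - \<gamma> a)"
      have \<alpha>s: "\<alpha> (m' + s *\<^sub>R (a - m')) = (1 - \<tau>) - s * ((1 - \<tau>) - \<alpha> a)"
        and \<gamma>s: "\<gamma> (m' + s *\<^sub>R (a - m')) = \<tau> - s * (\<tau> - \<gamma> a)" for s
        unfolding aff m'c by (simp_all add: algebra_simps)
      have sa: "0 < sa" "sa \<le> 1" "(1 - \<tau>) - sa * ((1 - \<tau>) - \<alpha> a) = 0" if "\<alpha> a < 0"
        using that blk(7,8) by (auto simp: sa_def)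
      have sc: "0 < sc" "sc \<le> 1" "\<tau> - sc * (\<tau> - \<gamma> a) = 0" if "\<gamma> a < 0"
        using that blk(7,8) by (auto simp: sc_def)
      consider "\<alpha> a < 0" "\<gamma> a \<ge> 0 \<or> sa \<le> sc" | "\<gamma> a < 0" "\<alpha> a \<ge> 0 \<or> sc \<le> sa"
        using neg by linarith
      then show False
      proof cases
        case 1
        have "\<tau> - sa * (\<tau> - \<gamma> a) \<ge> 0"
        proof (cases "\<gamma> a \<ge> 0")
          case True
          have "\<tau> - sa * (\<tau> - \<gamma> a) = (1 - sa) * \<tau> + sa * \<gamma> a"
            by (simp add: algebra_simps)
          then show ?thesis
            using True sa[OF 1(1)] blk(7) by simp
        next
          case False
          then have "sa * (\<tau> - \<gamma> a) \<le> sc * (\<tau> - \<gamma> a)"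
            using 1(2) blk(7) by (intro mult_right_mono) auto
          then show ?thesis
            using sc(3) False by simp
        qed
        then show False
          using no_exit[OF refl, of sa] sa[OF 1(1)] ab(6) unfolding \<alpha>s \<gamma>s along by simp
      next
        case 2
        have "(1 - \<tau>) - sc * ((1 - \<tau>) - \<alpha> a) \<ge> 0"
        proof (cases "\<alpha> a \<ge> 0")
          case True
          have "(1 - \<tau>) - sc * ((1 - \<tau>) - \<alpha> a) = (1 - sc) * (1 - \<tau>) + sc * \<alpha> a"
            by (simp add: algebra_simps)
          then show ?thesis
            using True sc[OF 2(1)] blk(8) by simp
        next
          case False
          then have "sc * ((1 - \<tau>) - \<alpha> a) \<le> sa * ((1 - \<tau>) - \<alpha> a)"
            using 2(2) blk(8) by (intro mult_right_mono) auto
          then show ?thesis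
            using sa(3) False by simp
        qed
        then show False
          using no_exit[OF refl, of sc] sc[OF 2(1)] ab(6) unfolding \<alpha>s \<gamma>s along by simp
      qed
    qed
    have a_hull: "a \<in> convex hull {c, m, q}"
      unfolding convex_hull_3
      by (intro CollectI exI[of _ "\<alpha> a"] exI[of _ "\<beta> a"] exI[of _ "\<gamma> a"] conjI comb sum1)
        (use a_in ab(6) in simp_all)
    have "m' \<in> closed_segment c q"
      using in_closed_segmentI[OF blk(6)] blk(7,8) by simp
    then have m'_hull: "m' \<in> convex hull {c, m, q}"
      using hull_mono[of "{c, q}" "{c, m, q}" convex] by (auto simp: segment_convex_hull)
    have sub: "convex hull {c, m', a} \<subseteq> convex hull {c, m, q}"
      using a_hull m'_hull by (intro hull_minimal) (auto simp: hull_inc)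
    have "\<gamma> a < 1"
    proof (rule ccontr)
      assume "\<not> \<gamma> a < 1"
      then show False
        using sum1[of a] a_in ab(6) by linarith
    qed
    \<comment> \<open>\<open>\<gamma>\<close> is below 1 at all corners of the new triangle but
      equals 1 at \<open>q\<close>. So the new triangle contains fewer vertices, and the induction
      applies.\<close>
    have "q \<notin> convex hull {c, m', a}"
    proof
      assume "q \<in> convex hull {c, m', a}"
      then obtain u v w where uvw: "0 \<le> u" "0 \<le> v" "0 \<le> w" "u + v + w = 1" "q = u *\<^sub>R c + v *\<^sub>R m' + w *\<^sub>R a"
        unfolding convex_hull_3 by auto
      have "q = c + v *\<^sub>R (m' - c) + w *\<^sub>R (a - c)"
      proof -
        have u_eq: "u = 1 - v - w"
          using uvw(4) by simp
        have "u *\<^sub>R c + v *\<^sub>R m' + w *\<^sub>R a = c + v *\<^sub>R (m' - c) + w *\<^sub>R (a - c)"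
          unfolding u_eq by (simp add: algebra_simps)
        then show ?thesis
          by (rule trans[OF uvw(5)])
      qed
      moreover have "\<gamma> (c + v *\<^sub>R (m' - c) + w *\<^sub>R (a - c)) = v * \<gamma> m' + w * \<gamma> a"
        unfolding \<gamma>_def times_divide_eq_right add_divide_distrib[symmetric]
        by (simp add: det3_def algebra_simps)
      ultimately have "1 = v * \<tau> + w * \<gamma> a"
        using corner(6) m'c(3) by simp
      moreover have "v * \<tau> \<le> v" "w * \<gamma> a \<le> w"
        using uvw blk(8) \<open>\<gamma> a < 1\<close> by (simp_all add: mult_left_le)
      moreover have "v * \<tau> = v \<Longrightarrow> v = 0" "w * \<gamma> a = w \<Longrightarrow> w = 0"
        using blk(8) \<open>\<gamma> a < 1\<close> by auto
      ultimately show False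
        using uvw by linarith
    qed
    then have "S \<inter> convex hull {c, m', a} \<subset> S \<inter> convex hull {c, m, q}"
      using sub S(2) by (auto simp: hull_inc)
    then have "card (S \<inter> convex hull {c, m', a}) < card (S \<inter> convex hull {c, m, q})"
      using finS by (intro psubset_card_mono) auto
    from less.hyps[OF this, of b]
    have "\<exists>z\<in>nb c. z \<in> convex hull {c, m', a}"
      using ab blk(9) abS by (auto simp: insert_commute)
    then show ?thesis
      using sub by blast
  qed
qed

text \<open>If no vertex were higher than \<open>u\<close>, then by general position at most one
  vertex \<open>s0\<close> could tie with it, and tilting \<open>g\<close> slightly away from
  \<open>s0\<close> would expose \<open>u\<close>.\<close>

lemma inner_strictly_dominated:
  assumes u: "u \<in> inner" and "g \<noteq> 0"
  shows "\<exists>s\<in>S. g \<bullet> s > g \<bullet> u"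
proof (rule ccontr)
  assume neg: "\<not> (\<exists>s\<in>S. g \<bullet> s > g \<bullet> u)"
  have uS: "u \<in> S" "u \<notin> outer"
    using u by (auto simp: inner_def)
  have tie: "\<exists>s\<in>S - {u}. g' \<bullet> s \<ge> g' \<bullet> u" for g'
  proof (rule ccontr)
    assume "\<not> ?thesis"
    then have "\<forall>s\<in>S - {u}. g' \<bullet> s < g' \<bullet> u"
      by (simp add: not_le)
    then show False
      using uS unfolding outer_def by blast
  qed
  obtain s0 where s0: "s0 \<in> S" "s0 \<noteq> u" "g \<bullet> s0 = g \<bullet> u"
    using tie[of g] neg by force
  have strict: "g \<bullet> s < g \<bullet> u" if s: "s \<in> S" "s \<noteq> u" "s \<noteq> s0" for s
  proof (rule ccontr)
    assume "\<not> ?thesis"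
    then have eq: "g \<bullet> s = g \<bullet> u"
      using neg s(1) by force
    have "fst g * det3 u s0 s = (snd s - snd u) * (g \<bullet> s0 - g \<bullet> u) - (snd s0 - snd u) * (g \<bullet> s - g \<bullet> u)"
      "snd g * det3 u s0 s = (fst s0 - fst u) * (g \<bullet> s - g \<bullet> u) - (fst s - fst u) * (g \<bullet> s0 - g \<bullet> u)"
      by (simp_all add: det3_def inner_prod_def algebra_simps)
    then have "fst g * det3 u s0 s = 0" "snd g * det3 u s0 s = 0"
      using eq s0(3) by simp_all
    then have "det3 u s0 s = 0"
      using \<open>g \<noteq> 0\<close> by (auto simp: prod_eq_iff)
    then show False
      using gp[of u s0 s] uS s0 s by auto
  qed
  have "\<forall>\<^sub>F \<delta> in at_right (0::real). \<forall>s\<in>S - {u, s0}. (g - \<delta> *\<^sub>R (s0 - u)) \<bullet> (s - u) < 0"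
  proof (rule eventually_ball_finite)
    show "finite (S - {u, s0})"
      using finS by simp
    show "\<forall>s\<in>S - {u, s0}. \<forall>\<^sub>F \<delta> in at_right 0. (g - \<delta> *\<^sub>R (s0 - u)) \<bullet> (s - u) < 0"
    proof
      fix s assume s: "s \<in> S - {u, s0}"
      have "((\<lambda>\<delta>. (g - \<delta> *\<^sub>R (s0 - u)) \<bullet> (s - u)) \<longlongrightarrow> (g - 0 *\<^sub>R (s0 - u)) \<bullet> (s - u)) (at_right 0)"
        by (intro tendsto_intros)
      moreover have "(g - 0 *\<^sub>R (s0 - u)) \<bullet> (s - u) < 0"
        using strict s by (auto simp: inner_diff_right)
      ultimately show "\<forall>\<^sub>F \<delta> in at_right 0. (g - \<delta> *\<^sub>R (s0 - u)) \<bullet> (s - u) < 0"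
        by (rule order_tendstoD(2))
    qed
  qed
  moreover have "\<forall>\<^sub>F \<delta> in at_right (0::real). \<delta> > 0"
    by (rule eventually_at_right_less)
  ultimately have "\<forall>\<^sub>F \<delta> in at_right (0::real). \<delta> > 0 \<and>
      (\<forall>s\<in>S - {u, s0}. (g - \<delta> *\<^sub>R (s0 - u)) \<bullet> (s - u) < 0)"
    by eventually_elim auto
  then have "\<exists>\<delta>::real. \<delta> > 0 \<and> (\<forall>s\<in>S - {u, s0}. (g - \<delta> *\<^sub>R (s0 - u)) \<bullet> (s - u) < 0)"
    by (rule eventually_happens'[rotated]) (simp add: trivial_limit_at_right_real)
  then obtain \<delta> :: real where \<delta>: "\<delta> > 0" "\<And>s. s \<in> S - {u, s0} \<Longrightarrow> (g - \<delta> *\<^sub>R (s0 - u)) \<bullet> (s - u) < 0"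
    by blast
  define g' where "g' = g - \<delta> *\<^sub>R (s0 - u)"
  have "g' \<bullet> (s0 - u) = - \<delta> * ((s0 - u) \<bullet> (s0 - u))"
    using s0(3) by (simp add: g'_def inner_diff_left inner_diff_right algebra_simps)
  moreover have "(s0 - u) \<bullet> (s0 - u) > 0"
    using s0(2) by simp
  ultimately have "g' \<bullet> (s0 - u) < 0"
    using \<delta>(1) by (simp add: mult_pos_pos)
  then have "g' \<bullet> (s - u) < 0" if "s \<in> S - {u}" for s
    using \<delta>(2)[of s] that unfolding g'_def by (cases "s = s0") auto
  then have below: "g' \<bullet> s < g' \<bullet> u" if "s \<in> S - {u}" for s
    using that by (simp add: inner_diff_right)
  obtain s where "s \<in> S - {u}" "g' \<bullet> s \<ge> g' \<bullet> u"
    using tie[of g'] by blast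
  then show False
    using below[of s] by simp
qed

text \<open>Some vertex \<open>s\<close> is higher than \<open>u\<close> in direction
  \<open>g\<close>. If it is not a neighbour, the blocking point \<open>m\<close> on the way to it
  is higher than \<open>u\<close>, hence so is one end \<open>q\<close> of the blocking edge. Then
  \<open>neighbour_in_triangle\<close> yields a neighbour in the triangle \<open>u m q\<close>,
  where every point except \<open>u\<close> is higher.\<close>

sublocale surrounded_plane_graph
proof
  fix u and g :: point assume u: "u \<in> inner" and "g \<noteq> 0"
  obtain s where s: "s \<in> S" "g \<bullet> s > g \<bullet> u"
    using inner_strictly_dominated[OF u \<open>g \<noteq> 0\<close>] by blast
  have uS: "u \<in> S" "u \<noteq> s"
    using inner_S[OF u] s by auto
  show "\<exists>x\<in>nb u. g \<bullet> x > g \<bullet> u"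
  proof (cases "{u, s} \<in> T")
    case True
    then show ?thesis
      using s by (intro bexI[of _ s]) (simp_all add: nb_def)
  next
    case False
    obtain m p q \<tau> where blk: "{p, q} \<in> T" "{p, q} \<inter> {u, s} = {}" "m \<in> closed_segment p q" "m \<noteq> p" "m \<noteq> q"
      "m = u + \<tau> *\<^sub>R (s - u)" "0 < \<tau>" "\<tau> < 1" "unblocked u m"
      by (rule first_block[OF uS(1) s(1) uS(2) False])
    have gm: "g \<bullet> m > g \<bullet> u"
      using blk(6,7) s(2) by (simp add: inner_add_right inner_diff_right)
    have fin: "\<exists>x\<in>nb u. g \<bullet> x > g \<bullet> u"
      if e: "{p, q} \<in> T" "u \<noteq> p" "u \<noteq> q" "m \<in> closed_segment p q" "m \<noteq> p" "m \<noteq> q" and gq: "g \<bullet> q > g \<bullet> u" for p q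
    proof -
      obtain z where z: "z \<in> nb u" "z \<in> convex hull {u, m, q}"
        using neighbour_in_triangle[OF uS(1) e blk(9)] by blast
      obtain a b c where abc: "0 \<le> a" "0 \<le> b" "0 \<le> c" "a + b + c = 1" "z = a *\<^sub>R u + b *\<^sub>R m + c *\<^sub>R q"
        using z(2) unfolding convex_hull_3 by auto
      have "a = 1 - b - c"
        using abc(4) by simp
      then have z_eq: "z = (1 - b - c) *\<^sub>R u + b *\<^sub>R m + c *\<^sub>R q"
        using abc(5) by simp
      have "g \<bullet> z - g \<bullet> u = b * (g \<bullet> m - g \<bullet> u) + c * (g \<bullet> q - g \<bullet> u)"
        unfolding z_eq by (simp add: inner_add_right algebra_simps)
      moreover have "b > 0 \<or> c > 0"
      proof (rule ccontr)
        assume "\<not> ?thesis"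
        then have "b = 0" "c = 0"
          using abc by auto
        then show False
          using abc(4,5) nbD(3)[OF z(1)] by simp
      qed
      ultimately have "g \<bullet> z > g \<bullet> u"
        using gm gq abc(2,3) by (smt (verit) mult_nonneg_nonneg mult_pos_pos)
      then show ?thesis
        using z(1) by blast
    qed
    obtain l where l: "m = p + l *\<^sub>R (q - p)" "0 \<le> l" "l \<le> 1"
      using blk(3) by (rule in_closed_segmentE)
    have "g \<bullet> m = (1 - l) * (g \<bullet> p) + l * (g \<bullet> q)"
      unfolding l(1) by (simp add: inner_add_right inner_diff_right algebra_simps)
    then have "g \<bullet> q > g \<bullet> u \<or> g \<bullet> p > g \<bullet> u"
      using gm l convex_bound_le[of "g \<bullet> p" "g \<bullet> u" "g \<bullet> q" "1 - l" l] by force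
    then show ?thesis
      using fin[of p q] fin[of q p] blk by (auto simp: closed_segment_commute insert_commute)
  qed
qed

end

section \<open>The triangle at a hull edge\<close>

context maximal_plane_graph
begin

text \<open>\<open>w\<close> is the first neighbour of \<open>A\<close> when turning from
  \<open>C\<close> towards the inside. If \<open>C w\<close> were not an edge, the triangle
  \<open>A C w\<close> would contain no vertex, and an edge blocking \<open>C w\<close> would have
  to end inside it, leave \<open>A\<close> before \<open>w\<close>, or cross
  \<open>A w\<close>.\<close>

lemma hull_edge_apex:
  assumes AC: "A \<in> S" "C \<in> S" "A \<noteq> C" and side: "\<And>s. s \<in> S \<Longrightarrow> s \<noteq> A \<Longrightarrow> s \<noteq> C \<Longrightarrow> det3 A C s > 0"
    and ne: "nb A - {C} \<noteq> {}"
  obtains w where "w \<in> nb A" "w \<in> nb C" "\<And>v. v \<in> nb A \<Longrightarrow> v \<noteq> C \<Longrightarrow> det3 A w v \<ge> 0"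
proof -
  have pos: "det3 A C v > 0" if "v \<in> nb A - {C}" for v
    using side[of v] nbD(2,3)[of v A] that by auto
  have "finite (nb A - {C})"
    using finite_nb by simp
  moreover have "-1 * det3 A x C > 0" if "x \<in> nb A - {C}" for x
    using pos[OF that] det3_swap'[of A x C] by simp
  ultimately obtain w where w: "w \<in> nb A - {C}" "\<And>x. x \<in> nb A - {C} \<Longrightarrow> -1 * det3 A x w \<ge> 0"
    using halfplane_extreme[of "nb A - {C}" "-1" A C] ne by metis
  have first: "det3 A w v \<ge> 0" if "v \<in> nb A" "v \<noteq> C" for v
    using w(2)[of v] that det3_swap'[of A w v] by simp
  have wS: "w \<in> S" "w \<noteq> A" "w \<noteq> C" "{A, w} \<in> T"
    using w(1) nbD[of w A] by auto
  have w_pos: "det3 A C w > 0"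
    using pos[OF w(1)] .
  have "{C, w} \<in> T"
  proof (rule ccontr)
    assume no_edge: "{C, w} \<notin> T"
    \<comment> \<open>A vertex \<open>y\<close> strictly inside the triangle \<open>A C w\<close> is
      not adjacent to \<open>A\<close>, as \<open>w\<close> comes first. The two ends of the edge
      blocking \<open>A y\<close> lead either to a neighbour of \<open>A\<close> before
      \<open>w\<close> other than \<open>C\<close> or to a crossing.\<close>
    have empty: False if y: "y \<in> S" "det3 A C y > 0" "det3 A y w > 0" "det3 C w y > 0" for y
    proof -
      have yne: "y \<noteq> A" "y \<noteq> C" "y \<noteq> w"
        using y by auto
      have "{A, y} \<notin> T"
      proof
        assume "{A, y} \<in> T"
        then have "det3 A w y \<ge> 0"
          using first[of y] yne by (simp add: nb_def)
        then show False
          using y(3) det3_swap'[of A w y] by simp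
      qed
      then obtain m p0 q0 \<tau> where blk: "{p0, q0} \<in> T" "{p0, q0} \<inter> {A, y} = {}" "m \<in> closed_segment p0 q0"
        "m \<noteq> p0" "m \<noteq> q0" "m = A + \<tau> *\<^sub>R (y - A)" "0 < \<tau>" "\<tau> < 1" "unblocked A m"
        using first_block[OF AC(1) y(1) yne(1)[symmetric]] by metis
      have det_m: "det3 A y m = 0" "det3 A C m = \<tau> * det3 A C y" "det3 A w m = \<tau> * det3 A w y"
        unfolding blk(6) det3_def by (simp_all add: algebra_simps)
      obtain p q where pq: "{p, q} \<in> T" "{p, q} \<inter> {A, y} = {}" "m \<in> closed_segment p q" "m \<noteq> p" "m \<noteq> q"
        "det3 A y p > 0" "det3 A y q < 0"
      proof -
        obtain l where l: "m = p0 + l *\<^sub>R (q0 - p0)" "0 \<le> l" "l \<le> 1"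
          using blk(3) by (rule in_closed_segmentE)
        have "l \<noteq> 0" "l \<noteq> 1"
          using l(1) blk(4,5) by auto
        have "(1 - l) * det3 A y p0 + l * det3 A y q0 = det3 A y m"
          unfolding l(1) det3_def by (simp add: algebra_simps)
        then have "(1 - l) * det3 A y p0 + l * det3 A y q0 = 0"
          using det_m by simp
        moreover have "det3 A y p0 \<noteq> 0" "det3 A y q0 \<noteq> 0"
          using gp[of A y p0] gp[of A y q0] AC y(1) yne edgeD[OF blk(1)] blk(2) by auto
        ultimately consider "det3 A y p0 > 0" "det3 A y q0 < 0" | "det3 A y p0 < 0" "det3 A y q0 > 0"
          using l \<open>l \<noteq> 0\<close> \<open>l \<noteq> 1\<close> by (smt (verit) mult_nonneg_nonneg mult_pos_pos mult_pos_neg)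
        then show ?thesis
        proof cases
          case 1
          then show ?thesis using that[OF blk(1-5)] by simp
        next
          case 2
          then show ?thesis
            using that[of q0 p0] blk by (auto simp: insert_commute closed_segment_commute)
        qed
      qed
      have S: "p \<in> S" "q \<in> S" "p \<noteq> q" "A \<noteq> p" "A \<noteq> q" "y \<noteq> p" "y \<noteq> q"
        using edgeD[OF pq(1)] pq(2) by auto
      have pq': "{q, p} \<in> T" "m \<in> closed_segment q p"
        using pq by (simp_all add: insert_commute closed_segment_commute)
      obtain z where z: "z \<in> nb A" "z \<in> convex hull {A, m, q}"
        using neighbour_in_triangle[OF AC(1) pq(1) S(4,5) pq(3-5) blk(9)] by blast
      obtain a b c where abc: "0 \<le> a" "0 \<le> b" "0 \<le> c" "a + b + c = 1" "z = a *\<^sub>R A + b *\<^sub>R m + c *\<^sub>R q"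
        using z(2) unfolding convex_hull_3 by auto
      have lin: "det3 A u (a *\<^sub>R A + b *\<^sub>R m' + c *\<^sub>R q') = b * det3 A u m' + c * det3 A u q'"
        if "a + b + c = 1" for u m' q' a b c
      proof -
        have a: "a = 1 - b - c"
          using that by simp
        show ?thesis
          unfolding a det3_def by (simp add: algebra_simps)
      qed
      have "det3 A y z \<le> 0"
        unfolding abc(5) lin[OF abc(4)] using det_m(1) abc(3) pq(7) by (simp add: mult_nonneg_nonpos)
      \<comment> \<open>A neighbour of \<open>A\<close> on or to the right of the ray
        \<open>A y\<close> precedes \<open>w\<close>, so it can only be \<open>C\<close>; this will
        force \<open>q = C\<close>.\<close>
      have "z = C"
      proof (rule ccontr)
        assume "z \<noteq> C"
        then have "det3 A w z \<ge> 0" "det3 A C z > 0"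
          using first[OF z(1)] pos z(1) by auto
        have "det3 A C w * det3 A y z = det3 A C z * det3 A y w + det3 A C y * det3 A w z"
          by (simp add: det3_def algebra_simps)
        moreover have "det3 A C z * det3 A y w > 0" "det3 A C y * det3 A w z \<ge> 0"
          using \<open>det3 A w z \<ge> 0\<close> \<open>det3 A C z > 0\<close> y by auto
        moreover have "det3 A C w * det3 A y z \<le> 0"
          using w_pos \<open>det3 A y z \<le> 0\<close> by (simp add: mult_nonneg_nonpos)
        ultimately show False
          by linarith
      qed
      have "det3 A C z = 0"
        using \<open>z = C\<close> by simp
      then have "b * det3 A C m + c * det3 A C q = 0"
        unfolding abc(5) lin[OF abc(4)] .
      moreover have "det3 A C m > 0"
        using det_m(2) blk(7) y(2) by simp
      moreover have q_nonneg: "det3 A C q \<ge> 0"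
        using side[of q] S by (cases "q = C") auto
      ultimately have "b = 0" "c = 0 \<or> det3 A C q = 0"
        using abc by (smt (verit) mult_nonneg_nonneg mult_pos_pos mult_eq_0_iff)+
      moreover have "c \<noteq> 0"
      proof
        assume "c = 0"
        then have "z = A"
          using abc(4,5) \<open>b = 0\<close> by simp
        then show False
          using nbD(3)[OF z(1)] by simp
      qed
      ultimately have "det3 A C q = 0"
        by simp
      then have "q = C"
        using side[of q] S by force
      have "p \<noteq> w"
        using pq(1) no_edge \<open>q = C\<close> by (auto simp: insert_commute)
      have "det3 A w p \<noteq> 0"
        using gp[of A w p] AC wS S \<open>p \<noteq> w\<close> by auto
      then consider "det3 A w p > 0" | "det3 A w p < 0"
        by linarith
      then show False
      proof cases
        case 1
        have AwC: "det3 A w C < 0"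
          using w_pos det3_swap'[of A w C] by simp
        have "det3 A w p * det3 A w C > 0 \<or> det3 p C A * det3 p C w > 0"
          using noncross_det3[OF wS(4), of p C] pq(1) \<open>q = C\<close> S AC wS \<open>p \<noteq> w\<close> by auto
        then have same: "det3 p C A * det3 p C w > 0"
          using 1 AwC by (auto simp: zero_less_mult_iff)
        have N: "det3 A C w * det3 p C y = det3 C w y * det3 p C A + det3 A C y * det3 p C w"
          by (simp add: det3_def algebra_simps)
        have "det3 p C m = 0"
          using det3_closed_segment[OF pq(3)] \<open>q = C\<close> by simp
        then have M: "(1 - \<tau>) * det3 p C A + \<tau> * det3 p C y = 0"
          unfolding blk(6) det3_def by (simp add: algebra_simps)
        have co: "det3 A C w > 0" "det3 C w y > 0" "det3 A C y > 0" "1 - \<tau> > 0" "\<tau> > 0"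
          using w_pos y blk(7,8) by auto
        \<comment> \<open>\<open>s\<close>, \<open>t\<close>, \<open>u\<close> stand for the
          positions of \<open>A\<close>, \<open>w\<close>, \<open>y\<close> relative to the line
          \<open>p C\<close>. As \<open>A\<close> and \<open>w\<close> share a side, so does
          \<open>y\<close>, which lies in their triangle with \<open>C\<close>; but \<open>m\<close>
          on that line separates \<open>A\<close> from \<open>y\<close>.\<close>
        have gen: False if "d * u = e * s + f * t" "r * s + k * u = 0" "s * t > 0"
          "d > 0" "e > 0" "f > 0" "r > 0" "k > 0" for d e f r k s t u :: real
        proof (cases "s > 0")
          case True
          then have "t > 0"
            using that(3) by (simp add: zero_less_mult_iff)
          then have "d * u > 0" "r * s > 0"
            using that True by (simp_all add: add_pos_pos)
          then have "u > 0"
            using that(4) zero_less_mult_pos by blast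
          then have "k * u > 0"
            using that(8) by simp
          then show False
            using \<open>r * s > 0\<close> that(2) by linarith
        next
          case False
          then have st: "s < 0" "t < 0"
            using that(3) by (auto simp: zero_less_mult_iff)
          then have "d * u < 0" "r * s < 0"
            using that by (simp_all add: add_neg_neg mult_pos_neg)
          then have "u < 0"
            using that(4) by (simp add: mult_less_0_iff)
          then have "k * u < 0"
            using that(8) by (simp add: mult_pos_neg)
          then show False
            using \<open>r * s < 0\<close> that(2) by linarith
        qed
        show False
          by (rule gen[OF N M same co])
      next
        case 2
        obtain z' where z': "z' \<in> nb A" "z' \<in> convex hull {A, m, p}"
          using neighbour_in_triangle[OF AC(1) pq'(1) S(5,4) pq'(2) pq(5,4) blk(9)] by blast
        obtain a b c where abc: "0 \<le> a" "0 \<le> b" "0 \<le> c" "a + b + c = 1" "z' = a *\<^sub>R A + b *\<^sub>R m + c *\<^sub>R p"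
          using z'(2) unfolding convex_hull_3 by auto
        have "det3 A y z' \<ge> 0"
          unfolding abc(5) lin[OF abc(4)] using det_m(1) abc(3) pq(6) by simp
        moreover have "det3 A y C < 0"
          using y(2) det3_swap'[of A y C] by simp
        ultimately have "det3 A w z' \<ge> 0"
          using first[OF z'(1)] by force
        then have sum: "b * det3 A w m + c * det3 A w p \<ge> 0"
          unfolding abc(5) lin[OF abc(4)] .
        have "det3 A w m < 0"
          using det_m(3) blk(7) y(3) det3_swap'[of A w y] by (simp add: mult_pos_neg)
        then have "b * det3 A w m \<le> 0" "b \<noteq> 0 \<Longrightarrow> b * det3 A w m < 0"
          "c * det3 A w p \<le> 0" "c \<noteq> 0 \<Longrightarrow> c * det3 A w p < 0"
          using 2 abc(2,3) by (simp_all add: mult_nonneg_nonpos mult_less_0_iff)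
        then have "b = 0" "c = 0"
          using sum by linarith+
        then show False
          using abc(4,5) nbD(3)[OF z'(1)] by simp
      qed
    qed
    obtain m p0 q0 \<tau> where blk: "{p0, q0} \<in> T" "{p0, q0} \<inter> {C, w} = {}" "m \<in> closed_segment p0 q0"
      "m \<noteq> p0" "m \<noteq> q0" "m = C + \<tau> *\<^sub>R (w - C)" "0 < \<tau>" "\<tau> < 1" "unblocked C m"
      using first_block[OF AC(2) wS(1) wS(3)[symmetric] no_edge] by metis
    have Cwm: "det3 C w m = 0"
      unfolding blk(6) det3_def by (simp add: algebra_simps)
    obtain p q l where pq: "{p, q} \<in> T" "{p, q} \<inter> {C, w} = {}" "det3 C w p > 0"
      "m = p + l *\<^sub>R (q - p)" "0 < l" "l < 1"
    proof -
      obtain l where l: "m = p0 + l *\<^sub>R (q0 - p0)" "0 \<le> l" "l \<le> 1"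
        using blk(3) by (rule in_closed_segmentE)
      have "l \<noteq> 0" "l \<noteq> 1"
        using l(1) blk(4,5) by auto
      then have l01: "0 < l" "l < 1" "0 < 1 - l" "1 - l < 1"
        using l by auto
      have "(1 - l) * det3 C w p0 + l * det3 C w q0 = det3 C w m"
        unfolding l(1) det3_def by (simp add: algebra_simps)
      then have "(1 - l) * det3 C w p0 + l * det3 C w q0 = 0"
        using Cwm by simp
      moreover have "det3 C w p0 \<noteq> 0" "det3 C w q0 \<noteq> 0"
        using gp[of C w p0] gp[of C w q0] AC wS edgeD[OF blk(1)] blk(2) by auto
      ultimately consider "det3 C w p0 > 0" | "det3 C w q0 > 0"
        using l01 by (smt (verit) mult_pos_neg)
      then show ?thesis
      proof cases
        case 1
        then show ?thesis using that[OF blk(1,2) _ l(1) l01(1,2)] by simp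
      next
        case 2
        have "m = q0 + (1 - l) *\<^sub>R (p0 - q0)"
          unfolding l(1) by (simp add: algebra_simps)
        then show ?thesis
          using that[of q0 p0 "1 - l"] blk(1,2) 2 l01 by (simp add: insert_commute)
      qed
    qed
    have S: "p \<in> S" "q \<in> S" "p \<noteq> q" "p \<noteq> C" "p \<noteq> w" "q \<noteq> C" "q \<noteq> w"
      using edgeD[OF pq(1)] pq(2) by auto
    have Awm: "det3 A w m < 0"
    proof -
      have "det3 A w m = (1 - \<tau>) * det3 A w C"
        unfolding blk(6) det3_def by (simp add: algebra_simps)
      then show ?thesis
        using blk(8) w_pos det3_swap'[of A w C] by (simp add: mult_pos_neg)
    qed
    have "p \<noteq> A"
    proof
      assume "p = A"
      then have "q \<in> nb A" "q \<noteq> C"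
        using pq(1) S by (auto simp: nb_def)
      then have "det3 A w q \<ge> 0"
        using first by blast
      moreover have "det3 A w m = l * det3 A w q"
        unfolding pq(4) \<open>p = A\<close> det3_def by (simp add: algebra_simps)
      ultimately show False
        using Awm pq(5) by (simp add: mult_less_0_iff)
    qed
    have ACp: "det3 A C p > 0"
      using side[of p] S \<open>p \<noteq> A\<close> by auto
    have "det3 A p w \<noteq> 0"
      using gp[of A p w] AC wS S \<open>p \<noteq> A\<close> by auto
    then have Apw: "det3 A p w < 0"
      using empty[OF S(1) ACp] pq(3) by (cases "det3 A p w > 0") auto
    then have Awp: "det3 A w p > 0"
      using det3_swap'[of A w p] by simp
    have "q \<noteq> A"
    proof
      assume "q = A"
      have "(1 - l) * det3 C w p + l * det3 C w q = det3 C w m"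
        unfolding pq(4) det3_def by (simp add: algebra_simps)
      moreover have "det3 C w q > 0"
        using \<open>q = A\<close> w_pos det3_rot[of A C w] det3_rot[of C w A] by simp
      ultimately show False
        using Cwm pq(3,5,6) by (smt (verit) mult_pos_pos)
    qed
    have "(1 - l) * det3 A w p + l * det3 A w q = det3 A w m"
      unfolding pq(4) det3_def by (simp add: algebra_simps)
    then have "l * det3 A w q < 0"
      using Awm Awp pq(6) by (smt (verit) mult_pos_pos)
    then have "det3 A w q < 0"
      using pq(5) by (simp add: mult_less_0_iff)
    then have "\<not> det3 A w p * det3 A w q > 0"
      using Awp by (simp add: zero_less_mult_iff)
    \<comment> \<open>\<open>p\<close> and \<open>q\<close> are on different sides of
      \<open>A w\<close>, so planarity puts \<open>A\<close> and \<open>w\<close> on one side of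
      \<open>p q\<close>; yet \<open>det3 p m A\<close> and \<open>det3 p m w\<close> turn out to
      have opposite signs.\<close>
    then have same: "det3 p q A * det3 p q w > 0"
      using noncross_det3[OF wS(4) pq(1)] \<open>p \<noteq> A\<close> \<open>q \<noteq> A\<close> S by auto
    have pm: "det3 p m A = l * det3 p q A" "det3 p m w = l * det3 p q w"
      unfolding pq(4) det3_def by (simp_all add: algebra_simps)
    have "det3 p m A = - ((1 - \<tau>) * det3 A C p) * 1 + \<tau> * det3 A p w * 1"
      unfolding blk(6) by (simp add: det3_def algebra_simps)
    then have "det3 p m A = (1 - \<tau>) * det3 A p C + \<tau> * det3 A p w"
      by (simp add: det3_swap'[of A p C])
    moreover have "det3 A p C < 0"
      using ACp det3_swap'[of A p C] by simp
    ultimately have "det3 p m A < 0"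
      using Apw blk(7,8) by (smt (verit) mult_pos_neg)
    moreover have "det3 p m w = (1 - \<tau>) * det3 C w p"
      unfolding blk(6) by (simp add: det3_def algebra_simps)
    then have "det3 p m w > 0"
      using pq(3) blk(8) by simp
    ultimately show False
      using same pq(5) unfolding pm by (auto simp: zero_less_mult_iff mult_less_0_iff)
  qed
  then show ?thesis
    using that[of w] w(1) first by (auto simp: nb_def)
qed

end

section \<open>Concentrating the weights\<close>

context surrounded_plane_graph
begin

lemma outer_subset: "outer \<subseteq> S"
  by (auto simp: outer_def)

text \<open>A maximum above all outer vertices would be attained on an inner set that balance makes
  closed under taking neighbours.\<close>

lemma balanced_max_principle:
  assumes bal: "balanced w p" and fixed: "\<And>h. h \<in> outer \<Longrightarrow> p h = h" and "u \<in> inner"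
  shows "\<exists>h\<in>outer. g \<bullet> p u \<le> g \<bullet> h"
proof (rule ccontr)
  assume neg: "\<not> ?thesis"
  define M where "M = (\<lambda>y. g \<bullet> p y) ` inner"
  have M: "finite M" "M \<noteq> {}"
    using finS \<open>u \<in> inner\<close> by (auto simp: M_def inner_def)
  obtain m where "m \<in> inner" and m_eq: "Max M = g \<bullet> p m"
    using Max_in[OF M] unfolding M_def by blast
  then have m: "m \<in> inner" "\<And>y. y \<in> inner \<Longrightarrow> g \<bullet> p y \<le> g \<bullet> p m"
    using Max_ge[OF M(1)] unfolding M_def by simp_all
  have out: "g \<bullet> h < g \<bullet> p m" if "h \<in> outer" for h
    using neg that m(2)[OF \<open>u \<in> inner\<close>] by force
  have max: "g \<bullet> p x \<le> g \<bullet> p m" if "x \<in> S" for x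
    using that m(2) out fixed by (cases "x \<in> outer") (auto simp: inner_def less_imp_le)
  define Y where "Y = {y \<in> inner. g \<bullet> p y = g \<bullet> p m}"
  have "nb y \<subseteq> Y \<union> {m, m}" if y: "y \<in> Y" for y
  proof
    fix x assume x: "x \<in> nb y"
    have yi: "y \<in> inner" "g \<bullet> p y = g \<bullet> p m"
      using y by (simp_all add: Y_def)
    have "(- g) \<bullet> (p x' - p y) \<ge> 0" if "x' \<in> nb y" for x'
      using max[of x'] nbD(2)[OF that] yi by (simp add: inner_diff_right)
    from balanced_one_sided[OF bal yi(1) this x]
    have eq: "g \<bullet> p x = g \<bullet> p m"
      using yi(2) by (simp add: inner_diff_right)
    then have "x \<notin> outer"
      using out[of x] fixed[of x] by auto
    then show "x \<in> Y \<union> {m, m}"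
      using eq nbD(2)[OF x] by (simp add: Y_def inner_def)
  qed
  moreover have "Y \<subseteq> inner" "m \<in> Y"
    using m by (auto simp: Y_def)
  ultimately show False
    using inner_set_boundary[of Y m m] by blast
qed

text \<open>One bound for all weights, so drawings stay bounded while the weights
  degenerate.\<close>

lemma balanced_bounded:
  obtains B where "\<And>w p u. balanced w p \<Longrightarrow> (\<And>h. h \<in> outer \<Longrightarrow> p h = h) \<Longrightarrow> u \<in> S \<Longrightarrow> norm (p u) \<le> B"
proof -
  define R where "R = (\<Sum>h\<in>outer. norm h)"
  have finO: "finite outer"
    by (rule finite_subset[OF outer_subset finS])
  have R: "norm h \<le> R" if "h \<in> outer" for h
    unfolding R_def using finO that by (simp add: member_le_sum)
  have "norm (p u) \<le> 2 * R"
    if "balanced w p" and fixed: "\<forall>h\<in>outer. p h = h" and "u \<in> S" for w p u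
  proof -
    have dir: "g \<bullet> p u \<le> R" if g: "norm g \<le> 1" for g
    proof -
      obtain h where h: "h \<in> outer" "g \<bullet> p u \<le> g \<bullet> h"
      proof (cases "u \<in> outer")
        case True
        then show thesis
          using bspec[OF fixed True] by (intro that[of u]) simp_all
      next
        case False
        then show thesis
          using balanced_max_principle[OF \<open>balanced w p\<close> bspec[OF fixed], of u g] \<open>u \<in> S\<close> False that
          unfolding inner_def by blast
      qed
      have "g \<bullet> h \<le> norm g * norm h"
        by (rule norm_cauchy_schwarz)
      also have "\<dots> \<le> norm h"
        using mult_right_mono[OF g, of "norm h"] by simp
      finally show ?thesis
        using h R[OF h(1)] by linarith
    qed
    have "\<bar>fst (p u)\<bar> \<le> R" "\<bar>snd (p u)\<bar> \<le> R"
      using dir[of "(1, 0)"] dir[of "(-1, 0)"] dir[of "(0, 1)"] dir[of "(0, -1)"]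
      by (auto simp: inner_prod_def norm_prod_def abs_le_iff)
    moreover have "norm (p u) \<le> \<bar>fst (p u)\<bar> + \<bar>snd (p u)\<bar>"
      using norm_Pair_le[of "fst (p u)" "snd (p u)"] by simp
    ultimately show ?thesis
      by linarith
  qed
  then show ?thesis
    using that by blast
qed

text \<open>The connected component of \<open>u\<close> in the graph induced on \<open>R\<close>.
  Both ends of a step must lie in \<open>R\<close>; for \<open>u\<close> outside \<open>R\<close>
  only \<open>u\<close> itself is obtained.\<close>

definition component :: "point set \<Rightarrow> point \<Rightarrow> point set" where
  "component R u = {v. (u, v) \<in> {(x, y). x \<in> R \<and> y \<in> R \<and> y \<in> nb x}\<^sup>*}"

lemma component_refl: "u \<in> component R u"
  by (simp add: component_def)

lemma component_subset: "u \<in> R \<Longrightarrow> component R u \<subseteq> R"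
  unfolding component_def by (auto elim: rtranclE)

lemma component_step:
  "u \<in> R \<Longrightarrow> x \<in> component R u \<Longrightarrow> y \<in> nb x \<Longrightarrow> y \<in> R \<Longrightarrow> y \<in> component R u"
  using component_subset[of u R] unfolding component_def
  by (auto intro: rtrancl.rtrancl_into_rtrancl)

lemma component_induct [consumes 1, case_names refl step]:
  assumes "v \<in> component R u" "P u"
    "\<And>x y. x \<in> component R u \<Longrightarrow> x \<in> R \<Longrightarrow> y \<in> R \<Longrightarrow> y \<in> nb x \<Longrightarrow> P x \<Longrightarrow> P y"
  shows "P v"
  using assms(1) unfolding component_def mem_Collect_eq
  by (induction rule: rtrancl_induct) (use assms(2,3) in \<open>auto simp: component_def\<close>)

lemma component_sym: "v \<in> component R u \<Longrightarrow> u \<in> component R v"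
proof (induction rule: component_induct)
  case (step x y)
  then have "(y, x) \<in> {(x, y). x \<in> R \<and> y \<in> R \<and> y \<in> nb x}"
    using nb_sym by simp
  then show ?case
    using step.IH unfolding component_def by (auto intro: converse_rtrancl_into_rtrancl)
qed (rule component_refl)

lemma component_trans: "v \<in> component R u \<Longrightarrow> w \<in> component R v \<Longrightarrow> w \<in> component R u"
  unfolding component_def by auto

lemma component_eq: "v \<in> component R u \<Longrightarrow> component R v = component R u"
  using component_sym component_trans by blast

lemma component_avoiding:
  assumes "v \<in> component R u" "u \<in> R'" "component R u \<inter> R \<subseteq> R'"
  shows "v \<in> component R' u"
  using assms(1)
proof (induction rule: component_induct)
  case (step x y)
  have "y \<in> component R u"
    using step by (auto simp: component_def intro: rtrancl.rtrancl_into_rtrancl)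
  then show ?case
    using component_step[of u R' x y] step assms(2,3) by blast
qed (rule component_refl)

text \<open>\<open>d\<close> is the breadth-first distance from \<open>u\<close>. It serves as the
  rank that directs weights along a spanning tree towards \<open>u\<close>.\<close>

lemma component_distance:
  obtains d :: "point \<Rightarrow> nat" where
    "\<And>v. v \<in> component R u \<Longrightarrow> v \<noteq> u \<Longrightarrow> \<exists>x\<in>nb v. x \<in> component R u \<and> d x < d v"
proof -
  define r where "r = {(x, y). x \<in> R \<and> y \<in> R \<and> y \<in> nb x}"
  define d where "d v = (LEAST n. (u, v) \<in> r ^^ n)" for v
  have "\<exists>x\<in>nb v. x \<in> component R u \<and> d x < d v" if v: "v \<in> component R u" "v \<noteq> u" for v
  proof -
    have "\<exists>n. (u, v) \<in> r ^^ n"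
      using v(1) unfolding component_def r_def[symmetric] by (simp add: rtrancl_power)
    then have dv: "(u, v) \<in> r ^^ d v"
      unfolding d_def by (rule LeastI_ex)
    then obtain m where m: "d v = Suc m"
      using v(2) by (cases "d v") auto
    then obtain x where x: "(u, x) \<in> r ^^ m" "(x, v) \<in> r"
      using dv by auto
    have "d x \<le> m"
      unfolding d_def using x(1) by (rule Least_le)
    moreover have "x \<in> component R u"
      using x(1) unfolding component_def r_def[symmetric] by (auto simp: rtrancl_power)
    moreover have "x \<in> nb v"
      using x(2) nb_sym by (simp add: r_def)
    ultimately show ?thesis
      using m by (intro bexI[of _ x]) simp_all
  qed
  then show ?thesis
    using that by blast
qed

end

context rigid_graph
begin

text \<open>Put weight 1 on the edge from each \<^term>\<open>u \<in> K\<close> towards its target and weight $1/(n+1)$ on all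
  other edges: in the limit the points of \<^term>\<open>K\<close> collapse to their targets.\<close>

lemma concentrate:
  fixes d :: "point \<Rightarrow> nat"
  assumes K: "K \<subseteq> inner"
    and next_hop: "\<And>u. u \<in> K \<Longrightarrow> \<exists>v\<in>nb u. v \<in> outer \<and> f u = v \<or> v \<in> K \<and> d v < d u \<and> f v = f u"
  shows "weak_type (K \<union> outer) (\<lambda>x. if x \<in> K then f x else x)"
proof -
  have "\<forall>u\<in>K. \<exists>v. v \<in> nb u \<and> (v \<in> outer \<and> f u = v \<or> v \<in> K \<and> d v < d u \<and> f v = f u)"
    using next_hop by blast
  from bchoice[OF this] obtain \<nu> where \<nu>: "\<And>u. u \<in> K \<Longrightarrow> \<nu> u \<in> nb u"
    "\<And>u. u \<in> K \<Longrightarrow> \<nu> u \<in> outer \<and> f u = \<nu> u \<or> \<nu> u \<in> K \<and> d (\<nu> u) < d u \<and> f (\<nu> u) = f u"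
    by blast
  define \<eta> where "\<eta> n = inverse (real (Suc n))" for n
  have \<eta>: "\<eta> n > 0" for n
    by (simp add: \<eta>_def)
  define W where "W n u x = (if x = \<nu> u then 1 else \<eta> n)" for n u x
  have "\<exists>p. same_type S p \<and> (\<forall>h\<in>outer. p h = h) \<and> balanced (W n) p" for n
  proof -
    have "positive (W n)"
      using \<eta> by (simp add: positive_def W_def)
    then show ?thesis
      using balanced_drawing_exists[of "W n"] by metis
  qed
  then obtain p where p: "\<And>n. same_type S (p n)" "\<And>n h. h \<in> outer \<Longrightarrow> p n h = h" "\<And>n. balanced (W n) (p n)"
    by metis
  obtain B where B: "\<And>w p u. balanced w p \<Longrightarrow> (\<And>h. h \<in> outer \<Longrightarrow> p h = h) \<Longrightarrow> u \<in> S \<Longrightarrow> norm (p u) \<le> B"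
    using balanced_bounded by blast
  have B: "norm (p n u) \<le> B" if "u \<in> S" for n u
    by (rule B[OF p(3) p(2) that])
  have KS: "u \<in> S" "u \<in> inner" if "u \<in> K" for u
    using subsetD[OF K that] inner_S by blast+
  \<comment> \<open>Balance at \<open>u\<close>, with weight 1 on \<open>\<nu> u\<close> and
    \<open>\<eta> n\<close> on all other edges, makes the distance between \<open>u\<close> and
    \<open>\<nu> u\<close> at most \<open>\<eta> n\<close> times a constant.\<close>
  have gap: "(\<lambda>n. p n (\<nu> u) - p n u) \<longlonglongrightarrow> 0" if u: "u \<in> K" for u
  proof (rule Lim_null_comparison)
    define C where "C = real (card (nb u - {\<nu> u})) * (2 * B)"
    show "\<forall>\<^sub>F n in sequentially. norm (p n (\<nu> u) - p n u) \<le> \<eta> n * C"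
    proof (rule always_eventually, rule allI)
      fix n
      have "0 = (\<Sum>x\<in>nb u. W n u x *\<^sub>R (p n x - p n u))"
        using p(3)[of n] KS(2)[OF u] by (simp add: balanced_def)
      also have "\<dots> = (p n (\<nu> u) - p n u) + (\<Sum>x\<in>nb u - {\<nu> u}. \<eta> n *\<^sub>R (p n x - p n u))"
        by (subst sum.remove[OF finite_nb \<nu>(1)[OF u]]) (simp add: W_def)
      finally have "p n (\<nu> u) - p n u = - (\<Sum>x\<in>nb u - {\<nu> u}. \<eta> n *\<^sub>R (p n x - p n u))"
        by (simp add: eq_neg_iff_add_eq_0)
      then have "norm (p n (\<nu> u) - p n u) \<le> (\<Sum>x\<in>nb u - {\<nu> u}. norm (\<eta> n *\<^sub>R (p n x - p n u)))"
        by (simp add: norm_sum del: norm_scaleR)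
      also have "\<dots> \<le> (\<Sum>x\<in>nb u - {\<nu> u}. \<eta> n * (2 * B))"
      proof (rule sum_mono)
        fix x assume "x \<in> nb u - {\<nu> u}"
        then have "norm (p n x) \<le> B" "norm (p n u) \<le> B"
          using B[OF nbD(2)] B[OF KS(1)[OF u]] by blast+
        then have "norm (p n x - p n u) \<le> 2 * B"
          using norm_triangle_ineq4[of "p n x" "p n u"] by linarith
        then show "norm (\<eta> n *\<^sub>R (p n x - p n u)) \<le> \<eta> n * (2 * B)"
          using \<eta>[of n] by simp
      qed
      also have "\<dots> = \<eta> n * C"
        by (simp add: C_def)
      finally show "norm (p n (\<nu> u) - p n u) \<le> \<eta> n * C" .
    qed
    have "(\<lambda>n. \<eta> n) \<longlonglongrightarrow> 0"
      unfolding \<eta>_def by (rule LIMSEQ_inverse_real_of_nat)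
    then show "(\<lambda>n. \<eta> n * C) \<longlonglongrightarrow> 0"
      by (rule tendsto_mult_left_zero)
  qed
  \<comment> \<open>The gaps close along the chain of hops, which descends in \<open>d\<close> until
    it reaches an outer vertex.\<close>
  have lim_K: "(\<lambda>n. p n u) \<longlonglongrightarrow> f u" if "u \<in> K" for u
    using that
  proof (induction "d u" arbitrary: u rule: less_induct)
    case less
    have "(\<lambda>n. p n (\<nu> u)) \<longlonglongrightarrow> f u"
      using \<nu>(2)[OF less.prems]
    proof
      assume "\<nu> u \<in> outer \<and> f u = \<nu> u"
      then show ?thesis
        using p(2) by simp
    next
      assume "\<nu> u \<in> K \<and> d (\<nu> u) < d u \<and> f (\<nu> u) = f u"
      then show ?thesis
        using less.hyps[of "\<nu> u"] by simp
    qed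
    from tendsto_diff[OF this gap[OF less.prems]] show ?case
      by simp
  qed
  define l where "l x = (if x \<in> K then f x else x)" for x
  have lim: "(\<lambda>n. p n x) \<longlonglongrightarrow> l x" if "x \<in> K \<union> outer" for x
    using lim_K[of x] p(2)[of x] that by (cases "x \<in> K") (simp_all add: l_def)
  have "weak_type (K \<union> outer) l"
    unfolding weak_type_def
  proof (intro ballI impI)
    fix a b c assume in_K: "a \<in> K \<union> outer" "b \<in> K \<union> outer" "c \<in> K \<union> outer" and ne: "a \<noteq> b" "a \<noteq> c" "b \<noteq> c"
    have S: "a \<in> S" "b \<in> S" "c \<in> S"
      using in_K KS(1) outer_subset by blast+
    have "(\<lambda>n. det3 a b c * det3 (p n a) (p n b) (p n c)) \<longlonglongrightarrow> det3 a b c * det3 (l a) (l b) (l c)"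
      unfolding det3_def by (intro tendsto_intros lim in_K)
    then show "det3 a b c * det3 (l a) (l b) (l c) \<ge> 0"
      using same_typeD[OF p(1) S ne] by (intro LIMSEQ_le_const) (auto intro: less_imp_le)
  qed
  then show ?thesis
    unfolding l_def .
qed

text \<open>The component is pulled along a breadth-first tree to its root \<open>y\<close> and from
  there to \<open>X\<close>; every vertex of \<open>Q\<close> goes straight to
  \<open>Z\<close>.\<close>

lemma concentrate_component:
  assumes "R \<subseteq> inner" "u \<in> R" "y \<in> component R u" "X \<in> nb y" "X \<in> outer"
    and Q: "Q \<subseteq> inner" "Q \<inter> component R u = {}" "\<And>q. q \<in> Q \<Longrightarrow> Z \<in> nb q" "Z \<in> outer"
  shows "weak_type (component R u \<union> Q \<union> outer)
    (\<lambda>x. if x \<in> component R u then X else if x \<in> Q then Z else x)"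
proof -
  have cy: "component R u = component R y"
    using component_eq[OF assms(3)] by simp
  obtain d :: "point \<Rightarrow> nat" where
    d: "\<And>v. v \<in> component R y \<Longrightarrow> v \<noteq> y \<Longrightarrow> \<exists>x\<in>nb v. x \<in> component R y \<and> d x < d v"
    using component_distance by blast
  define f where "f x = (if x \<in> component R u then X else Z)" for x
  have "weak_type (component R u \<union> Q \<union> outer) (\<lambda>x. if x \<in> component R u \<union> Q then f x else x)"
  proof (rule concentrate[where d = d])
    show "component R u \<union> Q \<subseteq> inner"
      using component_subset[OF assms(2)] assms(1) Q(1) by blast
    fix v assume v: "v \<in> component R u \<union> Q"
    show "\<exists>x\<in>nb v. x \<in> outer \<and> f v = x \<or> x \<in> component R u \<union> Q \<and> d x < d v \<and> f x = f v"
    proof (cases "v \<in> component R u")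
      case True
      then show ?thesis
        using d[of v] assms(4,5) by (cases "v = y") (auto simp: f_def cy)
    next
      case False
      then have "v \<in> Q" "Z \<in> nb v"
        using v Q(3) by blast+
      then show ?thesis
        using False Q(4) by (intro bexI[of _ Z]) (simp_all add: f_def)
    qed
  qed
  moreover have "(\<lambda>x. if x \<in> component R u \<union> Q then f x else x)
      = (\<lambda>x. if x \<in> component R u then X else if x \<in> Q then Z else x)"
    by (auto simp: f_def fun_eq_iff)
  ultimately show ?thesis
    by simp
qed

end

section \<open>Triangular convex hull\<close>

locale maximal_supporting_graph = supporting_plane_graph + maximal_plane_graph

sublocale maximal_supporting_graph \<subseteq> rigid_graph ..

text \<open>The product of the three left-hand sides is minus the square of a nonzero number, so at
  least one of them is negative.\<close>

lemma separating_line: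
  assumes "det3 c x y \<noteq> 0" "det3 c y z \<noteq> 0" "det3 c z x \<noteq> 0"
  shows "det3 c x y * det3 c x z < 0 \<or> det3 c y x * det3 c y z < 0 \<or> det3 c z x * det3 c z y < 0"
proof -
  have "p * - r < 0 \<or> - p * q < 0 \<or> r * - q < 0" if "p \<noteq> 0" "q \<noteq> 0" "r \<noteq> 0" for p q r :: real
  proof (rule ccontr)
    assume "\<not> ?thesis"
    then have "p * r \<le> 0" "p * q \<le> 0" "r * q \<le> 0"
      by auto
    then show False
      using that by (auto simp: mult_le_0_iff)
  qed
  from this[OF assms] show ?thesis
    by (simp add: det3_swap'[of c x y] det3_swap'[of c y z] det3_swap'[of c x z])
qed

lemma three_elements:
  assumes "\<And>e e'. \<not> B \<subseteq> {e, e'}"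
  obtains x y z where "x \<in> B" "y \<in> B" "z \<in> B" "x \<noteq> y" "x \<noteq> z" "y \<noteq> z"
proof -
  obtain x where "x \<in> B"
    using assms[of undefined undefined] by blast
  moreover obtain y where "y \<in> B" "y \<noteq> x"
    using assms[of x x] by blast
  moreover obtain z where "z \<in> B" "z \<noteq> x" "z \<noteq> y"
    using assms[of x y] by blast
  ultimately show ?thesis
    using that by metis
qed

context maximal_supporting_graph
begin

lemmas outer_S = subsetD[OF outer_subset]

lemma S_cases: "s \<in> S \<Longrightarrow> s \<in> outer \<or> s \<in> inner"
  by (simp add: inner_def)

lemma inner_not_outer: "s \<in> inner \<Longrightarrow> s \<notin> outer"
  by (simp add: inner_def)

text \<open>A component of inner vertices is adjacent to at least three outer vertices, and a fourth
  one is \<open>c\<close>. One of the lines from \<open>c\<close> to the three separates the other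
  two; collapsing the component to each of these in turn requires incompatible orientations of
  \<open>u\<close> relative to that line.\<close>

lemma inner_empty_if_many_outer:
  assumes "card outer \<ge> 4"
  shows "inner = {}"
proof (rule ccontr)
  assume "inner \<noteq> {}"
  then obtain u where u: "u \<in> inner"
    by blast
  define Y where "Y = component inner u"
  define B where "B = {h \<in> outer. \<exists>y\<in>Y. h \<in> nb y}"
  have Y: "Y \<subseteq> inner" "u \<in> Y"
    unfolding Y_def using component_subset[OF u] component_refl by auto
  have "nb y \<subseteq> Y \<union> B" if "y \<in> Y" for y
    using that component_step[OF u, of y] nbD(2) S_cases unfolding Y_def[symmetric] B_def by blast
  then have "\<not> B \<subseteq> {e, e'}" for e e'
    using inner_set_boundary[of Y e e'] Y by blast
  then obtain b1 b2 b3 where b: "b1 \<in> B" "b2 \<in> B" "b3 \<in> B" "b1 \<noteq> b2" "b1 \<noteq> b3" "b2 \<noteq> b3"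
    using three_elements by metis
  have "finite outer"
    using finS by (simp add: outer_def)
  have "card {b1, b2, b3} < card outer"
    using b assms by simp
  then have "\<not> outer \<subseteq> {b1, b2, b3}"
    using card_mono[of "{b1, b2, b3}" outer] by auto
  then obtain c where c: "c \<in> outer" "c \<noteq> b1" "c \<noteq> b2" "c \<noteq> b3"
    by blast
  have pull: "det3 a b u * det3 a b x \<ge> 0" if ab: "a \<in> outer" "b \<in> outer" "a \<noteq> b" and x: "x \<in> B" for a b x
  proof -
    obtain y where y: "y \<in> Y" "x \<in> nb y" "x \<in> outer"
      using x by (auto simp: B_def)
    have wt: "weak_type (component inner u \<union> {} \<union> outer) (\<lambda>v. if v \<in> component inner u then x else if v \<in> {} then x else v)"
      by (rule concentrate_component[OF order_refl u]) (use y in \<open>auto simp: Y_def\<close>)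
    have not_Y: "a \<notin> component inner u" "b \<notin> component inner u"
      using Y(1) ab inner_not_outer unfolding Y_def by blast+
    show ?thesis
      using weak_typeD[OF wt, of a b u] ab not_Y component_refl[of u inner] by auto
  qed
  have final: False if xyz: "x \<in> B" "y \<in> B" "z \<in> B" "c \<noteq> x" and neg: "det3 c x y * det3 c x z < 0" for x y z
  proof -
    have x: "x \<in> outer"
      using xyz(1) by (simp add: B_def)
    have "det3 c x u \<noteq> 0"
      using gp[of c x u] x c(1) outer_S inner_S[OF u] xyz(4) inner_not_outer[OF u] by metis
    moreover have "det3 c x u * det3 c x y \<ge> 0" "det3 c x u * det3 c x z \<ge> 0"
      using pull[OF c(1) x xyz(4)] xyz by auto
    ultimately show False
      using neg by (auto simp: zero_le_mult_iff mult_less_0_iff)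
  qed
  have bS: "b1 \<in> S" "b2 \<in> S" "b3 \<in> S" "c \<in> S"
    using b(1-3) c outer_S by (auto simp: B_def)
  have "det3 c b1 b2 \<noteq> 0" "det3 c b2 b3 \<noteq> 0" "det3 c b3 b1 \<noteq> 0"
    using gp[of c b1 b2] gp[of c b2 b3] gp[of c b3 b1] bS b(4-6) c(2-4) by auto
  then show False
    using separating_line[of c b1 b2 b3] final[of b1 b2 b3] final[of b2 b1 b3] final[of b3 b1 b2] b c
    by blast
qed

text \<open>Both \<open>z\<close> and the component of \<open>u\<close> can be collapsed to
  \<open>X\<close> as well as to \<open>Y\<close>. Sending them to different ones in the two
  possible ways gives the limits \<open>Z X Y\<close> and \<open>Z Y X\<close> for the same triple
  \<open>Z u z\<close>, with opposite orientations.\<close>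

lemma no_detour:
  assumes z: "z \<in> inner" "X \<in> nb z" "Y \<in> nb z"
    and XYZ: "X \<in> outer" "Y \<in> outer" "Z \<in> outer" "X \<noteq> Y" "X \<noteq> Z" "Y \<noteq> Z"
    and u: "u \<in> inner" "u \<noteq> z"
    and x: "x \<in> component (inner - {z}) u" "X \<in> nb x" and y: "y \<in> component (inner - {z}) u" "Y \<in> nb y"
  shows False
proof -
  define K where "K = component (inner - {z}) u"
  have u': "u \<in> inner - {z}"
    using u by simp
  have K: "K \<subseteq> inner - {z}" "u \<in> K"
    unfolding K_def using component_subset[OF u'] component_refl by auto
  have "det3 Z u z \<noteq> 0"
    using gp[of Z u z] u z(1) XYZ(3) outer_S inner_S inner_not_outer by metis
  have "det3 Z X Y \<noteq> 0"
    using gp[of Z X Y] XYZ outer_S by metis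
  have pull: "det3 Z u z * det3 Z P Q \<ge> 0"
    if "v \<in> K" "P \<in> nb v" "P \<in> outer" "Q \<in> nb z" "Q \<in> outer" for P Q v
  proof -
    have wt: "weak_type (component (inner - {z}) u \<union> {z} \<union> outer)
      (\<lambda>x. if x \<in> component (inner - {z}) u then P else if x \<in> {z} then Q else x)"
      by (rule concentrate_component[OF Diff_subset u', of v])
        (use that z(1) K(1) in \<open>auto simp: K_def\<close>)
    have "Z \<notin> K" "Z \<noteq> z" "z \<notin> K" "Z \<noteq> u"
      using K XYZ(3) inner_not_outer z(1) u by blast+
    then show ?thesis
      using weak_typeD[OF wt, of Z u z] XYZ(3) K(2) u(2) unfolding K_def[symmetric] by simp
  qed
  have "det3 Z u z * det3 Z X Y \<ge> 0" "det3 Z u z * det3 Z Y X \<ge> 0"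
    using pull[of x X Y] pull[of y Y X] x y z XYZ unfolding K_def by auto
  then show False
    using \<open>det3 Z u z \<noteq> 0\<close> \<open>det3 Z X Y \<noteq> 0\<close> det3_swap'[of Z X Y] by (auto simp: zero_le_mult_iff)
qed

text \<open>Otherwise \<open>e\<close> and \<open>e'\<close> would be the only exits of the
  component.\<close>

lemma component_boundary:
  assumes u: "u \<in> inner" "u \<noteq> z"
  obtains x k where "x \<in> component (inner - {z}) u" "k \<in> nb x" "k \<noteq> e" "k \<noteq> e'" "k = z \<or> k \<in> outer"
proof -
  define K where "K = component (inner - {z}) u"
  have u': "u \<in> inner - {z}"
    using u by simp
  have K: "K \<subseteq> inner" "u \<in> K"
    unfolding K_def using component_subset[OF u'] component_refl by auto
  then obtain x k where x: "x \<in> K" "k \<in> nb x" "k \<notin> K" "k \<noteq> e" "k \<noteq> e'"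
    using inner_set_boundary[of K e e'] by blast
  moreover have "k = z \<or> k \<in> outer"
    using x component_step[OF u', of x k] nbD(2)[OF x(2)] S_cases unfolding K_def[symmetric] by blast
  ultimately show ?thesis
    using that unfolding K_def by blast
qed

end

locale triangular_graph = maximal_supporting_graph +
  fixes A B C :: point
  assumes hull: "outer = {A, B, C}" and ccw: "det3 A B C > 0" and two_inner: "card inner \<ge> 2"
begin

lemma hull_distinct: "A \<noteq> B" "A \<noteq> C" "B \<noteq> C"
  using ccw by auto

lemma hull_S: "A \<in> S" "B \<in> S" "C \<in> S"
  using hull outer_S by blast+

lemma rotated: "triangular_graph S T B C A"
  by unfold_locales (use hull ccw two_inner det3_rot[of B C A] in auto)

text \<open>An inner vertex cannot minimise the affine function \<open>det3 A B\<close>, since one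
  of its neighbours is lower; so the minimum is attained at \<open>A\<close>, \<open>B\<close> or
  \<open>C\<close>.\<close>

lemma hull_side:
  assumes "s \<in> S" "s \<noteq> A" "s \<noteq> B"
  shows "det3 A B s > 0"
proof -
  define g where "g = (snd A - snd B, fst B - fst A)"
  have g: "g \<bullet> y - g \<bullet> x = det3 A B y - det3 A B x" for x y
    by (simp add: g_def inner_prod_def det3_def algebra_simps)
  have "g \<noteq> 0"
    using hull_distinct(1) by (auto simp: g_def prod_eq_iff)
  define M where "M = (\<lambda>x. det3 A B x) ` S"
  have M: "finite M" "M \<noteq> {}"
    using finS assms(1) by (auto simp: M_def)
  obtain m where m: "m \<in> S" "Min M = det3 A B m"
    using Min_in[OF M] unfolding M_def by blast
  then have min: "det3 A B m \<le> det3 A B x" if "x \<in> S" for x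
    using Min_le[OF M(1)] that unfolding M_def by simp
  have "det3 A B m \<ge> 0"
  proof (cases "m \<in> inner")
    case True
    then obtain x where "x \<in> nb m" "- g \<bullet> x > - g \<bullet> m"
      using surrounded[of m "- g"] \<open>g \<noteq> 0\<close> by auto
    then show ?thesis
      using min[OF nbD(2)[OF \<open>x \<in> nb m\<close>]] g[of m x] by simp
  next
    case False
    then have "m \<in> {A, B, C}"
      using S_cases[OF m(1)] hull by simp
    then show ?thesis
      using ccw by auto
  qed
  then show ?thesis
    using min[OF assms(1)] gp[OF hull_S(1,2) assms(1)] hull_distinct assms(2,3) by force
qed

lemma inner_neighbour: obtains x where "x \<in> inner" "x \<in> nb A"
proof -
  have "inner \<noteq> {}"
    using two_inner by auto
  then obtain u x where "u \<in> inner" "x \<in> nb u" "x \<notin> inner \<union> {B, C}"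
    using inner_set_boundary[of inner B C] by blast
  moreover have "x = A"
    using calculation nbD(2) S_cases hull by blast
  ultimately show ?thesis
    using that nb_sym by blast
qed

text \<open>The apex of the hull edge \<open>A B\<close> is not \<open>C\<close>, for then an inner
  neighbour of \<open>A\<close> would have to lie beyond the hull edge \<open>C A\<close>.\<close>

lemma apex: obtains y where "y \<in> inner" "A \<in> nb y" "B \<in> nb y"
proof -
  obtain x where x: "x \<in> inner" "x \<in> nb A"
    by (rule inner_neighbour)
  have x_hull: "x \<noteq> A" "x \<noteq> B" "x \<noteq> C"
    using inner_not_outer[OF x(1)] hull by auto
  then have "nb A - {B} \<noteq> {}"
    using x(2) by blast
  then obtain w where w: "w \<in> nb A" "w \<in> nb B" "\<And>v. v \<in> nb A \<Longrightarrow> v \<noteq> B \<Longrightarrow> det3 A w v \<ge> 0"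
    using hull_edge_apex[OF hull_S(1,2) hull_distinct(1) hull_side] by blast
  interpret CAB: triangular_graph S T C A B
    using triangular_graph.rotated[OF rotated] .
  have "w \<noteq> C"
  proof
    assume "w = C"
    then have "det3 A C x \<ge> 0"
      using w(3)[OF x(2)] x_hull by simp
    moreover have "det3 C A x > 0"
      using CAB.hull_side[OF inner_S[OF x(1)]] x_hull by simp
    ultimately show False
      using det3_swap[of A C x] by simp
  qed
  moreover have "w \<in> S" "w \<noteq> A" "w \<noteq> B"
    using nbD w by blast+
  ultimately have "w \<in> inner"
    using S_cases hull by blast
  then show ?thesis
    using that w(1,2) nb_sym by blast
qed

text \<open>The component of a second inner vertex, with \<open>z\<close> removed, is adjacent to
  two hull vertices; as \<open>z\<close> is adjacent to both, \<open>no_detour\<close>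
  applies.\<close>

lemma no_common_apex:
  assumes z: "z \<in> inner" "A \<in> nb z" "B \<in> nb z" "C \<in> nb z"
  shows False
proof -
  have "\<not> inner \<subseteq> {z}"
    using two_inner card_mono[of "{z}" inner] by auto
  then obtain u where u: "u \<in> inner" "u \<noteq> z"
    by blast
  obtain x k where x: "x \<in> component (inner - {z}) u" "k \<in> nb x" "k \<noteq> z" "k \<in> outer"
    using component_boundary[OF u, of z z] by metis
  obtain y k' where y: "y \<in> component (inner - {z}) u" "k' \<in> nb y" "k' \<noteq> k" "k' \<in> outer"
    using component_boundary[OF u, of z k] by metis
  obtain j where j: "j \<in> outer" "j \<noteq> k" "j \<noteq> k'"
    using hull hull_distinct by (metis insert_iff)
  have "k \<in> nb z" "k' \<in> nb z"
    using x(4) y(4) hull z by auto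
  then show False
    using no_detour[OF z(1) _ _ x(4) y(4) j(1) _ _ _ u x(1,2) y(1,2)] y(3) j(2,3) by metis
qed

text \<open>Let \<open>y\<close>, \<open>x\<close>, \<open>z\<close> be apexes over
  \<open>A B\<close>, \<open>B C\<close>, \<open>C A\<close>. The component \<open>K\<close> of
  \<open>y\<close> without \<open>z\<close> is not adjacent to \<open>C\<close>, by
  \<open>no_detour\<close> at \<open>z\<close>, so it misses \<open>x\<close>, and its exit other
  than \<open>A\<close> and \<open>B\<close> must be \<open>z\<close>. Thus \<open>y\<close> reaches
  \<open>z\<close> while avoiding \<open>x\<close>, which connects neighbours of \<open>B\<close>
  and of \<open>C\<close>, against \<open>no_detour\<close> at \<open>x\<close>.\<close>

lemma impossible: False
proof -
  have out: "A \<in> outer" "B \<in> outer" "C \<in> outer"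
    using hull by auto
  obtain y where y: "y \<in> inner" "A \<in> nb y" "B \<in> nb y"
    by (rule apex)
  obtain x where x: "x \<in> inner" "B \<in> nb x" "C \<in> nb x"
    by (rule triangular_graph.apex[OF rotated])
  obtain z where z: "z \<in> inner" "C \<in> nb z" "A \<in> nb z"
    by (rule triangular_graph.apex[OF triangular_graph.rotated[OF rotated]])
  have ne: "y \<noteq> z" "y \<noteq> x" "z \<noteq> x"
    using no_common_apex x y z by metis+
  define K where "K = component (inner - {z}) y"
  have "y \<in> K"
    unfolding K_def by (rule component_refl)
  have K: "K \<subseteq> inner - {z}"
    unfolding K_def using component_subset y(1) ne(1) by simp
  have no_C: "C \<notin> nb v" if "v \<in> K" for v
    using no_detour[OF z(1) z(3) z(2) out(1,3,2) _ _ _ y(1) ne(1), of y v] hull_distinct \<open>y \<in> K\<close> y(2) that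
    unfolding K_def by metis
  then have "x \<notin> K"
    using x(3) by blast
  obtain v where v: "v \<in> K" "z \<in> nb v"
    using component_boundary[OF y(1) ne(1), of A B] no_C hull unfolding K_def by (metis insert_iff empty_iff)
  have "v \<in> component (inner - {x}) y"
    by (rule component_avoiding[of v "inner - {z}"])
      (use v(1) K \<open>x \<notin> K\<close> y(1) ne(2) in \<open>auto simp: K_def\<close>)
  then have "z \<in> component (inner - {x}) y"
    using component_step[of y "inner - {x}" v z] y(1) z(1) ne v(2) by simp
  then show False
    using no_detour[OF x out(2,3,1) _ _ _ y(1) ne(2) component_refl y(3) _ z(2)] hull_distinct by metis
qed

end

section \<open>Convex position\<close>

context maximal_supporting_graph
begin

lemma exposed_not_in_triangle:
  assumes "h \<in> outer" "x \<in> S - {h}" "y \<in> S - {h}" "z \<in> S - {h}"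
    and pos: "\<alpha> > 0" "\<beta> > 0" "\<gamma> > 0"
    and eq: "(\<alpha> + \<beta> + \<gamma>) *\<^sub>R h = \<alpha> *\<^sub>R x + \<beta> *\<^sub>R y + \<gamma> *\<^sub>R z"
  shows False
proof -
  obtain g where g: "\<forall>s\<in>S - {h}. g \<bullet> s < g \<bullet> h"
    using assms(1) by (auto simp: outer_def)
  have "\<alpha> * (g \<bullet> x) < \<alpha> * (g \<bullet> h)" "\<beta> * (g \<bullet> y) < \<beta> * (g \<bullet> h)" "\<gamma> * (g \<bullet> z) < \<gamma> * (g \<bullet> h)"
    using bspec[OF g] assms(2-4) pos by simp_all
  moreover have "g \<bullet> ((\<alpha> + \<beta> + \<gamma>) *\<^sub>R h) = g \<bullet> (\<alpha> *\<^sub>R x + \<beta> *\<^sub>R y + \<gamma> *\<^sub>R z)"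
    by (simp only: eq)
  ultimately show False
    by (simp add: inner_add_right algebra_simps)
qed

text \<open>Up to sign the four determinants are the coefficients of the affine dependence of the
  points. A wrong sign of \<open>det3 c d a\<close> or \<open>det3 c d b\<close> would make
  \<open>a\<close> or \<open>b\<close> a convex combination of the other three.\<close>

lemma convex_quadrilateral:
  assumes out: "a \<in> outer" "b \<in> outer" "c \<in> outer" "d \<in> outer"
    and sep: "det3 a b c > 0" "det3 a b d < 0"
  shows "det3 c d a < 0" "det3 c d b > 0"
proof -
  have ne: "a \<noteq> b" "a \<noteq> c" "a \<noteq> d" "b \<noteq> c" "b \<noteq> d" "c \<noteq> d"
    using sep by auto
  note S = out[THEN outer_S]
  have nz: "det3 c d a \<noteq> 0" "det3 c d b \<noteq> 0"
    using gp[OF S(3,4,1)] gp[OF S(3,4,2)] ne by auto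
  have sum: "det3 c d b = det3 c d a - det3 a b d + det3 a b c"
    by (simp add: det3_def algebra_simps)
  have rel: "det3 c d b *\<^sub>R a = det3 c d a *\<^sub>R b - det3 a b d *\<^sub>R c + det3 a b c *\<^sub>R d"
    by (simp add: prod_eq_iff det3_def algebra_simps)
  have "\<not> det3 c d a > 0"
  proof
    assume "det3 c d a > 0"
    then show False
      using exposed_not_in_triangle[OF out(1), of b c d "det3 c d a" "- det3 a b d" "det3 a b c"]
        S ne sep rel sum by simp
  qed
  then show "det3 c d a < 0"
    using nz by simp
  have "\<not> det3 c d b < 0"
  proof
    assume "det3 c d b < 0"
    moreover have "(- det3 c d a) *\<^sub>R b = (- det3 c d b) *\<^sub>R a + (- det3 a b d) *\<^sub>R c + det3 a b c *\<^sub>R d"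
      using rel by (simp add: algebra_simps)
    ultimately show False
      using exposed_not_in_triangle[OF out(2), of a c d "- det3 c d b" "- det3 a b d" "det3 a b c"]
        S ne sep sum by simp
  qed
  then show "det3 c d b > 0"
    using nz by simp
qed

text \<open>Among exposed points, if one chord separates the ends of another, the separation is
  mutual, so the two edges would cross.\<close>

lemma separated_edges:
  assumes out: "a \<in> outer" "b \<in> outer" "c \<in> outer" "d \<in> outer"
    and sep: "det3 a b c * det3 a b d < 0" and e: "{a, b} \<in> T" "{c, d} \<in> T"
  shows False
proof -
  have ne: "{a, b} \<inter> {c, d} = {}"
    using sep by auto
  have "det3 c d a * det3 c d b < 0"
  proof (cases "det3 a b c > 0")
    case True
    then show ?thesis
      using convex_quadrilateral[OF out] sep by (simp add: mult_less_0_iff)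
  next
    case False
    then have "det3 a b d > 0" "det3 a b c < 0"
      using sep by (auto simp: mult_less_0_iff)
    then show ?thesis
      using convex_quadrilateral[OF out(1,2,4,3)] det3_swap[of c d] by (simp add: mult_less_0_iff)
  qed
  then show False
    using noncross_det3[OF e ne] sep by linarith
qed

text \<open>Of three chords at \<open>c\<close> one separates the far ends of the other two, and the
  edge joining these would cross it.\<close>

lemma convex_position_non_edge:
  assumes "inner = {}" "card S \<ge> 4"
  obtains a b where "a \<in> S" "b \<in> S" "a \<noteq> b" "{a, b} \<notin> T"
proof -
  have out: "outer = S"
    using assms(1) outer_subset by (auto simp: inner_def)
  have "S \<noteq> {}"
    using assms(2) by auto
  then obtain c where c: "c \<in> S"
    by blast
  have "\<not> S - {c} \<subseteq> {e, e'}" for e e'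
  proof
    assume "S - {c} \<subseteq> {e, e'}"
    then have "card S \<le> card {c, e, e'}"
      by (intro card_mono) auto
    also have "\<dots> \<le> 3"
      using card_insert_le_m1 by (simp add: card_insert_if)
    finally show False
      using assms(2) by simp
  qed
  then obtain x y z where xyz: "x \<in> S - {c}" "y \<in> S - {c}" "z \<in> S - {c}" "x \<noteq> y" "x \<noteq> z" "y \<noteq> z"
    using three_elements by metis
  have "\<exists>a b. a \<in> S \<and> b \<in> S \<and> a \<noteq> b \<and> {a, b} \<notin> T"
  proof (rule ccontr)
    assume "\<not> ?thesis"
    then have all: "\<And>a b. a \<in> S \<Longrightarrow> b \<in> S \<Longrightarrow> a \<noteq> b \<Longrightarrow> {a, b} \<in> T"
      by blast
    have no: "\<not> det3 c p q * det3 c p r < 0" if "p \<in> S - {c}" "q \<in> S - {c}" "r \<in> S - {c}" "q \<noteq> r" for p q r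
      using separated_edges[of c p q r] all[of c p] all[of q r] that c out by auto
    have "det3 c x y \<noteq> 0" "det3 c y z \<noteq> 0" "det3 c z x \<noteq> 0"
      using gp[of c x y] gp[of c y z] gp[of c z x] xyz c by auto
    then show False
      using separating_line[of c x y z] no[of x y z] no[of y x z] no[of z x y] xyz by blast
  qed
  then show ?thesis
    using that by blast
qed

definition left :: "point \<Rightarrow> point \<Rightarrow> point set" where
  "left a b = {s \<in> S. det3 a b s > 0}"

text \<open>Choose a missing edge with the fewest vertices to its left. For \<open>v\<close> on the
  left, the chords \<open>a v\<close> and \<open>v b\<close> cut off fewer, so they are edges. Two
  such \<open>v\<close> would give crossing edges, and without any \<open>v\<close> nothing could
  block \<open>a b\<close>.\<close>

lemma convex_position_ear:
  assumes empty: "inner = {}" and "card S \<ge> 4"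
  obtains a b v where "a \<in> S" "b \<in> S" "{a, b} \<notin> T" "left a b = {v}"
proof -
  have out: "outer = S"
    using empty outer_subset by (auto simp: inner_def)
  define P where "P z \<longleftrightarrow> fst z \<in> S \<and> snd z \<in> S \<and> fst z \<noteq> snd z \<and> {fst z, snd z} \<notin> T" for z
  obtain a0 b0 where "a0 \<in> S" "b0 \<in> S" "a0 \<noteq> b0" "{a0, b0} \<notin> T"
    using convex_position_non_edge[OF assms] by metis
  then have "P (a0, b0)"
    by (simp add: P_def)
  then obtain z where z: "P z" "\<And>y. P y \<Longrightarrow> card (left (fst z) (snd z)) \<le> card (left (fst y) (snd y))"
    using ex_has_least_nat[of P "(a0, b0)" "\<lambda>z. card (left (fst z) (snd z))"] by blast
  define a b where "a = fst z" and "b = snd z"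
  have ab: "a \<in> S" "b \<in> S" "a \<noteq> b" "{a, b} \<notin> T"
    using z(1) by (simp_all add: P_def a_def b_def)
  have least: "card (left a b) \<le> card (left p q)" if "p \<in> S" "q \<in> S" "p \<noteq> q" "{p, q} \<notin> T" for p q
    using z(2)[of "(p, q)"] that by (simp add: P_def a_def b_def)
  have fin: "finite (left p q)" for p q
    using finS by (simp add: left_def)
  have edge: "{p, q} \<in> T" if "p \<in> S" "q \<in> S" "p \<noteq> q" "left p q \<subset> left a b" for p q
  proof (rule ccontr)
    assume "{p, q} \<notin> T"
    then have "card (left a b) \<le> card (left p q)"
      using least[of p q] that by blast
    then show False
      using psubset_card_mono[OF fin that(4)] by simp
  qed
  have right: "det3 a b s < 0" if "s \<in> S" "\<not> det3 a b s > 0" "s \<noteq> a" "s \<noteq> b" for s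
    using gp[OF ab(1,2) that(1)] ab(3) that by force
  have av: "{a, v} \<in> T" and bv: "{v, b} \<in> T" if v: "v \<in> left a b" for v
  proof -
    have v: "v \<in> S" "det3 a b v > 0" "v \<noteq> a" "v \<noteq> b"
      using v by (auto simp: left_def)
    have *: "det3 v s a < 0" "det3 v s b > 0" if "s \<in> S" "det3 a b s < 0" for s
      using convex_quadrilateral[of a b v s] ab v that out by auto
    have "left a v \<subseteq> left a b"
    proof
      fix s assume "s \<in> left a v"
      then have s: "s \<in> S" "det3 a v s > 0"
        by (simp_all add: left_def)
      have "det3 a b s > 0"
      proof (rule ccontr)
        assume "\<not> ?thesis"
        moreover have "s \<noteq> a" "s \<noteq> b"
          using s(2) v(2) det3_swap'[of a v b] by auto
        ultimately show False
          using *(1)[OF s(1) right[OF s(1)]] s(2) det3_rot[of v s a] by simp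
      qed
      then show "s \<in> left a b"
        using s by (simp add: left_def)
    qed
    moreover have "v \<in> left a b" "v \<notin> left a v"
      using v by (simp_all add: left_def)
    ultimately show "{a, v} \<in> T"
      using edge[OF ab(1) v(1)] v(3) by blast
    have "left v b \<subseteq> left a b"
    proof
      fix s assume "s \<in> left v b"
      then have s: "s \<in> S" "det3 v b s > 0"
        by (simp_all add: left_def)
      have "det3 a b s > 0"
      proof (rule ccontr)
        assume "\<not> ?thesis"
        moreover have "s \<noteq> a" "s \<noteq> b"
          using s(2) v(2) det3_rot[of v b a] det3_swap'[of a v b] by auto
        ultimately show False
          using *(2)[OF s(1) right[OF s(1)]] s(2) det3_swap'[of v s b] by simp
      qed
      then show "s \<in> left a b"
        using s by (simp add: left_def)
    qed
    moreover have "v \<in> left a b" "v \<notin> left v b"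
      using v by (simp_all add: left_def)
    ultimately show "{v, b} \<in> T"
      using edge[OF v(1) ab(2) v(4)] by blast
  qed
  have unique: False if v: "v \<in> left a b" "v' \<in> left a b" "det3 a v v' > 0" for v v'
  proof -
    have S: "v \<in> S" "v' \<in> S" "det3 a b v > 0"
      using v by (simp_all add: left_def)
    have "det3 a v b * det3 a v v' < 0"
      using S(3) v(3) det3_swap'[of a v b] by (simp add: mult_less_0_iff)
    then show False
      using separated_edges[of a v b v'] av[OF v(1)] bv[OF v(2)] ab S out by (simp add: insert_commute)
  qed
  have uniq: "v = v'" if v: "v \<in> left a b" "v' \<in> left a b" for v v'
  proof (rule ccontr)
    assume "v \<noteq> v'"
    moreover have "v \<in> S" "v' \<in> S" "a \<noteq> v" "a \<noteq> v'"
      using v by (auto simp: left_def)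
    ultimately have "det3 a v v' \<noteq> 0"
      using gp[of a v v'] ab(1) by blast
    then have "det3 a v v' > 0 \<or> det3 a v' v > 0"
      using det3_swap'[of a v v'] by linarith
    then show False
      using unique v by blast
  qed
  obtain c d where cd: "{c, d} \<in> T" "{c, d} \<inter> {a, b} = {}" "closed_segment c d \<inter> closed_segment a b \<noteq> {}"
    using maximal[OF ab] by blast
  have cd_S: "c \<in> S" "d \<in> S" "c \<noteq> d"
    using edgeD[OF cd(1)] by auto
  have "left a b \<noteq> {}"
  proof
    assume "left a b = {}"
    then have no_left: "\<not> det3 a b s > 0" if "s \<in> S" for s
      using that unfolding left_def by blast
    have neg: "det3 a b c < 0" "det3 a b d < 0"
      using right[of c] right[of d] no_left cd_S cd(2) by blast+
    obtain x where x: "x \<in> closed_segment c d" "det3 a b x = 0"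
      using cd(3) det3_closed_segment by blast
    obtain l where l: "x = c + l *\<^sub>R (d - c)" "0 \<le> l" "l \<le> 1"
      using x(1) by (rule in_closed_segmentE)
    have "det3 a b x = (1 - l) * det3 a b c + l * det3 a b d"
      unfolding l(1) det3_def by (simp add: algebra_simps)
    moreover have "\<dots> < 0"
      using neg l by (intro convex_bound_lt) auto
    ultimately show False
      using x(2) by simp
  qed
  then obtain v where "v \<in> left a b"
    by blast
  then have "left a b = {v}"
    using uniq by blast
  then show ?thesis
    using that[OF ab(1,2,4)] by blast
qed

text \<open>Push the tip \<open>v\<close> of the ear onto the midpoint of \<open>a b\<close>. The
  other vertices stay exposed, and only the segment \<open>a b\<close> could be in the way of
  \<open>v\<close>, but it is not an edge. So the motion stays plane as long as it is
  \<open>weak_type\<close>, and \<open>reachable_extend\<close> preserves the order type, although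
  the triple \<open>a b v\<close> ends flat.\<close>

lemma not_convex_position:
  assumes empty: "inner = {}" and "card S \<ge> 4"
  shows False
proof -
  have out: "outer = S"
    using empty outer_subset by (auto simp: inner_def)
  obtain a b v where ab: "a \<in> S" "b \<in> S" "{a, b} \<notin> T" and ear: "left a b = {v}"
    using convex_position_ear[OF assms] by metis
  have v: "v \<in> S" "det3 a b v > 0"
    using ear by (auto simp: left_def)
  then have ne: "a \<noteq> b" "v \<noteq> a" "v \<noteq> b"
    by auto
  have right: "det3 a b s < 0" if "s \<in> S" "s \<noteq> a" "s \<noteq> b" "s \<noteq> v" for s
  proof -
    have "s \<notin> left a b"
      using ear that(4) by simp
    then show ?thesis
      using gp[OF ab(1,2) that(1)] ne that(1-3) by (force simp: left_def)
  qed
  define m where "m = (1/2) *\<^sub>R a + (1/2) *\<^sub>R b"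
  define \<delta> where "\<delta> t = id(v := v + t *\<^sub>R (m - v))" for t :: real
  have \<delta>v: "\<delta> t v = (1 - t) *\<^sub>R v + (t / 2) *\<^sub>R a + (t / 2) *\<^sub>R b" for t
    by (simp add: \<delta>_def m_def algebra_simps)
  have \<delta>s: "\<delta> t s = s" if "s \<noteq> v" for t s
    using that by (simp add: \<delta>_def)
  \<comment> \<open>The functional exposing \<open>h\<close> in \<open>S\<close> continues to do so:
    \<open>\<delta> t v\<close> is a convex combination of \<open>v\<close> and the midpoint, both
    strictly below the level of \<open>h\<close>.\<close>
  have exposed: "\<exists>g. (\<forall>s\<in>S - {h}. g \<bullet> \<delta> t s < g \<bullet> h)" if h: "h \<in> S" "h \<noteq> v" and t: "0 \<le> t" "t \<le> 1" for h t
  proof -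
    obtain g where g: "\<forall>s\<in>S - {h}. g \<bullet> s < g \<bullet> h"
    proof -
      have "h \<in> outer"
        using h(1) out by simp
      then show thesis
        using that unfolding outer_def by blast
    qed
    have le: "g \<bullet> s \<le> g \<bullet> h" if "s \<in> S" for s
      using bspec[OF g, of s] that by (cases "s = h") auto
    have lt: "g \<bullet> v < g \<bullet> h" "g \<bullet> a < g \<bullet> h \<or> g \<bullet> b < g \<bullet> h"
      using bspec[OF g, of v] bspec[OF g, of a] bspec[OF g, of b] v(1) ab ne h by auto
    have \<delta>v_g: "g \<bullet> \<delta> t v = (1 - t) * (g \<bullet> v) + t * ((1/2) * (g \<bullet> a) + (1/2) * (g \<bullet> b))"
      unfolding \<delta>v by (simp add: inner_add_right algebra_simps)
    have mid: "(1/2) * (g \<bullet> a) + (1/2) * (g \<bullet> b) < g \<bullet> h"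
      using lt(2) le[OF ab(1)] le[OF ab(2)] by linarith
    have "(1 - t) * (g \<bullet> v) + t * ((1/2) * (g \<bullet> a) + (1/2) * (g \<bullet> b)) < g \<bullet> h"
      using t by (intro convex_bound_lt[OF lt(1) mid]) auto
    then have "g \<bullet> \<delta> t s < g \<bullet> h" if "s \<in> S - {h}" for s
      using bspec[OF g that] \<delta>s[of s t] \<delta>v_g by (cases "s = v") auto
    then show ?thesis
      by blast
  qed
  have inj: "\<delta> t s \<noteq> \<delta> t h" if h: "h \<in> S" "s \<in> S" "s \<noteq> h" "h \<noteq> v" and t: "0 \<le> t" "t \<le> 1" for h s t
    using exposed[OF h(1,4) t] \<delta>s[OF h(4)] h(2,3) by fastforce
  have "reachable (\<delta> 1)"
  proof (rule reachable_extend[OF reachable_id])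
    show "\<delta> 0 = id"
      by (auto simp: \<delta>_def)
    show "path (\<lambda>t. \<delta> t s)" if "s \<in> S" for s
      unfolding path_def \<delta>_def fun_upd_apply
      by (cases "s = v") (auto intro!: continuous_intros)
    fix t :: real assume "t \<in> {0..1}" and weak: "weak_type S (\<delta> t)"
    then have t: "0 \<le> t" "t \<le> 1"
      by auto
    show "plane_config S T (\<delta> t)"
    proof (rule weak_type_plane_config[OF weak])
      show "\<delta> t x \<noteq> \<delta> t y" if "x \<in> S" "y \<in> S" "x \<noteq> y" for x y
        using inj[of y x t] inj[of x y t] that t by (cases "y = v") auto
      fix c d s assume cd: "{c, d} \<in> T" and s: "s \<in> S" "s \<noteq> c" "s \<noteq> d"
      have cd_S: "c \<in> S" "d \<in> S" "c \<noteq> d"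
        using edgeD[OF cd] by auto
      show "\<delta> t s \<notin> closed_segment (\<delta> t c) (\<delta> t d)"
      proof (cases "s = v")
        case False
        show ?thesis
        proof
          assume "\<delta> t s \<in> closed_segment (\<delta> t c) (\<delta> t d)"
          then obtain l where l: "s = (1 - l) *\<^sub>R \<delta> t c + l *\<^sub>R \<delta> t d" "0 \<le> l" "l \<le> 1"
            unfolding in_segment \<delta>s[OF False] by blast
          obtain g where g: "\<forall>x\<in>S - {s}. g \<bullet> \<delta> t x < g \<bullet> s"
            using exposed[OF s(1) False t] by blast
          have "g \<bullet> \<delta> t c < g \<bullet> s" "g \<bullet> \<delta> t d < g \<bullet> s"
            using bspec[OF g, of c] bspec[OF g, of d] cd_S s by auto
          then have "(1 - l) * (g \<bullet> \<delta> t c) + l * (g \<bullet> \<delta> t d) < g \<bullet> s"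
            using l by (intro convex_bound_lt) auto
          then show False
            using arg_cong[OF l(1), of "\<lambda>x. g \<bullet> x"] by (simp add: inner_add_right)
        qed
      next
        case True
        \<comment> \<open>The moving \<open>v\<close> never passes to the right of
          \<open>a b\<close>, and all other vertices lie on the line or to its right. So
          \<open>v\<close> can be met only by an edge with both ends on the line, which would be
          \<open>a b\<close> itself.\<close>
        have le: "det3 a b x \<le> 0" "x \<noteq> a \<Longrightarrow> x \<noteq> b \<Longrightarrow> det3 a b x < 0" if "x \<in> S" "x \<noteq> v" for x
          using right[of x] that by (cases "x = a \<or> x = b"; auto)+
        have cv: "c \<noteq> v" "d \<noteq> v"
          using s True by auto
        have "det3 a b (\<delta> t v) = (1 - t) * det3 a b v"
          unfolding \<delta>v det3_def by (simp add: field_simps)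
        then have nonneg: "det3 a b (\<delta> t v) \<ge> 0"
          using t v(2) by simp
        have "\<delta> t v \<notin> closed_segment c d"
        proof
          assume "\<delta> t v \<in> closed_segment c d"
          then obtain l where l: "\<delta> t v = c + l *\<^sub>R (d - c)" "0 \<le> l" "l \<le> 1"
            by (rule in_closed_segmentE)
          have "\<delta> t v \<noteq> c" "\<delta> t v \<noteq> d"
            using inj[OF cd_S(1) v(1) _ cv(1) t] inj[OF cd_S(2) v(1) _ cv(2) t] cv \<delta>s by auto
          then have "l \<noteq> 0" "l \<noteq> 1"
            using l(1) by auto
          have "det3 a b (\<delta> t v) = (1 - l) * det3 a b c + l * det3 a b d"
            unfolding l(1) det3_def by (simp add: algebra_simps)
          moreover have "(1 - l) * det3 a b c \<le> 0" "l * det3 a b d \<le> 0"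
            using le(1)[OF cd_S(1) cv(1)] le(1)[OF cd_S(2) cv(2)] l by (auto intro: mult_nonneg_nonpos)
          ultimately have "(1 - l) * det3 a b c = 0" "l * det3 a b d = 0"
            using nonneg by linarith+
          then have "det3 a b c = 0" "det3 a b d = 0"
            using \<open>l \<noteq> 0\<close> \<open>l \<noteq> 1\<close> by auto
          then have "c = a \<or> c = b" "d = a \<or> d = b"
            using le(2)[OF cd_S(1) cv(1)] le(2)[OF cd_S(2) cv(2)] by linarith+
          then have "{c, d} = {a, b}"
            using cd_S(3) by auto
          then show False
            using cd ab(3) by simp
        qed
        then show ?thesis
          using True cv \<delta>s by simp
      qed
    qed
  qed
  then have "det3 a b v * det3 (\<delta> 1 a) (\<delta> 1 b) (\<delta> 1 v) > 0"
    using same_typeD[OF reachable_same_type] ab v(1) ne by blast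
  moreover have "det3 (\<delta> 1 a) (\<delta> 1 b) (\<delta> 1 v) = 0"
    using ne by (simp add: \<delta>s \<delta>v det3_def field_simps)
  ultimately show False
    by simp
qed

text \<open>With an inner vertex present there are at most three extreme points, and at least three,
  since two could not be the only exits of the inner vertices. With exactly three, five vertices
  leave the two inner ones that the triangular case requires.\<close>

lemma contradiction:
  assumes "card S \<ge> 5"
  shows False
proof (cases "inner = {}")
  case True
  then show ?thesis
    using not_convex_position assms by simp
next
  case False
  have "card outer < 4"
    using inner_empty_if_many_outer False by (meson not_less)
  moreover obtain A B C where ABC: "A \<in> outer" "B \<in> outer" "C \<in> outer" "A \<noteq> B" "A \<noteq> C" "B \<noteq> C"
  proof -
    have "\<not> outer \<subseteq> {e, e'}" for e e'
    proof
      assume "outer \<subseteq> {e, e'}"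
      then have "nb u \<subseteq> inner \<union> {e, e'}" for u
        using nbD(2) S_cases by blast
      then show False
        using inner_set_boundary[of inner e e'] False by blast
    qed
    then show ?thesis
      using three_elements that by metis
  qed
  moreover have fin: "finite outer" "finite inner"
    using finS by (simp_all add: outer_def inner_def)
  ultimately have out: "outer = {A, B, C}"
    using card_seteq[of outer "{A, B, C}"] by simp
  have "card S = card outer + card inner"
    using card_Un_disjoint[OF fin] outer_subset by (simp add: inner_def Un_absorb1)
  then have two: "card inner \<ge> 2"
    using assms \<open>card outer < 4\<close> by simp
  have "det3 A B C \<noteq> 0"
    using gp[of A B C] ABC outer_S by blast
  then consider "det3 A B C > 0" | "det3 B A C > 0"
    using det3_swap[of B A C] by linarith
  then show ?thesis
  proof cases
    case 1
    interpret triangular_graph S T A B C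
      by unfold_locales (use out two 1 in auto)
    show ?thesis
      by (rule impossible)
  next
    case 2
    interpret triangular_graph S T B A C
      by unfold_locales (use out two 2 in auto)
    show ?thesis
      by (rule impossible)
  qed
qed

end

text \<open>Additional edges only restrict the isotopies that have to be considered.\<close>

lemma supporting_mono:
  assumes "supporting S E" "E \<subseteq> T"
  shows "supporting S T"
  unfolding supporting_def
proof (intro allI impI)
  fix F
  assume "ambient_isotopy F \<and> (\<forall>t\<in>{0..1}. (\<forall>e\<in>T. \<exists>a b. F t ` (convex hull e) = closed_segment a b)
    \<and> no_four_collinear (F t ` S))"
  then have "ambient_isotopy F \<and> (\<forall>t\<in>{0..1}. (\<forall>e\<in>E. \<exists>a b. F t ` (convex hull e) = closed_segment a b)
    \<and> no_four_collinear (F t ` S))"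
    using assms(2) by blast
  then show "\<forall>t\<in>{0..1}. general_position (F t ` S) \<longrightarrow> same_order_type S (F t)"
    using assms(1)[unfolded supporting_def] by (elim allE impE)
qed

theorem theorem5:
  fixes S :: "point set" and E :: "point set set"
  assumes "finite S" and "card S \<ge> 9" and "general_position S"
    and "geometric_graph_on S E" and "supporting S E"
  shows "has_crossing E"
proof (rule ccontr)
  assume no_crossing: "\<not> has_crossing E"
  define plane where "plane T \<longleftrightarrow> geometric_graph_on S T \<and>
    (\<forall>a b c d. {a, b} \<in> T \<longrightarrow> {c, d} \<in> T \<longrightarrow> {a, b} \<inter> {c, d} = {} \<longrightarrow> closed_segment a b \<inter> closed_segment c d = {})"
    for T
  have no_crossing': "\<forall>e\<in>E. \<forall>e'\<in>E. e \<noteq> e' \<longrightarrow> (convex hull e) \<inter> (convex hull e') - (e \<inter> e') = {}"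
    using no_crossing unfolding has_crossing_def by blast
  have "plane E"
    unfolding plane_def
  proof (intro conjI allI impI)
    show "geometric_graph_on S E"
      by fact
    fix a b c d assume e: "{a, b} \<in> E" "{c, d} \<in> E" and dis: "{a, b} \<inter> {c, d} = {}"
    have "{a, b} \<noteq> {c, d}"
      using dis by (metis Int_absorb insert_not_empty)
    then have "convex hull {a, b} \<inter> convex hull {c, d} - {a, b} \<inter> {c, d} = {}"
      using bspec[OF bspec[OF no_crossing' e(1)] e(2)] by simp
    then show "closed_segment a b \<inter> closed_segment c d = {}"
      using dis by (simp add: segment_convex_hull)
  qed
  \<comment> \<open>There are only finitely many graphs on \<open>S\<close>, so \<open>E\<close> is
    contained in a maximal plane one.\<close>
  moreover have "finite {T. plane T}"
  proof (rule finite_subset)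
    show "{T. plane T} \<subseteq> Pow (Pow S)"
    proof (intro subsetI PowI)
      fix T e s assume "T \<in> {T. plane T}" "e \<in> T" "s \<in> e"
      then have "geometric_graph_on S T"
        by (simp add: plane_def)
      then obtain p q where "p \<in> S" "q \<in> S" "e = {p, q}"
        using \<open>e \<in> T\<close> unfolding geometric_graph_on_def by metis
      then show "s \<in> S"
        using \<open>s \<in> e\<close> by blast
    qed
  qed (use assms(1) in simp)
  ultimately obtain T where T: "plane T" "E \<subseteq> T" and max: "\<And>T'. plane T' \<Longrightarrow> T \<subseteq> T' \<Longrightarrow> T' = T"
    using finite_has_maximal2[of "{T. plane T}" E] by (metis mem_Collect_eq)
  have graph: "geometric_graph_on S T"
    using T(1) by (simp add: plane_def)
  have noncross: "closed_segment a b \<inter> closed_segment c d = {}"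
    if "{a, b} \<in> T" "{c, d} \<in> T" "{a, b} \<inter> {c, d} = {}" for a b c d
    by (rule conjunct2[OF T(1)[unfolded plane_def], rule_format, OF that])
  interpret plane_graph S T
  proof
    show "det3 a b c \<noteq> 0" if "a \<in> S" "b \<in> S" "c \<in> S" "a \<noteq> b" "a \<noteq> c" "b \<noteq> c" for a b c
      using assms(3) that unfolding general_position_def collinear_iff_det3 by blast
  qed (use assms graph noncross in auto)
  interpret maximal_supporting_graph S T
  proof
    show "supporting S T"
      using supporting_mono[OF assms(5) T(2)] .
    fix u v assume uv: "u \<in> S" "v \<in> S" "u \<noteq> v" "{u, v} \<notin> T"
    show "\<exists>a b. {a, b} \<in> T \<and> {a, b} \<inter> {u, v} = {} \<and> closed_segment a b \<inter> closed_segment u v \<noteq> {}"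
    proof (rule ccontr)
      assume none: "\<not> ?thesis"
      have free: "closed_segment a b \<inter> closed_segment c d = {}"
        if "{a, b} \<in> T" "{a, b} \<inter> {c, d} = {}" "{c, d} = {u, v}" for a b c d
      proof -
        have "closed_segment c d = closed_segment u v"
          using that(3) by (simp add: segment_convex_hull)
        then show ?thesis
          using none that by metis
      qed
      have "plane (insert {u, v} T)"
        unfolding plane_def
      proof (intro conjI allI impI)
        show "geometric_graph_on S (insert {u, v} T)"
          using graph uv unfolding geometric_graph_on_def by blast
        fix a b c d assume e: "{a, b} \<in> insert {u, v} T" "{c, d} \<in> insert {u, v} T"
          and dis: "{a, b} \<inter> {c, d} = {}"
        show "closed_segment a b \<inter> closed_segment c d = {}"
        proof (cases "{a, b} = {u, v}")
          case True
          then have "{c, d} \<in> T" "{c, d} \<inter> {a, b} = {}"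
            using e(2) dis by blast+
          then show ?thesis
            using free[of c d a b] True by (simp add: Int_commute)
        next
          case ab: False
          show ?thesis
          proof (cases "{c, d} = {u, v}")
            case True
            then show ?thesis
              using free[of a b c d] e(1) ab dis by blast
          next
            case False
            then show ?thesis
              using noncross[of a b c d] e ab dis by blast
          qed
        qed
      qed
      then show False
        using max[of "insert {u, v} T"] uv(4) by blast
    qed
  qed
  show False
    using contradiction assms(2) by simp
qed

end
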